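(* Let $V$ be a vertex operator algebra, $z\in\mathbb C^\times$, $W_1,W_2$ generalized $V$-modules and $W_3$ an ordinary (respectively generalized) $V$-module, and let $F$ be a quasi-$P(z)$-intertwining map of type $\binom{W_3}{W_1\,W_2}$. Then for every $\alpha\in W_3'$, the element $F^\vee(\alpha)\in(W_1\otimes W_2)^*$ satisfies the lower truncation condition and the Jacobi identity with respect to $\tau_{P(z)}$. Consequently $F^\vee(W_3')\subset(W_1\otimes W_2)^*$ is an ordinary (respectively generalized) $V$-module under $\tau_{P(z)}$, and $F^\vee:W_3'\to F^\vee(W_3')$ is a homomorphism of ordinary (respectively generalized) $V$-modules. Conversely, every subspace $M\subset(W_1\otimes W_2)^*$ which is an ordinary (respectively generalized) $V$-module under $\tau_{P(z)}$ equals $F^\vee(W_3')$ for some ordinary (respectively generalized) $V$-module $W_3$ and some quasi-$P(z)$-intertwining map $F$ of type $\binom{W_3}{W_1\,W_2}$.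
   Context: $V$ is a vertex operator algebra with vertex operator map $Y$, vacuum $\mathbf 1$, conformal vector $\omega$, $Y(\omega,x)=\sum_n L(n)x^{-n-2}$. A weak $V$-module is a module for $V$ regarded as a vertex algebra. A generalized $V$-module is a weak $V$-module $W=\coprod_{n\in\mathbb C}W_{[n]}$ with $W_{[n]}$ the generalized $L(0)$-eigenspace of eigenvalue $n$, each $W_{[n]}$ finite-dimensional and $W_{[n+k]}=0$ for integers $k$ sufficiently negative; it is ordinary if $L(0)$ is semisimple. $\overline W=\prod_n W_{[n]}$. The contragredient is $W'=\coprod_n W_{[n]}^*$ with $\langle Y'(v,x)\alpha,w\rangle=\langle\alpha,Y^o(v,x)w\rangle$, $Y^o(v,x)=Y(e^{xL(1)}(-x^{-2})^{L(0)}v,x^{-1})$. A quasi-$P(z)$-intertwining map of type $\binom{W_3}{W_1\,W_2}$ is a linear map $F:W_1\otimes W_2\to\overline W_3$ with $Y_3(v,x_1)F(w_{(1)}\otimes w_{(2)})-F(w_{(1)}\otimes Y_2(v,x_1)w_{(2)})=\mathrm{Res}_{x_0}z^{-1}\delta\!\left(\frac{x_1-x_0}{z}\right)F(Y_1(v,x_0)w_{(1)}\otimes w_{(2)})$ for all $v,w_{(1)},w_{(2)}$. $F^\vee:W_3'\to(W_1\otimes W_2)^*$ is defined by $\langle F^\vee(\alpha),w_{(1)}\otimes w_{(2)}\rangle=\langle\alpha,F(w_{(1)}\otimes w_{(2)})\rangle$. The action $\tau_{P(z)}$ on $(W_1\otimes W_2)^*$ is given by $\tau_{P(z)}(Y_t(v,x))=\sum_n\tau_{P(z)}(v\otimes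 t^n)x^{-n-1}$ with $(\tau_{P(z)}(Y_t(v,x_1))\lambda)(w_{(1)}\otimes w_{(2)})=\mathrm{Res}_{x_0}z^{-1}\delta\!\left(\frac{x_1^{-1}-x_0}{z}\right)\lambda(Y_1(e^{x_1L(1)}(-x_1^{-2})^{L(0)}v,x_0)w_{(1)}\otimes w_{(2)})+\lambda(w_{(1)}\otimes Y_2^o(v,x_1)w_{(2)})$. $\lambda$ satisfies the lower truncation condition if $\tau_{P(z)}(Y_t(v,x))\lambda$ has only finitely many negative... more precisely $\tau_{P(z)}(v\otimes t^n)\lambda=0$ for $n$ sufficiently large, for each $v$; it satisfies the Jacobi identity if for all $u,v\in V$: $x_0^{-1}\delta(\frac{x_1-x_2}{x_0})\tau(Y_t(u,x_1))\tau(Y_t(v,x_2))\lambda-x_0^{-1}\delta(\frac{x_2-x_1}{-x_0})\tau(Y_t(v,x_2))\tau(Y_t(u,x_1))\lambda=x_2^{-1}\delta(\frac{x_1-x_0}{x_2})\tau(Y_t(Y(u,x_0)v,x_2))\lambda$ (with $\tau=\tau_{P(z)}$). A subspace is a $V$-module under $\tau_{P(z)}$ if it is $\tau_{P(z)}$-stable and, with $v_n$ acting as $\tau_{P(z)}(v\otimes t^n)$, is an ordinary (resp. generalized) $V$-module. *)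

theory Defs
  imports Complex_Main "HOL-Library.Function_Algebras"
begin

class cvec = ab_group_add +
  fixes cscale :: "complex \<Rightarrow> 'a \<Rightarrow> 'a"  (infixr \<open>*\<^sub>C\<close> 75)
  assumes cscale_right_distrib: "a *\<^sub>C (x + y) = a *\<^sub>C x + a *\<^sub>C y"
    and cscale_left_distrib: "(a + b) *\<^sub>C x = a *\<^sub>C x + b *\<^sub>C x"
    and cscale_assoc: "a *\<^sub>C (b *\<^sub>C x) = (a * b) *\<^sub>C x"
    and cscale_one: "1 *\<^sub>C x = x"

instantiation complex :: cvec
begin
definition cscale_complex :: "complex \<Rightarrow> complex \<Rightarrow> complex" where
  "cscale_complex a x = a * x"
instance by standard (auto simp: cscale_complex_def algebra_simps)
end

instantiation "fun" :: (type, cvec) cvec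
begin
definition cscale_fun :: "complex \<Rightarrow> ('a \<Rightarrow> 'b) \<Rightarrow> 'a \<Rightarrow> 'b" where
  "cscale_fun a f = (\<lambda>x. a *\<^sub>C f x)"
instance by standard
  (auto simp: cscale_fun_def cscale_right_distrib cscale_left_distrib cscale_assoc cscale_one)
end

text \<open>Finitely supported sum: the sum of all nonzero values (0 if there are
  infinitely many; in all uses below the support is finite).\<close>
definition fsum :: "('i \<Rightarrow> 'a::comm_monoid_add) \<Rightarrow> 'a" where
  "fsum f = sum f {i. f i \<noteq> 0}"

definition csubspace :: "'a::cvec set \<Rightarrow> bool" where
  "csubspace W \<longleftrightarrow> 0 \<in> W \<and> (\<forall>x\<in>W. \<forall>y\<in>W. x + y \<in> W) \<and> (\<forall>c. \<forall>x\<in>W. c *\<^sub>C x \<in> W)"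

definition clinear_on :: "'a::cvec set \<Rightarrow> ('a \<Rightarrow> 'b::cvec) \<Rightarrow> bool" where
  "clinear_on W f \<longleftrightarrow> (\<forall>x\<in>W. \<forall>y\<in>W. f (x + y) = f x + f y) \<and> (\<forall>c. \<forall>x\<in>W. f (c *\<^sub>C x) = c *\<^sub>C f x)"

definition cspan :: "'a::cvec set \<Rightarrow> 'a set" where
  "cspan S = {x. \<exists>T c. finite T \<and> T \<subseteq> S \<and> x = (\<Sum>t\<in>T. c t *\<^sub>C t)}"

definition fin_dim :: "'a::cvec set \<Rightarrow> bool" where
  "fin_dim W \<longleftrightarrow> (\<exists>S. finite S \<and> S \<subseteq> W \<and> W \<subseteq> cspan S)"

definition eigensp :: "'a::cvec set \<Rightarrow> ('a \<Rightarrow> 'a) \<Rightarrow> complex \<Rightarrow> 'a set" where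
  "eigensp W T n = {w\<in>W. T w = n *\<^sub>C w}"

definition gen_eigensp :: "'a::cvec set \<Rightarrow> ('a \<Rightarrow> 'a) \<Rightarrow> complex \<Rightarrow> 'a set" where
  "gen_eigensp W T n = {w\<in>W. \<exists>k. ((\<lambda>x. T x - n *\<^sub>C x) ^^ k) w = 0}"

definition decomp :: "'a::cvec set \<Rightarrow> ('a \<Rightarrow> 'a) \<Rightarrow> 'a \<Rightarrow> complex \<Rightarrow> 'a" where
  "decomp W T w = (THE f. (\<forall>n. f n \<in> gen_eigensp W T n) \<and> finite {n. f n \<noteq> 0} \<and> w = fsum f)"

definition gbin :: "int \<Rightarrow> nat \<Rightarrow> complex" where
  "gbin n k = (of_int n :: complex) gchoose k"

text \<open>A vertex operator map is given by its modes: \<open>Y v n w\<close> is \<open>v\<^sub>n w\<close>, i.e.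
  \<open>Y(v,x) w = \<Sum>\<^sub>n (v\<^sub>n w) x\<^sup>-\<^sup>n\<^sup>-\<^sup>1\<close>.  The Jacobi identity is stated through its
  coefficient of \<open>x\<^sub>0\<^sup>-\<^sup>l\<^sup>-\<^sup>1 x\<^sub>1\<^sup>-\<^sup>m\<^sup>-\<^sup>1 x\<^sub>2\<^sup>-\<^sup>n\<^sup>-\<^sup>1\<close> (all \<open>l,m,n\<close>).\<close>
definition borcherds ::
  "'v::cvec set \<Rightarrow> ('v \<Rightarrow> int \<Rightarrow> 'v \<Rightarrow> 'v) \<Rightarrow> 'w::cvec set \<Rightarrow> ('v \<Rightarrow> int \<Rightarrow> 'w \<Rightarrow> 'w) \<Rightarrow> bool" where
  "borcherds V Y W YW \<longleftrightarrow>
    (\<forall>u\<in>V. \<forall>v\<in>V. \<forall>w\<in>W. \<forall>l m n :: int.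
      fsum (\<lambda>i::nat. gbin m i *\<^sub>C YW (Y u (l + int i) v) (m + n - int i) w)
      = fsum (\<lambda>i::nat. ((-1) ^ i * gbin l i) *\<^sub>C
           (YW u (m + l - int i) (YW v (n + int i) w)
            - ((-1) powi l) *\<^sub>C YW v (n + l - int i) (YW u (m + int i) w))))"

definition weak_module ::
  "'v::cvec set \<Rightarrow> ('v \<Rightarrow> int \<Rightarrow> 'v \<Rightarrow> 'v) \<Rightarrow> 'v \<Rightarrow> 'w::cvec set \<Rightarrow> ('v \<Rightarrow> int \<Rightarrow> 'w \<Rightarrow> 'w) \<Rightarrow> bool" where
  "weak_module V Y vac W YW \<longleftrightarrow>
    csubspace W
    \<and> (\<forall>v\<in>V. \<forall>n. \<forall>w\<in>W. YW v n w \<in> W)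
    \<and> (\<forall>v\<in>V. \<forall>n. clinear_on W (YW v n))
    \<and> (\<forall>w\<in>W. \<forall>n. clinear_on V (\<lambda>v. YW v n w))
    \<and> (\<forall>v\<in>V. \<forall>w\<in>W. \<exists>N. \<forall>n\<ge>N. YW v n w = 0)
    \<and> (\<forall>w\<in>W. \<forall>n. YW vac n w = (if n = -1 then w else 0))
    \<and> borcherds V Y W YW"

text \<open>Vertex operator algebra; \<open>L(n) = \<omega>\<^sub>n\<^sub>+\<^sub>1\<close>, \<open>V\<^sub>(\<^sub>n\<^sub>)\<close> the \<open>L(0)\<close>-eigenspaces.\<close>
definition is_VOA :: "'v::cvec set \<Rightarrow> ('v \<Rightarrow> int \<Rightarrow> 'v \<Rightarrow> 'v) \<Rightarrow> 'v \<Rightarrow> 'v \<Rightarrow> bool" where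
  "is_VOA V Y vac \<omega> \<longleftrightarrow>
    csubspace V \<and> vac \<in> V \<and> \<omega> \<in> V
    \<and> weak_module V Y vac V Y
    \<and> (\<forall>v\<in>V. \<forall>n\<ge>0. Y v n vac = 0)
    \<and> (\<forall>v\<in>V. Y v (-1) vac = v)
    \<and> (\<exists>c::complex. \<forall>m n :: int. \<forall>v\<in>V.
         Y \<omega> (m + 1) (Y \<omega> (n + 1) v) - Y \<omega> (n + 1) (Y \<omega> (m + 1) v)
         = of_int (m - n) *\<^sub>C Y \<omega> (m + n + 1) v
           + (if m + n = 0 then (((of_int m) ^ 3 - of_int m) / 12 * c) *\<^sub>C v else 0))
    \<and> (\<forall>u\<in>V. \<forall>n. \<forall>w\<in>V. Y (Y \<omega> 0 u) n w = (- of_int n) *\<^sub>C Y u (n - 1) w)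
    \<and> (\<forall>v\<in>V. \<exists>f :: int \<Rightarrow> 'v. finite {n. f n \<noteq> 0}
          \<and> (\<forall>n. f n \<in> eigensp V (Y \<omega> 1) (of_int n)) \<and> v = fsum f)
    \<and> (\<forall>n::int. fin_dim (eigensp V (Y \<omega> 1) (of_int n)))
    \<and> (\<exists>N::int. \<forall>n<N. eigensp V (Y \<omega> 1) (of_int n) = {0})"

definition gen_module ::
  "bool \<Rightarrow> 'v::cvec set \<Rightarrow> ('v \<Rightarrow> int \<Rightarrow> 'v \<Rightarrow> 'v) \<Rightarrow> 'v \<Rightarrow> 'v \<Rightarrow>
   'w::cvec set \<Rightarrow> ('v \<Rightarrow> int \<Rightarrow> 'w \<Rightarrow> 'w) \<Rightarrow> bool" where
  "gen_module ordinary V Y vac \<omega> W YW \<longleftrightarrow>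
    weak_module V Y vac W YW
    \<and> (\<forall>w\<in>W. \<exists>f :: complex \<Rightarrow> 'w. finite {n. f n \<noteq> 0}
          \<and> (\<forall>n. f n \<in> gen_eigensp W (YW \<omega> 1) n) \<and> w = fsum f)
    \<and> (\<forall>n. fin_dim (gen_eigensp W (YW \<omega> 1) n))
    \<and> (\<forall>n. \<exists>K::int. \<forall>k<K. gen_eigensp W (YW \<omega> 1) (n + of_int k) = {0})
    \<and> (ordinary \<longrightarrow> (\<forall>n. gen_eigensp W (YW \<omega> 1) n = eigensp W (YW \<omega> 1) n))"

definition module_hom ::
  "'v::cvec set \<Rightarrow> 'w::cvec set \<Rightarrow> ('v \<Rightarrow> int \<Rightarrow> 'w \<Rightarrow> 'w) \<Rightarrow>
   'u::cvec set \<Rightarrow> ('v \<Rightarrow> int \<Rightarrow> 'u \<Rightarrow> 'u) \<Rightarrow> ('w \<Rightarrow> 'u) \<Rightarrow> bool" where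
  "module_hom V W YW U YU f \<longleftrightarrow>
    (\<forall>w\<in>W. f w \<in> U) \<and> clinear_on W f
    \<and> (\<forall>v\<in>V. \<forall>n. \<forall>w\<in>W. f (YW v n w) = YU v n (f w))"

definition completion :: "'w::cvec set \<Rightarrow> ('w \<Rightarrow> 'w) \<Rightarrow> (complex \<Rightarrow> 'w) set" where
  "completion W T = {f. \<forall>n. f n \<in> gen_eigensp W T n}"

definition Ybar :: "'w::cvec set \<Rightarrow> ('v \<Rightarrow> int \<Rightarrow> 'w \<Rightarrow> 'w) \<Rightarrow> 'v \<Rightarrow> 'v \<Rightarrow> int
                    \<Rightarrow> (complex \<Rightarrow> 'w) \<Rightarrow> complex \<Rightarrow> 'w" where
  "Ybar W YW \<omega> v m f = (\<lambda>k. fsum (\<lambda>p. decomp W (YW \<omega> 1) (YW v m (f p)) k))"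

text \<open>Contragredient \<open>W' = \<Oplus>\<^sub>n W_[n]\<^sup>*\<close>: linear functionals on \<open>W\<close> (zero outside
  \<open>W\<close>) vanishing on all but finitely many \<open>W_[n]\<close>.\<close>
definition contragredient :: "'w::cvec set \<Rightarrow> ('v \<Rightarrow> int \<Rightarrow> 'w \<Rightarrow> 'w) \<Rightarrow> 'v \<Rightarrow> ('w \<Rightarrow> complex) set" where
  "contragredient W YW \<omega> = {\<alpha>. clinear_on W \<alpha> \<and> (\<forall>w. w \<notin> W \<longrightarrow> \<alpha> w = 0)
        \<and> finite {n. \<exists>w\<in>gen_eigensp W (YW \<omega> 1) n. \<alpha> w \<noteq> 0}}"

definition pairing :: "('w \<Rightarrow> complex) \<Rightarrow> (complex \<Rightarrow> 'w) \<Rightarrow> complex" where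
  "pairing \<alpha> f = fsum (\<lambda>n. \<alpha> (f n))"

text \<open>Modes of \<open>Y\<^sup>o(v,x) = Y(e\<^sup>x\<^sup>L\<^sup>(\<^sup>1\<^sup>)(-x\<^sup>-\<^sup>2)\<^sup>L\<^sup>(\<^sup>0\<^sup>)v, x\<^sup>-\<^sup>1)\<close>: coefficient of \<open>x\<^sup>-\<^sup>m\<^sup>-\<^sup>1\<close>,
  obtained by splitting \<open>v\<close> into \<open>L(0)\<close>-homogeneous components of weight \<open>h\<close>.\<close>
definition Yo :: "'v::cvec set \<Rightarrow> ('v \<Rightarrow> int \<Rightarrow> 'v \<Rightarrow> 'v) \<Rightarrow> 'v \<Rightarrow>
                  ('v \<Rightarrow> int \<Rightarrow> 'w::cvec \<Rightarrow> 'w) \<Rightarrow> 'v \<Rightarrow> int \<Rightarrow> 'w \<Rightarrow> 'w" where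
  "Yo V Y \<omega> YW v m w =
     fsum (\<lambda>h::int. fsum (\<lambda>j::nat.
        ((-1) powi h / of_nat (fact j)) *\<^sub>C
          YW (((Y \<omega> 2) ^^ j) (decomp V (Y \<omega> 1) v (of_int h))) (2 * h - m - 2 - int j) w))"

definition Yprime :: "'v::cvec set \<Rightarrow> ('v \<Rightarrow> int \<Rightarrow> 'v \<Rightarrow> 'v) \<Rightarrow> 'v \<Rightarrow> 'w::cvec set \<Rightarrow>
                      ('v \<Rightarrow> int \<Rightarrow> 'w \<Rightarrow> 'w) \<Rightarrow> 'v \<Rightarrow> int \<Rightarrow> ('w \<Rightarrow> complex) \<Rightarrow> 'w \<Rightarrow> complex" where
  "Yprime V Y \<omega> W YW v m \<alpha> = (\<lambda>w. if w \<in> W then \<alpha> (Yo V Y \<omega> YW v m w) else 0)"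

text \<open>\<open>(W\<^sub>1 \<otimes> W\<^sub>2)\<^sup>*\<close>, identified with bilinear forms on \<open>W\<^sub>1 \<times> W\<^sub>2\<close> (zero outside).\<close>
definition bilin_forms :: "'w1::cvec set \<Rightarrow> 'w2::cvec set \<Rightarrow> ('w1 \<Rightarrow> 'w2 \<Rightarrow> complex) set" where
  "bilin_forms W1 W2 = {lam. (\<forall>b\<in>W2. clinear_on W1 (\<lambda>a. lam a b)) \<and> (\<forall>a\<in>W1. clinear_on W2 (lam a))
        \<and> (\<forall>a b. a \<notin> W1 \<or> b \<notin> W2 \<longrightarrow> lam a b = 0)}"

text \<open>Quasi-\<open>P(z)\<close>-intertwining map \<open>F : W\<^sub>1 \<otimes> W\<^sub>2 \<rightarrow> \<overline>W\<^sub>3\<close> (as a bilinear map); the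
  identity is stated as its coefficient of \<open>x\<^sub>1\<^sup>-\<^sup>m\<^sup>-\<^sup>1\<close>, where
  \<open>Res\<^sub>x\<^sub>0 z\<^sup>-\<^sup>1\<delta>((x\<^sub>1-x\<^sub>0)/z) F(Y\<^sub>1(v,x\<^sub>0)w\<^sub>1\<otimes>w\<^sub>2)\<close> has coefficient
  \<open>\<Sum>\<^sub>k\<^sub>\<ge>\<^sub>0 binom(k-m-1,k)(-1)\<^sup>k z\<^sup>m\<^sup>-\<^sup>k F(v\<^sub>k w\<^sub>1 \<otimes> w\<^sub>2)\<close>.\<close>
definition quasi_intertwining ::
  "'v::cvec set \<Rightarrow> 'v \<Rightarrow> 'w1::cvec set \<Rightarrow> ('v \<Rightarrow> int \<Rightarrow> 'w1 \<Rightarrow> 'w1) \<Rightarrow>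
   'w2::cvec set \<Rightarrow> ('v \<Rightarrow> int \<Rightarrow> 'w2 \<Rightarrow> 'w2) \<Rightarrow> 'w3::cvec set \<Rightarrow> ('v \<Rightarrow> int \<Rightarrow> 'w3 \<Rightarrow> 'w3) \<Rightarrow>
   complex \<Rightarrow> ('w1 \<Rightarrow> 'w2 \<Rightarrow> complex \<Rightarrow> 'w3) \<Rightarrow> bool" where
  "quasi_intertwining V \<omega> W1 Y1 W2 Y2 W3 Y3 z F \<longleftrightarrow>
    (\<forall>a\<in>W1. \<forall>b\<in>W2. F a b \<in> completion W3 (Y3 \<omega> 1))
    \<and> (\<forall>b\<in>W2. clinear_on W1 (\<lambda>a. F a b)) \<and> (\<forall>a\<in>W1. clinear_on W2 (F a))
    \<and> (\<forall>v\<in>V. \<forall>a\<in>W1. \<forall>b\<in>W2. \<forall>m::int.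
         Ybar W3 Y3 \<omega> v m (F a b) - F a (Y2 v m b)
         = fsum (\<lambda>k::nat. ((-1) ^ k * gbin (int k - m - 1) k * z powi (m - int k)) *\<^sub>C
                            F (Y1 v (int k) a) b))"

definition Fvee :: "'w1 set \<Rightarrow> 'w2 set \<Rightarrow> ('w1 \<Rightarrow> 'w2 \<Rightarrow> complex \<Rightarrow> 'w3) \<Rightarrow>
                    ('w3 \<Rightarrow> complex) \<Rightarrow> 'w1 \<Rightarrow> 'w2 \<Rightarrow> complex" where
  "Fvee W1 W2 F \<alpha> = (\<lambda>a b. if a \<in> W1 \<and> b \<in> W2 then pairing \<alpha> (F a b) else 0)"

text \<open>\<open>\<tau>\<^sub>P\<^sub>(\<^sub>z\<^sub>)(v \<otimes> t\<^sup>m)\<close>, the coefficient of \<open>x\<^sub>1\<^sup>-\<^sup>m\<^sup>-\<^sup>1\<close> in \<open>\<tau>\<^sub>P\<^sub>(\<^sub>z\<^sub>)(Y\<^sub>t(v,x\<^sub>1))\<close>.  For \<open>v\<close>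
  of weight \<open>h\<close>, \<open>e\<^sup>x\<^sup>\<^sub>1\<^sup>L\<^sup>(\<^sup>1\<^sup>)(-x\<^sub>1\<^sup>-\<^sup>2)\<^sup>L\<^sup>(\<^sup>0\<^sup>)v = \<Sum>\<^sub>j (-1)\<^sup>h x\<^sub>1\<^sup>j\<^sup>-\<^sup>2\<^sup>h L(1)\<^sup>j v / j!\<close>, and
  \<open>z\<^sup>-\<^sup>1\<delta>((x\<^sub>1\<^sup>-\<^sup>1-x\<^sub>0)/z) = \<Sum>\<^sub>n\<^sub>,\<^sub>k\<^sub>\<ge>\<^sub>0 z\<^sup>-\<^sup>n\<^sup>-\<^sup>1 binom(n,k) x\<^sub>1\<^sup>k\<^sup>-\<^sup>n (-x\<^sub>0)\<^sup>k\<close>; taking the residue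
  in \<open>x\<^sub>0\<close> and the coefficient of \<open>x\<^sub>1\<^sup>-\<^sup>m\<^sup>-\<^sup>1\<close> forces \<open>n = k + j - 2h + m + 1\<close>.\<close>
definition tauP ::
  "'v::cvec set \<Rightarrow> ('v \<Rightarrow> int \<Rightarrow> 'v \<Rightarrow> 'v) \<Rightarrow> 'v \<Rightarrow>
   'w1::cvec set \<Rightarrow> ('v \<Rightarrow> int \<Rightarrow> 'w1 \<Rightarrow> 'w1) \<Rightarrow> 'w2::cvec set \<Rightarrow> ('v \<Rightarrow> int \<Rightarrow> 'w2 \<Rightarrow> 'w2) \<Rightarrow>
   complex \<Rightarrow> 'v \<Rightarrow> int \<Rightarrow> ('w1 \<Rightarrow> 'w2 \<Rightarrow> complex) \<Rightarrow> 'w1 \<Rightarrow> 'w2 \<Rightarrow> complex" where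
  "tauP V Y \<omega> W1 Y1 W2 Y2 z v m lam = (\<lambda>a b. if a \<in> W1 \<and> b \<in> W2 then
      fsum (\<lambda>h::int. fsum (\<lambda>j::nat. fsum (\<lambda>k::nat.
         ((-1) powi (h + int k) / of_nat (fact j)
          * z powi (- (int k + int j - 2 * h + m + 2))
          * gbin (int k + int j - 2 * h + m + 1) k)
         * lam (Y1 (((Y \<omega> 2) ^^ j) (decomp V (Y \<omega> 1) v (of_int h))) (int k) a) b)))
      + lam a (Yo V Y \<omega> Y2 v m b)
    else 0)"

definition lower_truncation ::
  "'v::cvec set \<Rightarrow> ('v \<Rightarrow> int \<Rightarrow> 'v \<Rightarrow> 'v) \<Rightarrow> 'v \<Rightarrow>
   'w1::cvec set \<Rightarrow> ('v \<Rightarrow> int \<Rightarrow> 'w1 \<Rightarrow> 'w1) \<Rightarrow> 'w2::cvec set \<Rightarrow> ('v \<Rightarrow> int \<Rightarrow> 'w2 \<Rightarrow> 'w2) \<Rightarrow>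
   complex \<Rightarrow> ('w1 \<Rightarrow> 'w2 \<Rightarrow> complex) \<Rightarrow> bool" where
  "lower_truncation V Y \<omega> W1 Y1 W2 Y2 z lam \<longleftrightarrow>
    (\<forall>v\<in>V. \<exists>N. \<forall>n\<ge>N. tauP V Y \<omega> W1 Y1 W2 Y2 z v n lam = 0)"

text \<open>Jacobi identity for \<open>\<lambda>\<close> w.r.t. \<open>\<tau>\<^sub>P\<^sub>(\<^sub>z\<^sub>)\<close>, as the coefficient of
  \<open>x\<^sub>0\<^sup>-\<^sup>l\<^sup>-\<^sup>1 x\<^sub>1\<^sup>-\<^sup>m\<^sup>-\<^sup>1 x\<^sub>2\<^sup>-\<^sup>n\<^sup>-\<^sup>1\<close> for all \<open>l,m,n\<close>.\<close>
definition tau_jacobi ::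
  "'v::cvec set \<Rightarrow> ('v \<Rightarrow> int \<Rightarrow> 'v \<Rightarrow> 'v) \<Rightarrow> 'v \<Rightarrow>
   'w1::cvec set \<Rightarrow> ('v \<Rightarrow> int \<Rightarrow> 'w1 \<Rightarrow> 'w1) \<Rightarrow> 'w2::cvec set \<Rightarrow> ('v \<Rightarrow> int \<Rightarrow> 'w2 \<Rightarrow> 'w2) \<Rightarrow>
   complex \<Rightarrow> ('w1 \<Rightarrow> 'w2 \<Rightarrow> complex) \<Rightarrow> bool" where
  "tau_jacobi V Y \<omega> W1 Y1 W2 Y2 z lam \<longleftrightarrow>
    (let t = tauP V Y \<omega> W1 Y1 W2 Y2 z in
     \<forall>u\<in>V. \<forall>v\<in>V. \<forall>l m n :: int.
      fsum (\<lambda>i::nat. gbin m i *\<^sub>C t (Y u (l + int i) v) (m + n - int i) lam)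
      = fsum (\<lambda>i::nat. ((-1) ^ i * gbin l i) *\<^sub>C
           (t u (m + l - int i) (t v (n + int i) lam)
            - ((-1) powi l) *\<^sub>C t v (n + l - int i) (t u (m + int i) lam))))"

definition tau_module ::
  "bool \<Rightarrow> 'v::cvec set \<Rightarrow> ('v \<Rightarrow> int \<Rightarrow> 'v \<Rightarrow> 'v) \<Rightarrow> 'v \<Rightarrow> 'v \<Rightarrow>
   'w1::cvec set \<Rightarrow> ('v \<Rightarrow> int \<Rightarrow> 'w1 \<Rightarrow> 'w1) \<Rightarrow> 'w2::cvec set \<Rightarrow> ('v \<Rightarrow> int \<Rightarrow> 'w2 \<Rightarrow> 'w2) \<Rightarrow>
   complex \<Rightarrow> ('w1 \<Rightarrow> 'w2 \<Rightarrow> complex) set \<Rightarrow> bool" where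
  "tau_module ordinary V Y vac \<omega> W1 Y1 W2 Y2 z M \<longleftrightarrow>
    M \<subseteq> bilin_forms W1 W2 \<and> csubspace M
    \<and> (\<forall>v\<in>V. \<forall>n. \<forall>lam\<in>M. tauP V Y \<omega> W1 Y1 W2 Y2 z v n lam \<in> M)
    \<and> gen_module ordinary V Y vac \<omega> M (tauP V Y \<omega> W1 Y1 W2 Y2 z)"

end

(* The modes of Y^o(v,x) = Y(e^(xL(1)) (-x^(-2))^(L(0)) v, x^(-1)) satisfy the Jacobi identity with the
   order of the operators reversed.  Indeed, for homogeneous u, v its commutator side is a finite
   combination of commutator sides of ordinary Jacobi identities for the vectors L(1)^a u / a! and
   L(1)^c v / c!; after applying those identities, what remains is the conjugation formula for
   L(1)^j (u_k v) / j!, an induction on j, together with Vandermonde's identity.  Hence the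
   contragredient of a module is a module.  The transform Y -> Y^o is an involution, and tau_P(z) is
   exactly the transform of the right-hand side of the quasi-intertwining relation.  Therefore a
   quasi-P(z)-intertwining map F turns Y_3' into tau_P(z) under F^vee, and F^vee(W_3') is a homomorphic
   image of W_3'.  Conversely, for a tau_P(z)-module M take W_3 = M' and for F the evaluation of the
   homogeneous components of elements of M; then W_3' = M'' = M since weight spaces are
   finite-dimensional. *)

theory Submission
  imports Defs "HOL-Computational_Algebra.Formal_Power_Series"
begin

section \<open>Linear algebra and generalized eigenspaces\<close>

text \<open>Every formal series is replaced by its modes and every sum over modes by
  \<open>fsum\<close>, which returns 0 on infinite support. An identity can therefore be moved
  through a linear map only once its support is known to be finite, and much of the work is the
  choice of finite index sets. For this reason the opposite Jacobi identity is stated for all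
  sufficiently long partial sums: such statements can be added, paired with a functional and
  extended from homogeneous vectors without naming a truncation bound. \<open>tauP\<close> acts on
  all bilinear forms, where nothing forces truncation, so its Jacobi identity is never computed; it
  is inherited from W_3' along F^vee, using only that F^vee commutes with the modes. The converse
  reads the same computation backwards, and there the involutivity of the transform enters: on M
  only the action of \<open>tauP\<close> is given, and the transform has to be undone to recover the
  right-hand side of the quasi-intertwining relation.\<close>

global_interpretation cv: vector_space "cscale :: complex \<Rightarrow> 'a::cvec \<Rightarrow> 'a"
  by unfold_locales
    (simp_all add: cscale_right_distrib cscale_left_distrib cscale_assoc cscale_one)

lemma csubspace_eq: "csubspace W \<longleftrightarrow> cv.subspace W"
  unfolding csubspace_def cv.subspace_def by blast

lemma cspan_eq: "cspan S = cv.span S"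
  unfolding cspan_def cv.span_explicit by auto

lemma cscale_fun_apply [simp]: "(c *\<^sub>C f) x = c *\<^sub>C f x"
  by (simp add: cscale_fun_def)

lemma cscale_complex [simp]: "(c::complex) *\<^sub>C x = c * x"
  by (simp add: cscale_complex_def)

lemma sum_fun_apply: "(sum f A) x = (\<Sum>i\<in>A. f i x)"
  by (induction A rule: infinite_finite_induct) auto

lemma fsum_eq_sum:
  assumes "finite A" "\<And>i. i \<notin> A \<Longrightarrow> f i = 0"
  shows "fsum f = sum f A"
  unfolding fsum_def using assms by (intro sum.mono_neutral_left) auto

lemma fsum_eq_sum_lessThan:
  fixes f :: "nat \<Rightarrow> 'a::comm_monoid_add"
  assumes "\<And>i. i \<ge> N \<Longrightarrow> f i = 0"
  shows "fsum f = sum f {..<N}"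
  by (rule fsum_eq_sum) (use assms in auto)

lemma fsum_single:
  assumes "\<And>i. i \<noteq> k \<Longrightarrow> f i = 0"
  shows "fsum f = f k"
  using fsum_eq_sum[of "{k}" f] assms by auto

lemma fsum_zero: "(\<And>i. f i = 0) \<Longrightarrow> fsum f = 0"
  by (simp add: fsum_def)

lemma csubspace_add: "csubspace W \<Longrightarrow> x \<in> W \<Longrightarrow> y \<in> W \<Longrightarrow> x + y \<in> W"
  and csubspace_scale: "csubspace W \<Longrightarrow> x \<in> W \<Longrightarrow> c *\<^sub>C x \<in> W"
  and csubspace_0: "csubspace W \<Longrightarrow> 0 \<in> W"
  by (simp_all add: csubspace_def)

lemma csubspace_diff: "csubspace W \<Longrightarrow> x \<in> W \<Longrightarrow> y \<in> W \<Longrightarrow> x - y \<in> W"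
  unfolding csubspace_eq by (rule cv.subspace_diff)

lemma csubspace_sum: "csubspace W \<Longrightarrow> (\<And>i. i \<in> A \<Longrightarrow> f i \<in> W) \<Longrightarrow> sum f A \<in> W"
  unfolding csubspace_eq by (rule cv.subspace_sum)

lemma csubspace_fsum: "csubspace W \<Longrightarrow> (\<And>i. f i \<in> W) \<Longrightarrow> fsum f \<in> W"
  unfolding fsum_def by (rule csubspace_sum)

lemma clinear_on_add: "clinear_on W f \<Longrightarrow> x \<in> W \<Longrightarrow> y \<in> W \<Longrightarrow> f (x + y) = f x + f y"
  and clinear_on_scale: "clinear_on W f \<Longrightarrow> x \<in> W \<Longrightarrow> f (c *\<^sub>C x) = c *\<^sub>C f x"
  by (simp_all add: clinear_on_def)

lemma clinear_on_0:
  assumes "clinear_on W f" "csubspace W" shows "f 0 = 0"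
  using clinear_on_scale[OF assms(1), of 0 0] assms(2) by (simp add: csubspace_0)

lemma clinear_on_diff:
  assumes "clinear_on W f" "csubspace W" "x \<in> W" "y \<in> W" shows "f (x - y) = f x - f y"
proof -
  have "f ((x - y) + y) = f (x - y) + f y"
    using assms by (intro clinear_on_add) (auto intro: csubspace_diff)
  then show ?thesis by (simp add: algebra_simps)
qed

lemma clinear_on_sum:
  assumes "clinear_on W f" "csubspace W" "\<And>i. i \<in> A \<Longrightarrow> g i \<in> W"
  shows "f (sum g A) = (\<Sum>i\<in>A. f (g i))"
  using assms(3)
proof (induction A rule: infinite_finite_induct)
  case (insert i A)
  then have "f (g i + sum g A) = f (g i) + f (sum g A)"
    by (intro clinear_on_add[OF assms(1)] csubspace_sum[OF assms(2)]) auto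
  then show ?case using insert by simp
qed (auto simp: clinear_on_0[OF assms(1,2)])

lemma clinear_on_fsum:
  assumes "clinear_on W f" "csubspace W" "\<And>i. g i \<in> W" "finite {i. g i \<noteq> 0}"
  shows "f (fsum g) = fsum (\<lambda>i. f (g i))"
proof -
  have "fsum (\<lambda>i. f (g i)) = (\<Sum>i | g i \<noteq> 0. f (g i))"
    using assms(4) by (intro fsum_eq_sum) (auto simp: clinear_on_0[OF assms(1,2)])
  then show ?thesis
    unfolding fsum_def[of g] by (simp add: clinear_on_sum[OF assms(1,2)] assms(3))
qed

lemma clinear_on_subset: "clinear_on W f \<Longrightarrow> U \<subseteq> W \<Longrightarrow> clinear_on U f"
  unfolding clinear_on_def by blast

lemma clinear_onI:
  "(\<And>x y. x \<in> W \<Longrightarrow> y \<in> W \<Longrightarrow> f (x + y) = f x + f y) \<Longrightarrow>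
   (\<And>c x. x \<in> W \<Longrightarrow> f (c *\<^sub>C x) = c *\<^sub>C f x) \<Longrightarrow> clinear_on W f"
  unfolding clinear_on_def by blast

lemma clinear_on_sumI:
  "(\<And>i. i \<in> A \<Longrightarrow> clinear_on W (f i)) \<Longrightarrow> clinear_on W (\<lambda>x. \<Sum>i\<in>A. f i x)"
  unfolding clinear_on_def by (simp add: sum.distrib cv.scale_sum_right)

lemma clinear_on_scaleI: "clinear_on W f \<Longrightarrow> clinear_on W (\<lambda>x. c *\<^sub>C f x)"
  unfolding clinear_on_def by (simp add: cscale_right_distrib cv.scale_left_commute)

text \<open>The support may depend on x; for x + y everything is evaluated on the union of the two
  supports.\<close>

lemma clinear_on_fsumI:
  assumes "\<And>x y c. \<lbrakk>x \<in> W; y \<in> W\<rbrakk> \<Longrightarrow> x + y \<in> W" "\<And>x c. x \<in> W \<Longrightarrow> c *\<^sub>C x \<in> W"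
    and "\<And>i. clinear_on W (f i)" and fin: "\<And>x. x \<in> W \<Longrightarrow> finite {i. f i x \<noteq> 0}"
  shows "clinear_on W (\<lambda>x. fsum (\<lambda>i. f i x))"
proof (rule clinear_onI)
  fix x y assume xy: "x \<in> W" "y \<in> W"
  let ?A = "{i. f i x \<noteq> 0} \<union> {i. f i y \<noteq> 0}"
  have A: "finite ?A" using fin xy by blast
  have "fsum (\<lambda>i. f i (x + y)) = (\<Sum>i\<in>?A. f i (x + y))"
    using A xy by (intro fsum_eq_sum) (auto simp: clinear_on_add[OF assms(3)])
  also have "\<dots> = (\<Sum>i\<in>?A. f i x) + (\<Sum>i\<in>?A. f i y)"
    using xy by (simp add: clinear_on_add[OF assms(3)] sum.distrib)
  also have "(\<Sum>i\<in>?A. f i x) = fsum (\<lambda>i. f i x)" using A by (intro fsum_eq_sum[symmetric]) auto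
  also have "(\<Sum>i\<in>?A. f i y) = fsum (\<lambda>i. f i y)" using A by (intro fsum_eq_sum[symmetric]) auto
  finally show "fsum (\<lambda>i. f i (x + y)) = fsum (\<lambda>i. f i x) + fsum (\<lambda>i. f i y)" .
next
  fix c x assume x: "x \<in> W"
  have "fsum (\<lambda>i. f i (c *\<^sub>C x)) = (\<Sum>i | f i x \<noteq> 0. f i (c *\<^sub>C x))"
    using fin x by (intro fsum_eq_sum) (auto simp: clinear_on_scale[OF assms(3)])
  also have "\<dots> = c *\<^sub>C fsum (\<lambda>i. f i x)"
    using x by (simp add: fsum_def clinear_on_scale[OF assms(3)] cv.scale_sum_right)
  finally show "fsum (\<lambda>i. f i (c *\<^sub>C x)) = c *\<^sub>C fsum (\<lambda>i. f i x)" .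
qed

lemma fin_dim_basis:
  assumes "csubspace W" "fin_dim W"
  obtains B where "finite B" "cv.independent B" "cv.span B = W"
proof -
  from assms(2) obtain S where S: "finite S" "S \<subseteq> W" "W \<subseteq> cv.span S"
    unfolding fin_dim_def cspan_eq by blast
  obtain B where B: "B \<subseteq> W" "cv.independent B" "W \<subseteq> cv.span B"
    by (rule cv.basis_exists[of W])
  have "finite B" using cv.independent_span_bound[OF S(1) B(2)] B(1) S(3) by blast
  moreover have "cv.span B = W"
    using B assms(1) unfolding csubspace_eq by (simp add: cv.span_minimal subset_antisym)
  ultimately show thesis using that B(2) by blast
qed

lemma fin_dim_image:
  assumes "fin_dim W" "csubspace W" "clinear_on W f"
  shows "fin_dim (f ` W)"
proof -
  from assms(1) obtain S where S: "finite S" "S \<subseteq> W" "W \<subseteq> cspan S"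
    unfolding fin_dim_def by blast
  have "f w \<in> cspan (f ` S)" if "w \<in> W" for w
  proof -
    from that S obtain T c where T: "finite T" "T \<subseteq> S" "w = (\<Sum>t\<in>T. c t *\<^sub>C t)"
      unfolding cspan_def by blast
    have "f w = (\<Sum>t\<in>T. c t *\<^sub>C f t)"
      unfolding T(3) using T(2) S(2)
      by (subst clinear_on_sum[OF assms(3,2)])
        (auto intro!: csubspace_scale assms sum.cong clinear_on_scale[OF assms(3)])
    moreover have "c t *\<^sub>C f t \<in> cv.span (f ` S)" if "t \<in> T" for t
      using that T(2) by (intro cv.span_scale cv.span_base) auto
    ultimately show ?thesis unfolding cspan_eq by (simp add: cv.span_sum)
  qed
  then show ?thesis unfolding fin_dim_def using S by (intro exI[of _ "f ` S"]) auto
qed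

text \<open>Abstracts the action of L(0). Existence of a decomposition is assumed and uniqueness
  derived; V, generalized modules and homomorphic images of these are the instances.\<close>

locale graded_space =
  fixes W :: "'a::cvec set" and T :: "'a \<Rightarrow> 'a"
  assumes sub: "csubspace W"
    and T_in: "w \<in> W \<Longrightarrow> T w \<in> W"
    and T_lin: "clinear_on W T"
    and ex_dec: "w \<in> W \<Longrightarrow> \<exists>f. finite {n. f n \<noteq> 0} \<and> (\<forall>n. f n \<in> gen_eigensp W T n) \<and> w = fsum f"
begin

abbreviation "G \<equiv> gen_eigensp W T"
abbreviation S where "S n \<equiv> (\<lambda>x. T x - n *\<^sub>C x)"
abbreviation "\<pi> n w \<equiv> decomp W T w n"

lemma S_in: "w \<in> W \<Longrightarrow> S n w \<in> W"
  using sub by (simp add: csubspace_diff csubspace_scale T_in)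

lemma S_lin: "clinear_on W (S n)"
  using T_lin unfolding clinear_on_def by (simp add: algebra_simps cv.scale_left_commute)

lemma Spow_in: "w \<in> W \<Longrightarrow> (S n ^^ k) w \<in> W"
  by (induction k) (auto simp: S_in)

lemma Spow_lin: "clinear_on W (S n ^^ k)"
proof (induction k)
  case 0 show ?case by (simp add: clinear_on_def)
next
  case (Suc k)
  show ?case
    using Suc S_lin[of n] Spow_in[where n=n and k=k] unfolding clinear_on_def by simp
qed

lemma S_comm: "w \<in> W \<Longrightarrow> S n (S m w) = S m (S n w)"
  by (simp add: clinear_on_diff[OF T_lin sub] clinear_on_scale[OF T_lin] T_in
      csubspace_scale[OF sub] algebra_simps cv.scale_left_commute)

lemma S_Spow_comm: "w \<in> W \<Longrightarrow> S n ((S m ^^ k) w) = (S m ^^ k) (S n w)"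
proof (induction k)
  case (Suc k)
  show ?case using S_comm[OF Spow_in[OF Suc.prems], where n=n and m=m] Suc by simp
qed simp

lemma G_W: "w \<in> G n \<Longrightarrow> w \<in> W"
  by (simp add: gen_eigensp_def)

lemma Spow_0: "(S n ^^ k) 0 = 0"
  using clinear_on_0[OF Spow_lin sub] .

lemma Spow_zero_mono: 
  assumes "(S n ^^ k) w = 0" "k \<le> l" shows "(S n ^^ l) w = 0"
proof -
  obtain d where "l = d + k" using assms(2) by (metis add.commute le_Suc_ex)
  then show ?thesis using assms(1) Spow_0 by (simp add: funpow_add)
qed

lemma G_sub: "csubspace (G n)"
  unfolding csubspace_def
proof (intro conjI ballI allI)
  show "0 \<in> G n" unfolding gen_eigensp_def using sub by (auto simp: csubspace_0 intro: exI[of _ 0])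
next
  fix x y assume "x \<in> G n" "y \<in> G n"
  then obtain k l where "x \<in> W" "y \<in> W" "(S n ^^ k) x = 0" "(S n ^^ l) y = 0"
    unfolding gen_eigensp_def by blast
  then have "(S n ^^ (max k l)) (x + y) = 0" "x + y \<in> W"
    using Spow_zero_mono[where n=n and k=k and w=x and l="max k l"]
      Spow_zero_mono[where n=n and k=l and w=y and l="max k l"] sub
    by (auto simp: clinear_on_add[OF Spow_lin] csubspace_add)
  then show "x + y \<in> G n" unfolding gen_eigensp_def by blast
next
  fix c x assume "x \<in> G n"
  then obtain k where "x \<in> W" "(S n ^^ k) x = 0" unfolding gen_eigensp_def by blast
  then have "(S n ^^ k) (c *\<^sub>C x) = 0" "c *\<^sub>C x \<in> W"
    using sub by (auto simp: clinear_on_scale[OF Spow_lin] csubspace_scale)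
  then show "c *\<^sub>C x \<in> G n" unfolding gen_eigensp_def by blast
qed

lemma S_G: "w \<in> G n \<Longrightarrow> S m w \<in> G n"
proof -
  assume "w \<in> G n"
  then obtain k where k: "w \<in> W" "(S n ^^ k) w = 0" unfolding gen_eigensp_def by blast
  have "(S n ^^ k) (S m w) = S m ((S n ^^ k) w)" using S_Spow_comm[OF k(1), where n=m and m=n and k=k] by simp
  also have "\<dots> = 0" using k clinear_on_0[OF T_lin sub] by simp
  finally show "S m w \<in> G n" using k S_in unfolding gen_eigensp_def by blast
qed

lemma Spow_G: "w \<in> G n \<Longrightarrow> (S m ^^ k) w \<in> G n"
  by (induction k) (auto simp: S_G)

lemma T_G: "w \<in> G n \<Longrightarrow> T w \<in> G n"
  using S_G[of w n 0] by simp

text \<open>If T w = m w, then (T - n)^j w = (m - n)^j w, and some power on the left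
  vanishes.\<close>

lemma S_inj:
  assumes "w \<in> G n" "n \<noteq> m" "S m w = 0"
  shows "w = 0"
proof -
  from assms obtain k where k: "w \<in> W" "(S n ^^ k) w = 0" unfolding gen_eigensp_def by blast
  have "(S n ^^ j) w = (m - n) ^ j *\<^sub>C w" for j
  proof (induction j)
    case (Suc j)
    have "T w = m *\<^sub>C w" using assms by simp
    then show ?case using Suc k
      by (simp add: clinear_on_scale[OF T_lin] cv.scale_left_diff_distrib algebra_simps)
  qed simp
  then show ?thesis using k assms by simp
qed

lemma Spow_inj:
  assumes "w \<in> G n" "n \<noteq> m" "(S m ^^ k) w = 0"
  shows "w = 0"
  using assms(3)
proof (induction k)
  case (Suc k)
  have "(S m ^^ k) w = 0"
    using S_inj[OF Spow_G[OF assms(1)] assms(2), where k1=k] Suc.prems by simp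
  then show ?case by (rule Suc.IH)
qed simp

text \<open>A power of T - p that kills f p leaves a shorter relation among the images of the other
  components. These images stay in their eigenspaces, and \<open>Spow_inj\<close> carries the
  conclusion back to the components; hence the induction runs over all families f.\<close>

lemma G_independent:
  assumes "finite A" "\<And>n. n \<in> A \<Longrightarrow> f n \<in> G n" "sum f A = 0" "n \<in> A"
  shows "f n = 0"
  using assms
proof (induction A arbitrary: f n rule: finite_induct)
  case (insert p A)
  from insert.prems(1)[of p] obtain k where k: "(S p ^^ k) (f p) = 0"
    unfolding gen_eigensp_def by blast
  have W: "f m \<in> W" if "m \<in> insert p A" for m using insert.prems(1) that G_W by blast
  have "(S p ^^ k) (sum f (insert p A)) = (\<Sum>m\<in>insert p A. (S p ^^ k) (f m))"
    using W by (intro clinear_on_sum[OF Spow_lin sub]) auto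
  then have "(\<Sum>m\<in>A. (S p ^^ k) (f m)) = 0"
    using insert.hyps insert.prems(2) k Spow_0 by simp
  then have "(S p ^^ k) (f m) = 0" if "m \<in> A" for m
    using insert.IH[of "\<lambda>m. (S p ^^ k) (f m)" m] insert.prems(1) Spow_G that by simp
  then have A: "f m = 0" if "m \<in> A" for m
    using Spow_inj[of "f m" m p k] insert.prems(1) insert.hyps that by auto
  then have "f p = 0" using insert.prems(2) insert.hyps by simp
  then show ?case using A insert.prems(3) by auto
qed simp

text \<open>The difference of two decompositions, summed over the union of their supports, is a
  relation to which \<open>G_independent\<close> applies. This makes the definite description in
  \<open>decomp\<close> usable.\<close>

lemma decomp_eqI:
  assumes f: "\<And>n. f n \<in> G n" "finite {n. f n \<noteq> 0}" "w = fsum f"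
  shows "decomp W T w = f"
  unfolding decomp_def
proof (rule the_equality)
  show "(\<forall>n. f n \<in> G n) \<and> finite {n. f n \<noteq> 0} \<and> w = fsum f" using f by blast
next
  fix g assume g: "(\<forall>n. g n \<in> G n) \<and> finite {n. g n \<noteq> 0} \<and> w = fsum g"
  let ?A = "{n. f n \<noteq> 0} \<union> {n. g n \<noteq> 0}"
  have A: "finite ?A" using f g by blast
  have "fsum f = sum f ?A" "fsum g = sum g ?A" using A by (auto intro!: fsum_eq_sum)
  then have 0: "(\<Sum>n\<in>?A. g n - f n) = 0" using f g by (simp add: sum_subtractf)
  have "g n - f n = 0" if "n \<in> ?A" for n
    using G_independent[OF A _ 0 that] f(1) g G_sub by (blast intro: csubspace_diff)
  then have "g n = f n" for n by (cases "n \<in> ?A") auto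
  then show "g = f" by blast
qed

lemma
  assumes "w \<in> W"
  shows \<pi>_in: "\<pi> n w \<in> G n" and \<pi>_finite: "finite {n. \<pi> n w \<noteq> 0}"
    and \<pi>_sum: "fsum (\<lambda>n. \<pi> n w) = w"
  using ex_dec[OF assms] decomp_eqI by metis+

lemma \<pi>_W: "w \<in> W \<Longrightarrow> \<pi> n w \<in> W"
  using \<pi>_in G_W by blast

lemma \<pi>_G: assumes "w \<in> G n" shows "\<pi> m w = (if m = n then w else 0)"
proof -
  have "decomp W T w = (\<lambda>m. if m = n then w else 0)"
    by (rule decomp_eqI)
      (use assms G_sub in \<open>auto simp: csubspace_0 fsum_single[of n] intro: finite_subset[of _ "{n}"]\<close>)
  then show ?thesis by simp
qed

lemma \<pi>_add: assumes "x \<in> W" "y \<in> W" shows "\<pi> n (x + y) = \<pi> n x + \<pi> n y"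
proof -
  let ?A = "{n. \<pi> n x \<noteq> 0} \<union> {n. \<pi> n y \<noteq> 0}"
  have A: "finite ?A" using \<pi>_finite assms by blast
  have "fsum (\<lambda>n. \<pi> n x) = (\<Sum>n\<in>?A. \<pi> n x)" "fsum (\<lambda>n. \<pi> n y) = (\<Sum>n\<in>?A. \<pi> n y)"
    "fsum (\<lambda>n. \<pi> n x + \<pi> n y) = (\<Sum>n\<in>?A. \<pi> n x + \<pi> n y)"
    using A by (auto intro!: fsum_eq_sum)
  then have "x + y = fsum (\<lambda>n. \<pi> n x + \<pi> n y)" using \<pi>_sum assms by (simp add: sum.distrib)
  then have "decomp W T (x + y) = (\<lambda>n. \<pi> n x + \<pi> n y)"
    by (intro decomp_eqI csubspace_add[OF G_sub] \<pi>_in assms finite_subset[OF _ A]) auto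
  then show ?thesis by simp
qed

lemma \<pi>_scale: assumes "x \<in> W" shows "\<pi> n (c *\<^sub>C x) = c *\<^sub>C \<pi> n x"
proof -
  have A: "finite {n. \<pi> n x \<noteq> 0}" using \<pi>_finite assms by blast
  have "fsum (\<lambda>n. c *\<^sub>C \<pi> n x) = (\<Sum>n | \<pi> n x \<noteq> 0. c *\<^sub>C \<pi> n x)"
    using A by (intro fsum_eq_sum) auto
  also have "\<dots> = c *\<^sub>C x"
    using \<pi>_sum[OF assms] by (simp add: fsum_def flip: cv.scale_sum_right)
  finally have "decomp W T (c *\<^sub>C x) = (\<lambda>n. c *\<^sub>C \<pi> n x)"
    by (intro decomp_eqI csubspace_scale[OF G_sub] \<pi>_in assms finite_subset[OF _ A]) auto
  then show ?thesis by simp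
qed

lemma \<pi>_lin: "clinear_on W (\<pi> n)"
  by (simp add: clinear_on_def \<pi>_add \<pi>_scale)

lemma lin_\<pi>:
  assumes "clinear_on W f" "w \<in> W"
  shows "f w = fsum (\<lambda>n. f (\<pi> n w))"
  using clinear_on_fsum[OF assms(1) sub, of "\<lambda>n. \<pi> n w"] assms(2)
  by (simp add: \<pi>_sum \<pi>_W \<pi>_finite)

lemma graded_induct:
  assumes "w \<in> W" "P 0" "\<And>x y. x \<in> W \<Longrightarrow> y \<in> W \<Longrightarrow> P x \<Longrightarrow> P y \<Longrightarrow> P (x + y)"
    "\<And>n x. x \<in> G n \<Longrightarrow> P x"
  shows "P w"
proof -
  have "P (\<Sum>n\<in>A. \<pi> n w) \<and> (\<Sum>n\<in>A. \<pi> n w) \<in> W" if "finite A" for A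
    using that
  proof (induction A)
    case (insert n A)
    then show ?case using assms \<pi>_in[OF assms(1), of n] \<pi>_W[OF assms(1), of n] sub
      by (simp add: csubspace_add)
  qed (use assms sub in \<open>auto simp: csubspace_0\<close>)
  from this[OF \<pi>_finite[OF assms(1)]] show ?thesis
    using \<pi>_sum[OF assms(1)] by (simp add: fsum_def)
qed

end

section \<open>Binomial sums, weak modules and weights\<close>

lemma gbin_nat: "gbin (int p) i = of_nat (p choose i)"
  by (simp add: gbin_def binomial_gbinomial)

lemma gbin_0 [simp]: "gbin m 0 = 1"
  by (simp add: gbin_def)

lemma gbin_0_left: "gbin 0 i = (if i = 0 then 1 else 0)"
  using gbin_nat[of 0 i] by (cases i) auto

text \<open>The coefficients of (1 + x)^(-2); they produce the factor n in the derivative property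
  of modules.\<close>

lemma gbin_minus2: "gbin (-2) i = (-1) ^ i * (1 + of_nat i)"
proof -
  have "gbin (-2) i = (-1) ^ i * ((of_nat (Suc i) :: complex) gchoose i)"
    unfolding gbin_def using gbinomial_negated_upper[of "-2 :: complex" i] by (simp add: add.commute)
  also have "(of_nat (Suc i) :: complex) gchoose i = of_nat (Suc i choose i)"
    by (simp only: binomial_gbinomial)
  finally show ?thesis by simp
qed

text \<open>Negating the upper index turns binom(R - i, B - i) into (-1)^(B - i) binom(B - R - 1, B
  - i). The new upper index \<open>?b\<close> is independent of i, so the ordinary Vandermonde
  convolution applies; a second negation restores the form.\<close>

lemma gbin_Vandermonde:
  "(\<Sum>i\<le>B. ((-1) ^ i * gbin m i) * gbin (R - int i) (B - i)) = gbin (R - m) B"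
proof -
  let ?b = "of_nat B - of_int R - 1 :: complex"
  have "((-1) ^ i * gbin m i) * gbin (R - int i) (B - i)
      = (-1) ^ B * ((of_int m gchoose i) * (?b gchoose (B - i)))" if "i \<le> B" for i
  proof -
    have "gbin (R - int i) (B - i) = (-1) ^ (B - i) * (?b gchoose (B - i))"
      unfolding gbin_def gbinomial_negated_upper[of "of_int (R - int i)" "B - i"]
      using that by (simp add: of_nat_diff)
    moreover have "(-1) ^ i * (-1) ^ (B - i) = ((-1) ^ B :: complex)"
      using that by (simp flip: power_add)
    ultimately show ?thesis by (simp add: gbin_def mult.assoc mult.left_commute)
  qed
  then have "(\<Sum>i\<le>B. ((-1) ^ i * gbin m i) * gbin (R - int i) (B - i))
      = (-1) ^ B * ((of_int m + ?b) gchoose B)"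
    by (simp add: sum_distrib_left[symmetric] gbinomial_Vandermonde[symmetric] atMost_atLeast0)
  also have "\<dots> = gbin (R - m) B"
    unfolding gbin_def gbinomial_negated_upper[of "of_int (R - m)" B] by (simp add: algebra_simps)
  finally show ?thesis .
qed

lemma fsum_scale: "fsum (\<lambda>i. c *\<^sub>C f i) = c *\<^sub>C fsum f"
  by (cases "c = 0") (simp_all add: fsum_def cv.scale_sum_right)

definition triples :: "nat \<Rightarrow> (nat \<times> nat \<times> nat) set" where
  "triples s = {(a, b, c). a + b + c = s}"

lemma finite_triples [simp]: "finite (triples s)"
  by (rule finite_subset[of _ "{..s} \<times> {..s} \<times> {..s}"]) (auto simp: triples_def)

text \<open>L(1) acts on a product by raising one of three exponents. If the summand vanishes where
  that exponent is 0, the raised sum over total s is already the full sum over total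
  \<open>Suc s\<close>.\<close>

lemma sum_triples_shift:
  fixes F :: "nat \<Rightarrow> nat \<Rightarrow> nat \<Rightarrow> 'a::comm_monoid_add"
  shows "(\<And>b c. F 0 b c = 0) \<Longrightarrow>
      (\<Sum>(a, b, c)\<in>triples s. F (Suc a) b c) = (\<Sum>(a, b, c)\<in>triples (Suc s). F a b c)"
    and "(\<And>a c. F a 0 c = 0) \<Longrightarrow>
      (\<Sum>(a, b, c)\<in>triples s. F a (Suc b) c) = (\<Sum>(a, b, c)\<in>triples (Suc s). F a b c)"
    and "(\<And>a b. F a b 0 = 0) \<Longrightarrow>
      (\<Sum>(a, b, c)\<in>triples s. F a b (Suc c)) = (\<Sum>(a, b, c)\<in>triples (Suc s). F a b c)"
proof -
  assume F: "\<And>b c. F 0 b c = 0"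
  show "(\<Sum>(a, b, c)\<in>triples s. F (Suc a) b c) = (\<Sum>(a, b, c)\<in>triples (Suc s). F a b c)"
    by (rule sum.reindex_bij_witness_not_neutral[of "{}" "{x \<in> triples (Suc s). fst x = 0}" _
          "\<lambda>(a, b, c). (a - 1, b, c)" "\<lambda>(a, b, c). (Suc a, b, c)"])
      (auto simp: F, auto simp: triples_def gr0_conv_Suc)
next
  assume F: "\<And>a c. F a 0 c = 0"
  show "(\<Sum>(a, b, c)\<in>triples s. F a (Suc b) c) = (\<Sum>(a, b, c)\<in>triples (Suc s). F a b c)"
    by (rule sum.reindex_bij_witness_not_neutral[of "{}" "{x \<in> triples (Suc s). fst (snd x) = 0}" _
          "\<lambda>(a, b, c). (a, b - 1, c)" "\<lambda>(a, b, c). (a, Suc b, c)"])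
      (auto simp: F, auto simp: triples_def gr0_conv_Suc)
next
  assume F: "\<And>a b. F a b 0 = 0"
  show "(\<Sum>(a, b, c)\<in>triples s. F a b (Suc c)) = (\<Sum>(a, b, c)\<in>triples (Suc s). F a b c)"
    by (rule sum.reindex_bij_witness_not_neutral[of "{}" "{x \<in> triples (Suc s). snd (snd x) = 0}" _
          "\<lambda>(a, b, c). (a, b, c - 1)" "\<lambda>(a, b, c). (a, b, Suc c)"])
      (auto simp: F, auto simp: triples_def gr0_conv_Suc)
qed

text \<open>Support in a box with sides A and B forces i + j < A + B, so regrouping by total degree
  up to any larger S loses nothing. Total degree is the index under which powers of L(1)
  act.\<close>

lemma sum_pairs_by_total:
  fixes f :: "nat \<Rightarrow> nat \<Rightarrow> 'a::comm_monoid_add"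
  assumes "\<And>i j. i \<ge> A \<or> j \<ge> B \<Longrightarrow> f i j = 0" "A + B \<le> S"
  shows "(\<Sum>i<A. \<Sum>j<B. f i j) = (\<Sum>s<S. \<Sum>i\<le>s. f i (s - i))"
proof -
  have "(\<Sum>i<A. \<Sum>j<B. f i j) = (\<Sum>(i, j)\<in>{..<A} \<times> {..<B}. f i j)"
    by (simp add: sum.cartesian_product)
  also have "\<dots> = (\<Sum>(i, j)\<in>{(i, j). i + j < S}. f i j)"
  proof (rule sum.mono_neutral_left)
    show "finite {(i, j). i + j < S}"
      by (rule finite_subset[of _ "{..<S} \<times> {..<S}"]) auto
  qed (use assms in \<open>auto simp: not_less[symmetric]\<close>)
  also have "\<dots> = (\<Sum>s<S. \<Sum>i\<le>s. f i (s - i))"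
    by (rule sum.triangle_reindex)
  finally show ?thesis .
qed

lemma sum_triples_by_total:
  fixes f :: "nat \<Rightarrow> nat \<Rightarrow> nat \<Rightarrow> 'a::comm_monoid_add"
  assumes "\<And>a b c. a \<ge> A \<or> b \<ge> B \<or> c \<ge> C \<Longrightarrow> f a b c = 0" "A + B + C \<le> S"
  shows "(\<Sum>a<A. \<Sum>c<C. \<Sum>b<B. f a b c) = (\<Sum>s<S. \<Sum>(a, b, c)\<in>triples s. f a b c)"
proof -
  let ?D = "{(a, b, c). a + b + c < S}"
  have fin: "finite ?D"
    by (rule finite_subset[of _ "{..<S} \<times> {..<S} \<times> {..<S}"]) auto
  have "(\<Sum>a<A. \<Sum>c<C. \<Sum>b<B. f a b c) = (\<Sum>a<A. \<Sum>b<B. \<Sum>c<C. f a b c)"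
    by (intro sum.cong refl sum.swap)
  also have "\<dots> = (\<Sum>(a, b, c)\<in>{..<A} \<times> {..<B} \<times> {..<C}. f a b c)"
    by (simp add: sum.cartesian_product)
  also have "\<dots> = (\<Sum>(a, b, c)\<in>?D. f a b c)"
    by (rule sum.mono_neutral_left[OF fin]) (use assms in \<open>auto simp: not_less[symmetric]\<close>)
  also have "\<dots> = (\<Sum>s<S. \<Sum>x\<in>{x\<in>?D. (\<lambda>(a, b, c). a + b + c) x = s}. (\<lambda>(a, b, c). f a b c) x)"
    by (rule sum.group[symmetric]) (auto simp: fin)
  also have "\<dots> = (\<Sum>s<S. \<Sum>(a, b, c)\<in>triples s. f a b c)"
    by (intro sum.cong refl) (auto simp: triples_def)
  finally show ?thesis .
qed

section \<open>Modes on a weak module: Jacobi identity, commutators with L(0) and L(1),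
  weights\<close>

locale voa =
  fixes V :: "'v::cvec set" and Y :: "'v \<Rightarrow> int \<Rightarrow> 'v \<Rightarrow> 'v" and vac \<omega> :: 'v
  assumes voa: "is_VOA V Y vac \<omega>"

locale weak_mod = voa V Y vac \<omega>
  for V :: "'v::cvec set" and Y :: "'v \<Rightarrow> int \<Rightarrow> 'v \<Rightarrow> 'v" and vac \<omega> :: 'v +
  fixes W :: "'w::cvec set" and YW :: "'v \<Rightarrow> int \<Rightarrow> 'w \<Rightarrow> 'w"
  assumes weak: "weak_module V Y vac W YW"

context voa
begin

lemma V_sub: "csubspace V" and vac_V: "vac \<in> V" and om_V: "\<omega> \<in> V"
  and weak_V: "weak_module V Y vac V Y"
  and Y_vac: "v \<in> V \<Longrightarrow> n \<ge> 0 \<Longrightarrow> Y v n vac = 0"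
  and creation: "v \<in> V \<Longrightarrow> Y v (-1) vac = v"
  and deriv: "u \<in> V \<Longrightarrow> w \<in> V \<Longrightarrow> Y (Y \<omega> 0 u) n w = (- of_int n) *\<^sub>C Y u (n - 1) w"
  using voa unfolding is_VOA_def by blast+

text \<open>Makes every statement about modules available for V acting on itself.\<close>

lemma self: "weak_mod V Y vac \<omega> V Y"
  by unfold_locales (rule weak_V)

lemma virasoro:
  "\<exists>c::complex. \<forall>m n :: int. \<forall>v\<in>V.
         Y \<omega> (m + 1) (Y \<omega> (n + 1) v) - Y \<omega> (n + 1) (Y \<omega> (m + 1) v)
         = of_int (m - n) *\<^sub>C Y \<omega> (m + n + 1) v
           + (if m + n = 0 then (((of_int m) ^ 3 - of_int m) / 12 * c) *\<^sub>C v else 0)"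
  using voa unfolding is_VOA_def by (elim conjE) assumption

abbreviation hom :: "int \<Rightarrow> 'v set" where "hom h \<equiv> eigensp V (Y \<omega> 1) (of_int h)"

lemma hom_V: "v \<in> hom h \<Longrightarrow> v \<in> V" and hom_eig: "v \<in> hom h \<Longrightarrow> Y \<omega> 1 v = of_int h *\<^sub>C v"
  by (simp_all add: eigensp_def)

end

context weak_mod
begin

lemma W_sub: "csubspace W"
  and YW_in: "v \<in> V \<Longrightarrow> w \<in> W \<Longrightarrow> YW v n w \<in> W"
  and YW_lin: "v \<in> V \<Longrightarrow> clinear_on W (YW v n)"
  and YW_lin_v: "w \<in> W \<Longrightarrow> clinear_on V (\<lambda>v. YW v n w)"
  and YW_trunc: "v \<in> V \<Longrightarrow> w \<in> W \<Longrightarrow> \<exists>N. \<forall>n\<ge>N. YW v n w = 0"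
  and YW_vac: "w \<in> W \<Longrightarrow> YW vac n w = (if n = -1 then w else 0)"
  and YW_borch: "borcherds V Y W YW"
  using weak unfolding weak_module_def by blast+

lemma YW_0_left: "w \<in> W \<Longrightarrow> YW 0 n w = 0"
  using clinear_on_0[OF YW_lin_v V_sub] .

lemma YW_0_right: "v \<in> V \<Longrightarrow> YW v n 0 = 0"
  using clinear_on_0[OF YW_lin W_sub] .

lemma borch:
  "u \<in> V \<Longrightarrow> v \<in> V \<Longrightarrow> w \<in> W \<Longrightarrow>
    fsum (\<lambda>i::nat. gbin m i *\<^sub>C YW (Y u (l + int i) v) (m + n - int i) w)
      = fsum (\<lambda>i::nat. ((-1) ^ i * gbin l i) *\<^sub>C
           (YW u (m + l - int i) (YW v (n + int i) w)
            - ((-1) powi l) *\<^sub>C YW v (n + l - int i) (YW u (m + int i) w)))"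
  using YW_borch unfolding borcherds_def by blast

lemma trunc_ev:
  assumes "v \<in> V" "w \<in> W" shows "\<exists>N. \<forall>i\<ge>N. YW v (n + int i) w = 0"
proof -
  obtain N where N: "\<forall>k\<ge>N. YW v k w = 0" using YW_trunc assms by blast
  have "YW v (n + int i) w = 0" if "i \<ge> nat (N - n)" for i using N that by auto
  then show ?thesis by blast
qed

text \<open>Three truncations are involved, of u on v, of v on w and of u on w. Past all of them
  both sides of the Jacobi identity agree with partial sums of one common length, the form in which
  several instances can be combined.\<close>

lemma borch_ev:
  assumes "u \<in> V" "v \<in> V" "w \<in> W"
  shows "\<forall>\<^sub>F N in sequentially.
    (\<Sum>i<N. gbin m i *\<^sub>C YW (Y u (l + int i) v) (m + n - int i) w)
      = (\<Sum>i<N. ((-1) ^ i * gbin l i) *\<^sub>C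
           (YW u (m + l - int i) (YW v (n + int i) w)
            - ((-1) powi l) *\<^sub>C YW v (n + l - int i) (YW u (m + int i) w)))"
proof -
  obtain N1 where N1: "\<forall>i\<ge>N1. Y u (l + int i) v = 0"
    using weak_mod.trunc_ev[OF self] assms by blast
  obtain N2 where N2: "\<forall>i\<ge>N2. YW v (n + int i) w = 0" using trunc_ev assms by blast
  obtain N3 where N3: "\<forall>i\<ge>N3. YW u (m + int i) w = 0" using trunc_ev assms by blast
  show ?thesis unfolding eventually_sequentially
  proof (intro exI[of _ "max N1 (max N2 N3)"] allI impI)
    fix N assume "max N1 (max N2 N3) \<le> N"
    then have N: "N1 \<le> N" "N2 \<le> N" "N3 \<le> N" by auto
    show "(\<Sum>i<N. gbin m i *\<^sub>C YW (Y u (l + int i) v) (m + n - int i) w)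
      = (\<Sum>i<N. ((-1) ^ i * gbin l i) *\<^sub>C
           (YW u (m + l - int i) (YW v (n + int i) w)
            - ((-1) powi l) *\<^sub>C YW v (n + l - int i) (YW u (m + int i) w)))"
      using borch[OF assms, of m l n] N N1 N2 N3 assms
      by (subst (asm) (1 2) fsum_eq_sum_lessThan[of N])
        (auto simp: YW_0_left YW_0_right)
  qed
qed

text \<open>The case l = 0 of the Jacobi identity: binom(0, i) leaves only i = 0 among the products
  of modes, and a nonnegative mode p makes the other side stop at i = p.\<close>

lemma commutator:
  assumes "u \<in> V" "v \<in> V" "w \<in> W"
  shows "YW u (int p) (YW v n w) - YW v n (YW u (int p) w)
    = (\<Sum>i\<le>p. of_nat (p choose i) *\<^sub>C YW (Y u (int i) v) (int p + n - int i) w)"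
proof -
  have "fsum (\<lambda>i. ((-1) ^ i * gbin 0 i) *\<^sub>C
           (YW u (int p + 0 - int i) (YW v (n + int i) w)
            - ((-1) powi 0) *\<^sub>C YW v (n + 0 - int i) (YW u (int p + int i) w)))
     = YW u (int p) (YW v n w) - YW v n (YW u (int p) w)"
    by (subst fsum_single[of 0]) (simp_all add: gbin_0_left)
  moreover have "fsum (\<lambda>i. gbin (int p) i *\<^sub>C YW (Y u (0 + int i) v) (int p + n - int i) w)
     = (\<Sum>i\<le>p. of_nat (p choose i) *\<^sub>C YW (Y u (int i) v) (int p + n - int i) w)"
    by (subst fsum_eq_sum[of "{..p}"]) (auto simp: gbin_nat)
  ultimately show ?thesis using borch[OF assms, of "int p" 0 n] by simp
qed

text \<open>The L(-1)-derivative property is an axiom for V only. On V, the axiom applied to the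
  vacuum together with creation gives L(-1)u = u_(-2) vac; the Jacobi identity for u, the vacuum and
  l = -2 then transfers the property to W.\<close>

lemma derivative:
  assumes u: "u \<in> V" and w: "w \<in> W"
  shows "YW (Y \<omega> 0 u) n w = (- of_int n) *\<^sub>C YW u (n - 1) w"
proof -
  have L: "Y \<omega> 0 u \<in> V" using weak_mod.YW_in[OF self] om_V u by blast
  have eq: "Y \<omega> 0 u = Y u (-2) vac"
    using deriv[OF u vac_V, of "-1"] creation[OF L] by simp
  let ?f = "\<lambda>i::nat. ((-1) ^ i * gbin (-2) i) *\<^sub>C
           (YW u (0 + - 2 - int i) (YW vac (n + int i) w)
            - ((-1) powi (-2)) *\<^sub>C YW vac (n + - 2 - int i) (YW u (0 + int i) w))"
  let ?g = "\<lambda>i::nat. (1 + of_nat i) *\<^sub>C ((if int i = - 1 - n then YW u (-2 - int i) w else 0)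
            - (if int i = n - 1 then YW u (int i) w else 0))"
  have f: "?f = ?g"
  proof
    fix i
    have "(-1) ^ i * gbin (-2) i = (1 + of_nat i :: complex)"
      by (simp add: gbin_minus2 flip: power_mult_distrib mult.assoc)
    then show "?f i = ?g i" using u w
      by (auto simp: YW_vac YW_in YW_0_right power_int_minus)
  qed
  have "fsum (\<lambda>i. gbin 0 i *\<^sub>C YW (Y u (- 2 + int i) vac) (0 + n - int i) w)
     = YW (Y u (-2) vac) n w"
    by (subst fsum_single[of 0]) (simp_all add: gbin_0_left)
  then have "YW (Y \<omega> 0 u) n w = fsum ?f" using borch[OF u vac_V w, of 0 "-2" n] eq by simp
  also have "fsum ?f = fsum ?g" by (simp only: f)
  \<comment> \<open>The two terms of \<open>?g\<close> live at i = -1 - n and i = n - 1. At most one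
    of these is a natural number, according to the sign of n, and either way the coefficient 1 + i
    yields -n.\<close>
  also have "\<dots> = (- of_int n) *\<^sub>C YW u (n - 1) w"
  proof (cases n "0::int" rule: linorder_cases)
    case less
    then have "fsum ?g = ?g (nat (-1 - n))" by (intro fsum_single) auto
    then show ?thesis using less by simp
  next
    case equal
    then have "fsum ?g = 0" by (intro fsum_zero) auto
    then show ?thesis using equal by simp
  next
    case greater
    then have "fsum ?g = ?g (nat (n - 1))" by (intro fsum_single) auto
    then show ?thesis using greater by (simp add: cv.scale_minus_left)
  qed
  finally show ?thesis .
qed

lemma L0_mode:
  assumes v: "v \<in> hom h" and w: "w \<in> W"
  shows "YW \<omega> 1 (YW v n w) = YW v n (YW \<omega> 1 w) + of_int (h - n - 1) *\<^sub>C YW v n w"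
proof -
  have vV: "v \<in> V" using v hom_V by blast
  have "YW \<omega> 1 (YW v n w) - YW v n (YW \<omega> 1 w)
     = YW (Y \<omega> 0 v) (n + 1) w + YW (Y \<omega> 1 v) n w"
    using commutator[OF om_V vV w, of 1 n] by (simp add: add.commute)
  also have "YW (Y \<omega> 1 v) n w = of_int h *\<^sub>C YW v n w"
    using v vV w by (simp add: hom_eig clinear_on_scale[OF YW_lin_v])
  finally show ?thesis using derivative[OF vV w, of "n + 1"]
    by (simp add: algebra_simps cv.scale_left_diff_distrib)
qed

text \<open>The commutator formula at p = 2: L(-1)v contributes -(n + 2), twice L(0)v contributes
  2h. The term with L(1)v is the obstruction to v being quasi-primary and the source of all higher
  powers of L(1) below.\<close>

lemma L1_mode:
  assumes v: "v \<in> hom h" and w: "w \<in> W"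
  shows "YW \<omega> 2 (YW v n w) = YW (Y \<omega> 2 v) n w
    + of_int (2 * h - n - 2) *\<^sub>C YW v (n + 1) w + YW v n (YW \<omega> 2 w)"
proof -
  have vV: "v \<in> V" using v hom_V by blast
  have "YW \<omega> 2 (YW v n w) - YW v n (YW \<omega> 2 w)
     = YW (Y \<omega> 0 v) (n + 2) w + 2 *\<^sub>C YW (Y \<omega> 1 v) (n + 1) w + YW (Y \<omega> 2 v) n w"
    using commutator[OF om_V vV w, of 2 n]
    by (simp add: numeral_2_eq_2 add.commute add.left_commute)
  also have "YW (Y \<omega> 1 v) (n + 1) w = of_int h *\<^sub>C YW v (n + 1) w"
    using v vV w by (simp add: hom_eig clinear_on_scale[OF YW_lin_v])
  finally show ?thesis using derivative[OF vV w, of "n + 2"]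
    by (simp add: algebra_simps cv.scale_left_diff_distrib)
qed

text \<open>Moving L(0) - (p + h - n - 1) to the right past v_n turns it into L(0) - p, so the same
  power annihilates the image.\<close>

lemma mode_weight:
  assumes v: "v \<in> hom h" and w: "w \<in> gen_eigensp W (YW \<omega> 1) p"
  shows "YW v n w \<in> gen_eigensp W (YW \<omega> 1) (p + of_int (h - n - 1))"
proof -
  have vV: "v \<in> V" using v hom_V by blast
  let ?S = "\<lambda>x. YW \<omega> 1 x - p *\<^sub>C x"
  let ?S' = "\<lambda>x. YW \<omega> 1 x - (p + of_int (h - n - 1)) *\<^sub>C x"
  have SW: "?S x \<in> W" if "x \<in> W" for x
    using that by (intro csubspace_diff csubspace_scale W_sub YW_in om_V)
  have step: "?S' (YW v n x) = YW v n (?S x)" if "x \<in> W" for x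
    using that L0_mode[OF v that, of n] W_sub
    by (simp add: clinear_on_diff[OF YW_lin[OF vV] W_sub] YW_in om_V csubspace_scale
        clinear_on_scale[OF YW_lin[OF vV]] algebra_simps)
  have pow: "(?S' ^^ k) (YW v n x) = YW v n ((?S ^^ k) x) \<and> (?S ^^ k) x \<in> W" if "x \<in> W" for x k
  proof (induction k)
    case (Suc k)
    then show ?case using step SW by simp
  qed (use that in simp)
  from w obtain k where "w \<in> W" "(?S ^^ k) w = 0" unfolding gen_eigensp_def by blast
  then have "(?S' ^^ k) (YW v n w) = 0" using pow[of w k] YW_0_right[OF vV] by simp
  then show ?thesis using \<open>w \<in> W\<close> vV YW_in unfolding gen_eigensp_def by blast
qed

end

section \<open>Powers of L(1) acting on products\<close>

context voa
begin

section \<open>The integral, semisimple grading of V\<close>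

lemma V_int_dec:
  assumes "v \<in> V"
  obtains f :: "int \<Rightarrow> 'v" where "finite {n. f n \<noteq> 0}" "\<And>n. f n \<in> hom n" "v = fsum f"
proof -
  have "\<forall>v\<in>V. \<exists>f :: int \<Rightarrow> 'v. finite {n. f n \<noteq> 0} \<and> (\<forall>n. f n \<in> hom n) \<and> v = fsum f"
    using voa unfolding is_VOA_def by (elim conjE) assumption
  then show thesis using assms that by blast
qed

lemma eigensp_gen: "eigensp V (Y \<omega> 1) c \<subseteq> gen_eigensp V (Y \<omega> 1) c"
  by (auto simp: eigensp_def gen_eigensp_def intro: exI[of _ 1])

text \<open>The axioms grade V by integers while \<open>graded_space\<close> uses complex
  eigenvalues. The integral family is extended by zero off the integers, with the floor of the real
  part recovering the index.\<close>

lemma V_dec: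
  assumes "v \<in> V"
  obtains g where "finite {c. g c \<noteq> 0}" "\<And>c. g c \<in> eigensp V (Y \<omega> 1) c" "v = fsum g"
    "\<And>c. c \<notin> \<int> \<Longrightarrow> g c = 0"
proof -
  obtain f where f: "finite {n. f n \<noteq> 0}" "\<And>n. f n \<in> hom n" "v = fsum f"
    using V_int_dec[OF assms] by blast
  define g where "g c = (if c \<in> \<int> then f \<lfloor>Re c\<rfloor> else 0)" for c
  have g_int: "g (of_int n) = f n" for n by (simp add: g_def)
  have supp: "{c. g c \<noteq> 0} = of_int ` {n. f n \<noteq> 0}"
    by (auto simp: g_int g_def elim!: Ints_cases)
  have "fsum g = (\<Sum>n | f n \<noteq> 0. g (of_int n))"
    unfolding fsum_def supp by (subst sum.reindex) (auto simp: inj_on_def)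
  then have "v = fsum g" using f(3) by (simp add: g_int fsum_def)
  moreover have "g c \<in> eigensp V (Y \<omega> 1) c" for c
  proof (cases "c \<in> \<int>")
    case True then show ?thesis using f(2) by (auto elim!: Ints_cases simp: g_int)
  next
    case False
    moreover have "Y \<omega> 1 0 = 0" using weak_mod.YW_0_right[OF self om_V] .
    ultimately show ?thesis using V_sub by (simp add: g_def eigensp_def csubspace_0)
  qed
  moreover have "finite {c. g c \<noteq> 0}" unfolding supp using f(1) by simp
  moreover have "g c = 0" if "c \<notin> \<int>" for c using that by (simp add: g_def)
  ultimately show thesis using that by blast
qed

lemma graded_V: "graded_space V (Y \<omega> 1)"
proof
  fix w assume "w \<in> V"
  then obtain g where "finite {c. g c \<noteq> 0}" "\<And>c. g c \<in> eigensp V (Y \<omega> 1) c" "w = fsum g"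
    using V_dec by blast
  then show "\<exists>f. finite {n. f n \<noteq> 0} \<and> (\<forall>n. f n \<in> gen_eigensp V (Y \<omega> 1) n) \<and> w = fsum f"
    using eigensp_gen by blast
qed (use V_sub om_V weak_mod.YW_in[OF self] weak_mod.YW_lin[OF self] in auto)

text \<open>V is a sum of true eigenvectors. By uniqueness of decompositions a generalized
  eigenvector equals its own component, which is a true eigenvector.\<close>

lemma gen_eigensp_V: "gen_eigensp V (Y \<omega> 1) c = eigensp V (Y \<omega> 1) c"
proof
  show "gen_eigensp V (Y \<omega> 1) c \<subseteq> eigensp V (Y \<omega> 1) c"
  proof
    fix v assume v: "v \<in> gen_eigensp V (Y \<omega> 1) c"
    then have "v \<in> V" by (simp add: gen_eigensp_def)
    then obtain g where g: "finite {c. g c \<noteq> 0}" "\<And>c. g c \<in> eigensp V (Y \<omega> 1) c" "v = fsum g"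
      using V_dec by blast
    then have "decomp V (Y \<omega> 1) v = g"
      using eigensp_gen by (intro graded_space.decomp_eqI[OF graded_V]) auto
    then have "v = g c" using graded_space.\<pi>_G[OF graded_V v, of c] by simp
    then show "v \<in> eigensp V (Y \<omega> 1) c" using g(2) by simp
  qed
qed (rule eigensp_gen)

lemma gen_eigensp_V_nonint: "c \<notin> \<int> \<Longrightarrow> v \<in> gen_eigensp V (Y \<omega> 1) c \<Longrightarrow> v = 0"
proof -
  assume c: "c \<notin> \<int>" and v: "v \<in> gen_eigensp V (Y \<omega> 1) c"
  then have "v \<in> V" by (simp add: gen_eigensp_def)
  then obtain g where g: "finite {c. g c \<noteq> 0}" "\<And>c. g c \<in> eigensp V (Y \<omega> 1) c" "v = fsum g"
    "\<And>c. c \<notin> \<int> \<Longrightarrow> g c = 0"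
    using V_dec by blast
  then have "decomp V (Y \<omega> 1) v = g"
    using eigensp_gen by (intro graded_space.decomp_eqI[OF graded_V]) auto
  then show "v = 0" using graded_space.\<pi>_G[OF graded_V v, of c] g(4)[OF c] by simp
qed

lemma hom_induct [consumes 1, case_names zero add hom]:
  assumes "v \<in> V" "P 0" "\<And>x y. x \<in> V \<Longrightarrow> y \<in> V \<Longrightarrow> P x \<Longrightarrow> P y \<Longrightarrow> P (x + y)"
    "\<And>h x. x \<in> hom h \<Longrightarrow> P x"
  shows "P v"
proof (rule graded_space.graded_induct[OF graded_V assms(1), of P])
  fix n x assume x: "x \<in> gen_eigensp V (Y \<omega> 1) n"
  show "P x"
  proof (cases "n \<in> \<int>")
    case True
    then show ?thesis using x assms(4) by (auto simp: gen_eigensp_V elim!: Ints_cases)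
  next
    case False
    then show ?thesis using gen_eigensp_V_nonint[OF _ x] assms(2) by simp
  qed
qed (use assms in auto)

lemma lin_eq_hom:
  assumes "v \<in> V" "clinear_on V f" "clinear_on V g" "\<And>h x. x \<in> hom h \<Longrightarrow> f x = g x"
  shows "f v = g v"
  using assms(1)
  by (induction rule: hom_induct)
    (use assms V_sub in \<open>auto simp: clinear_on_add clinear_on_0\<close>)

abbreviation comp where "comp v h \<equiv> decomp V (Y \<omega> 1) v (of_int h)"

lemma comp_in: "v \<in> V \<Longrightarrow> comp v h \<in> hom h"
  using graded_space.\<pi>_in[OF graded_V] gen_eigensp_V by blast

lemma comp_finite: "v \<in> V \<Longrightarrow> finite {h. comp v h \<noteq> 0}"
  using finite_vimageI[OF graded_space.\<pi>_finite[OF graded_V], of v "of_int :: int \<Rightarrow> complex"]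
  by (simp add: inj_on_def vimage_def)

lemma comp_lin: "clinear_on V (\<lambda>v. comp v h)"
  by (rule graded_space.\<pi>_lin[OF graded_V])

lemma comp_hom: "v \<in> hom h \<Longrightarrow> comp v k = (if k = h then v else 0)"
  using graded_space.\<pi>_G[OF graded_V, of v "of_int h" "of_int k"] gen_eigensp_V by auto

lemma hom_sub: "csubspace (hom h)"
  using graded_space.G_sub[OF graded_V] gen_eigensp_V by metis

text \<open>One lower bound for the weights of V. Since L(1) lowers weight by one, L(1)^j vanishes
  on weight h once j > h - \<open>lb\<close>; this gives the explicit cutoff
  \<open>nat (h - lb + 1)\<close> used throughout.\<close>

definition lb :: int where "lb = (SOME N. \<forall>n<N. hom n = {0})"

lemma hom_lb: "n < lb \<Longrightarrow> v \<in> hom n \<Longrightarrow> v = 0"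
proof -
  have "\<exists>N::int. \<forall>n<N. hom n = {0}"
    using voa unfolding is_VOA_def by (elim conjE) assumption
  then have "\<forall>n<lb. hom n = {0}" unfolding lb_def by (rule someI_ex)
  then show "n < lb \<Longrightarrow> v \<in> hom n \<Longrightarrow> v = 0" by blast
qed

section \<open>Divided powers of L(1) and their action on products\<close>

abbreviation "L1 \<equiv> Y \<omega> 2"

text \<open>The coefficients of e^(xL(1)). With the factorial built in, later formulas involve only
  binomial coefficients.\<close>

definition E :: "nat \<Rightarrow> 'v \<Rightarrow> 'v" where "E j v = (1 / fact j) *\<^sub>C (L1 ^^ j) v"

lemma mode_hom: "u \<in> hom h \<Longrightarrow> v \<in> hom h' \<Longrightarrow> Y u n v \<in> hom (h + h' - n - 1)"
  using weak_mod.mode_weight[OF self, of u h v "of_int h'" n] gen_eigensp_V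
  by (simp add: algebra_simps)

lemma \<omega>_eq: "Y \<omega> (-1) vac = \<omega>"
  using creation om_V by blast

text \<open>The Virasoro relation is applied to the vacuum, using \<omega> = L(-2) vac. The pairs
  (0, -2) and (1, -2) have nonzero sum, so the central term is absent. As both vectors are killed by
  L(1), their opposite modes consist of a single term.\<close>

lemma \<omega>_hom: "\<omega> \<in> hom 2" and L1_\<omega>: "L1 \<omega> = 0" and vac_hom: "vac \<in> hom 0"
  and L1_vac: "L1 vac = 0"
proof -
  note vacs = Y_vac[OF om_V] vac_V
  have Y0: "Y \<omega> n 0 = 0" for n using weak_mod.YW_0_right[OF self om_V] .
  obtain c :: complex where vir: "\<And>m n v. v \<in> V \<Longrightarrow>
         Y \<omega> (m + 1) (Y \<omega> (n + 1) v) - Y \<omega> (n + 1) (Y \<omega> (m + 1) v)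
         = of_int (m - n) *\<^sub>C Y \<omega> (m + n + 1) v
           + (if m + n = 0 then (((of_int m) ^ 3 - of_int m) / 12 * c) *\<^sub>C v else 0)"
    using virasoro by blast
  show "\<omega> \<in> hom 2"
    using vir[OF vac_V, of 0 "-2"] \<omega>_eq vacs(1)[of 1] by (simp add: eigensp_def om_V Y0)
  show "L1 \<omega> = 0"
    using vir[OF vac_V, of 1 "-2"] \<omega>_eq vacs(1)[of 2] vacs(1)[of 0] by (simp add: Y0)
  show "vac \<in> hom 0" using vacs by (simp add: eigensp_def)
  show "L1 vac = 0" using vacs by simp
qed

lemma L1_hom: "v \<in> hom h \<Longrightarrow> L1 v \<in> hom (h - 1)"
  using mode_hom[OF \<omega>_hom, of v h 2] by (simp add: algebra_simps)

lemma L1_lin: "clinear_on V L1" and L1_V: "v \<in> V \<Longrightarrow> L1 v \<in> V"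
  using weak_mod.YW_lin[OF self om_V] weak_mod.YW_in[OF self om_V] by auto

lemma L1_pow_V: "v \<in> V \<Longrightarrow> (L1 ^^ j) v \<in> V"
  by (induction j) (auto simp: L1_V)

lemma L1_pow_lin: "clinear_on V (L1 ^^ j)"
proof (induction j)
  case (Suc j)
  then show ?case using L1_lin L1_pow_V[of _ j] unfolding clinear_on_def by simp
qed (simp add: clinear_on_def)

lemma L1_pow_hom: "v \<in> hom h \<Longrightarrow> (L1 ^^ j) v \<in> hom (h - int j)"
proof (induction j)
  case (Suc j)
  then show ?case using L1_hom[of "(L1 ^^ j) v" "h - int j"] by (simp add: algebra_simps)
qed simp

lemma L1_pow_0: "(L1 ^^ j) 0 = 0"
  using clinear_on_0[OF L1_pow_lin V_sub] .

lemma L1_pow_zero: "v \<in> hom h \<Longrightarrow> j \<ge> nat (h - lb + 1) \<Longrightarrow> (L1 ^^ j) v = 0"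
  by (rule hom_lb[OF _ L1_pow_hom]) auto

lemma E_hom: "v \<in> hom h \<Longrightarrow> E j v \<in> hom (h - int j)"
  unfolding E_def by (intro csubspace_scale hom_sub L1_pow_hom)

lemma E_V: "v \<in> V \<Longrightarrow> E j v \<in> V"
  unfolding E_def by (intro csubspace_scale V_sub L1_pow_V)

lemma E_0 [simp]: "E 0 v = v"
  by (simp add: E_def)

lemma E_zero: "v \<in> hom h \<Longrightarrow> j \<ge> nat (h - lb + 1) \<Longrightarrow> E j v = 0"
  unfolding E_def by (simp add: L1_pow_zero)

lemma E_lin: "clinear_on V (E j)"
  unfolding E_def by (intro clinear_on_scaleI L1_pow_lin)

lemma L1_E: "v \<in> V \<Longrightarrow> L1 (E j v) = of_nat (Suc j) *\<^sub>C E (Suc j) v"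
proof -
  assume "v \<in> V"
  moreover have "1 / fact j = of_nat (Suc j) * (1 / fact (Suc j)) * (1::complex)"
    by (simp del: of_nat_Suc)
  ultimately show ?thesis unfolding E_def
    by (simp add: clinear_on_scale[OF L1_lin] L1_pow_V del: of_nat_Suc fact_Suc)
qed

lemma E_E: "v \<in> V \<Longrightarrow> E i (E j v) = of_nat ((i + j) choose i) *\<^sub>C E (i + j) v"
  unfolding E_def
  by (simp add: clinear_on_scale[OF L1_pow_lin] L1_pow_V funpow_add binomial_fact)

text \<open>The recursion satisfied by the coefficients in \<open>E_mode\<close>: the three summands
  come from raising the exponent a, b or c. It combines Pascal's rule with the absorption identity
  for binomials.\<close>

lemma L1_coefficient:
  "of_nat a * gbin (Q - int a + 1) b
    + (if b = 0 then 0 else of_int (Q - 2 * int a - int b + 1) * gbin (Q - int a) (b - 1))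
    + of_nat c * gbin (Q - int a) b = of_nat (a + b + c) * gbin (Q - int a) b"
proof (cases b)
  case (Suc k)
  let ?q = "of_int Q - of_nat a :: complex"
  have "of_nat (Suc k) * (?q gchoose Suc k) = (?q - of_nat k) * (?q gchoose k)"
    using gbinomial_mult_1[of ?q k] by (simp add: algebra_simps)
  moreover have "(?q + 1) gchoose (Suc k) = (?q gchoose k) + (?q gchoose Suc k)"
    by (rule gbinomial_Suc_Suc)
  ultimately show ?thesis by (simp add: Suc gbin_def algebra_simps)
qed (simp add: algebra_simps)

text \<open>The mode form of the conjugation of Y(u, x_0) by e^(xL(1)), which gives Y(e^(x(1 - x
  x_0)L(1)) (1 - x x_0)^(-2L(0)) u, x_0/(1 - x x_0)). Here a counts powers of L(1) on u, b is the
  expansion degree in x x_0, and c belongs to the factor e^(xL(1)) left on v.\<close>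

lemma E_mode:
  assumes u: "u \<in> hom h" and v: "v \<in> V"
  shows "E j (Y u k v)
    = (\<Sum>(a, b, c)\<in>triples j. gbin (2 * h - k - 2 - int a) b *\<^sub>C Y (E a u) (k + int b) (E c v))"
proof (induction j)
  case 0
  have "triples 0 = {(0, 0, 0)}" by (auto simp: triples_def)
  then show ?case by simp
next
  case (Suc j)
  interpret self: weak_mod V Y vac \<omega> V Y by (rule self)
  let ?Q = "2 * h - k - 2"
  let ?g = "\<lambda>a b c. Y (E a u) (k + int b) (E c v)"
  have uV: "u \<in> V" using u hom_V by blast
  have gV: "?g a b c \<in> V" for a b c using E_V uV v self.YW_in by blast
  \<comment> \<open>\<open>E a u\<close> has weight h - a and stands at mode k + b, which gives the
    middle factor 2(h - a) - (k + b) - 2.\<close>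
  have step: "L1 (?g a b c) = of_nat (Suc a) *\<^sub>C ?g (Suc a) b c
      + of_int (?Q - 2 * int a - int b) *\<^sub>C ?g a (Suc b) c + of_nat (Suc c) *\<^sub>C ?g a b (Suc c)"
    for a b c
    using self.L1_mode[OF E_hom[OF u] E_V[OF v], of a "k + int b" c] E_V[OF uV] E_V[OF v]
    by (simp add: L1_E uV v clinear_on_scale[OF self.YW_lin] clinear_on_scale[OF self.YW_lin_v]
        of_nat_Suc[where 'a = int] algebra_simps del: of_nat_Suc)
  \<comment> \<open>The whole comparison is made after multiplication by j + 1, so that no division
    appears until the factor is cancelled at the end.\<close>
  have "of_nat (Suc j) *\<^sub>C E (Suc j) (Y u k v) = L1 (E j (Y u k v))"
    using L1_E self.YW_in uV v by simp
  also have "\<dots> = (\<Sum>(a, b, c)\<in>triples j. gbin (?Q - int a) b *\<^sub>C L1 (?g a b c))"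
    unfolding Suc.IH using gV
    by (subst clinear_on_sum[OF L1_lin V_sub])
      (auto intro!: csubspace_scale V_sub sum.cong simp: clinear_on_scale[OF L1_lin])
  also have "\<dots> = (\<Sum>(a, b, c)\<in>triples j. (of_nat (Suc a) * gbin (?Q - int a) b) *\<^sub>C ?g (Suc a) b c)
     + (\<Sum>(a, b, c)\<in>triples j. (of_int (?Q - 2 * int a - int b) * gbin (?Q - int a) b) *\<^sub>C ?g a (Suc b) c)
     + (\<Sum>(a, b, c)\<in>triples j. (of_nat (Suc c) * gbin (?Q - int a) b) *\<^sub>C ?g a b (Suc c))"
    unfolding step sum.distrib[symmetric]
    by (intro sum.cong refl) (auto simp: cscale_right_distrib mult.commute)
  also have "(\<Sum>(a, b, c)\<in>triples j. (of_nat (Suc a) * gbin (?Q - int a) b) *\<^sub>C ?g (Suc a) b c)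
     = (\<Sum>(a, b, c)\<in>triples (Suc j). (of_nat a * gbin (?Q - int a + 1) b) *\<^sub>C ?g a b c)"
    by (subst sum_triples_shift(1)[symmetric]) (simp_all add: algebra_simps)
  also have "(\<Sum>(a, b, c)\<in>triples j. (of_int (?Q - 2 * int a - int b) * gbin (?Q - int a) b) *\<^sub>C ?g a (Suc b) c)
     = (\<Sum>(a, b, c)\<in>triples (Suc j). (if b = 0 then 0 else of_int (?Q - 2 * int a - int b + 1) * gbin (?Q - int a) (b - 1)) *\<^sub>C ?g a b c)"
    by (subst sum_triples_shift(2)[symmetric]) (simp_all add: algebra_simps)
  also have "(\<Sum>(a, b, c)\<in>triples j. (of_nat (Suc c) * gbin (?Q - int a) b) *\<^sub>C ?g a b (Suc c))
     = (\<Sum>(a, b, c)\<in>triples (Suc j). (of_nat c * gbin (?Q - int a) b) *\<^sub>C ?g a b c)"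
    by (subst sum_triples_shift(3)[symmetric]) (simp_all add: algebra_simps)
  also have "(\<Sum>(a, b, c)\<in>triples (Suc j). (of_nat a * gbin (?Q - int a + 1) b) *\<^sub>C ?g a b c)
     + (\<Sum>(a, b, c)\<in>triples (Suc j). (if b = 0 then 0 else of_int (?Q - 2 * int a - int b + 1) * gbin (?Q - int a) (b - 1)) *\<^sub>C ?g a b c)
     + (\<Sum>(a, b, c)\<in>triples (Suc j). (of_nat c * gbin (?Q - int a) b) *\<^sub>C ?g a b c)
     = (\<Sum>(a, b, c)\<in>triples (Suc j). (of_nat (Suc j) * gbin (?Q - int a) b) *\<^sub>C ?g a b c)"
    unfolding sum.distrib[symmetric]
  proof (intro sum.cong refl, clarify)
    fix a b c assume "(a, b, c) \<in> triples (Suc j)"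
    then have "a + b + c = Suc j" by (simp add: triples_def)
    then show "(of_nat a * gbin (?Q - int a + 1) b) *\<^sub>C ?g a b c
      + (if b = 0 then 0 else of_int (?Q - 2 * int a - int b + 1) * gbin (?Q - int a) (b - 1)) *\<^sub>C ?g a b c
      + (of_nat c * gbin (?Q - int a) b) *\<^sub>C ?g a b c
      = (of_nat (Suc j) * gbin (?Q - int a) b) *\<^sub>C ?g a b c"
      using L1_coefficient[of a ?Q b c] by (simp only: cv.scale_left_distrib[symmetric])
  qed
  also have "\<dots> = of_nat (Suc j) *\<^sub>C (\<Sum>(a, b, c)\<in>triples (Suc j). gbin (?Q - int a) b *\<^sub>C ?g a b c)"
    unfolding cv.scale_sum_right by (intro sum.cong refl) auto
  finally show ?case
    by (rule cv.scale_left_imp_eq[rotated]) (simp del: of_nat_Suc)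
qed

text \<open>The left side of the opposite Jacobi identity, collected by total degree s. After
  \<open>E_mode\<close>, the summation index i and the expansion degree b shift the mode of
  \<open>E a u\<close> only through i + b; for fixed i + b, \<open>gbin_Vandermonde\<close> lowers
  the upper binomial index by m.\<close>

lemma E_iterate:
  assumes u: "u \<in> hom h" and v: "v \<in> V"
  shows "(\<Sum>i\<le>s. ((-1) ^ i * gbin m i) *\<^sub>C E (s - i) (Y u (l + int i) v))
    = (\<Sum>(a, b, c)\<in>triples s. gbin (2 * h - m - l - 2 - int a) b *\<^sub>C Y (E a u) (l + int b) (E c v))"
proof -
  let ?g = "\<lambda>a b c. Y (E a u) (l + int b) (E c v)"
  let ?R = "\<lambda>a. 2 * h - l - 2 - int a"
  have "(\<Sum>i\<le>s. ((-1) ^ i * gbin m i) *\<^sub>C E (s - i) (Y u (l + int i) v))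
    = (\<Sum>i\<le>s. \<Sum>(a, b, c)\<in>triples (s - i). (((-1) ^ i * gbin m i) * gbin (?R a - int i) b) *\<^sub>C ?g a (i + b) c)"
  proof (intro sum.cong refl)
    fix i
    have "2 * h - (l + int i) - 2 - int a = ?R a - int i" "l + int i + int b = l + int (i + b)" for a b
      by simp_all
    then show "((-1) ^ i * gbin m i) *\<^sub>C E (s - i) (Y u (l + int i) v)
      = (\<Sum>(a, b, c)\<in>triples (s - i). (((-1) ^ i * gbin m i) * gbin (?R a - int i) b) *\<^sub>C ?g a (i + b) c)"
      unfolding E_mode[OF u v] cv.scale_sum_right
      by (intro sum.cong refl) (clarsimp simp only: case_prod_conv cv.scale_scale)
  qed
  also have "\<dots> = (\<Sum>(i, a, b, c)\<in>Sigma {..s} (\<lambda>i. triples (s - i)).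
      (((-1) ^ i * gbin m i) * gbin (?R a - int i) b) *\<^sub>C ?g a (i + b) c)"
    by (subst sum.Sigma) auto
  \<comment> \<open>The new b is the old i + b, so i ranges over 0, ..., b inside each triple of
    total s.\<close>
  also have "\<dots> = (\<Sum>((a, b, c), i)\<in>Sigma (triples s) (\<lambda>(a, b, c). {..b}).
      (((-1) ^ i * gbin m i) * gbin (?R a - int i) (b - i)) *\<^sub>C ?g a b c)"
    by (rule sum.reindex_bij_witness[of _ "\<lambda>((a, b, c), i). (i, a, b - i, c)"
          "\<lambda>(i, a, b, c). ((a, i + b, c), i)"]) (auto simp: triples_def)
  also have "\<dots> = (\<Sum>x\<in>triples s. \<Sum>i\<in>(\<lambda>(a, b, c). {..b}) x.
      (\<lambda>((a, b, c), i). (((-1) ^ i * gbin m i) * gbin (?R a - int i) (b - i)) *\<^sub>C ?g a b c) (x, i))"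
    by (subst sum.Sigma) (auto intro!: sum.cong)
  also have "\<dots> = (\<Sum>(a, b, c)\<in>triples s. gbin (?R a - m) b *\<^sub>C ?g a b c)"
    by (intro sum.cong refl)
      (clarsimp simp only: case_prod_conv cv.scale_sum_left[symmetric] gbin_Vandermonde)
  also have "\<dots> = (\<Sum>(a, b, c)\<in>triples s. gbin (2 * h - m - l - 2 - int a) b *\<^sub>C ?g a b c)"
  proof -
    have R: "?R a - m = 2 * h - m - l - 2 - int a" for a by simp
    show ?thesis unfolding R by (rule refl)
  qed
  finally show ?thesis .
qed

end

section \<open>The opposite vertex operator\<close>

lemma powi_mult_self [simp]: "(-1) powi l * (-1) powi l = (1::complex)"
  by (simp flip: power_int_mult_distrib)

text \<open>The transform \<open>\<Phi>(v, x) \<mapsto> \<Phi>(e\<^sup>x\<^sup>L\<^sup>(\<^sup>1\<^sup>)(-x\<^sup>-\<^sup>2)\<^sup>L\<^sup>(\<^sup>0\<^sup>)v, x\<^sup>-\<^sup>1)\<close> for an arbitrary family of modes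
  \<open>\<Phi>\<close>, so that both \<open>Yo\<close> and \<open>tauP\<close> are instances.\<close>
definition opp :: "'v::cvec set \<Rightarrow> ('v \<Rightarrow> int \<Rightarrow> 'v \<Rightarrow> 'v) \<Rightarrow> 'v \<Rightarrow> ('v \<Rightarrow> int \<Rightarrow> 'x::cvec) \<Rightarrow> 'v \<Rightarrow> int \<Rightarrow> 'x"
  where "opp V Y \<omega> \<Phi> v m = fsum (\<lambda>h::int. fsum (\<lambda>j::nat. ((-1) powi h / of_nat (fact j)) *\<^sub>C
          \<Phi> (((Y \<omega> 2) ^^ j) (decomp V (Y \<omega> 1) v (of_int h))) (2 * h - m - 2 - int j)))"

lemma Yo_eq_opp: "Yo V Y \<omega> YW v m w = opp V Y \<omega> (\<lambda>v n. YW v n w) v m"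
  unfolding Yo_def opp_def ..

context voa
begin

abbreviation "Opp \<equiv> opp V Y \<omega>"

text \<open>The cutoff J is left free so that two vectors of different weights can be expanded with
  a common bound.\<close>

lemma opp_hom:
  assumes v: "v \<in> hom h" and \<Phi>: "\<And>n. clinear_on V (\<lambda>v. \<Phi> v n)" and J: "\<And>j. j \<ge> J \<Longrightarrow> E j v = 0"
  shows "Opp \<Phi> v m = (\<Sum>j<J. (-1) powi h *\<^sub>C \<Phi> (E j v) (2 * h - m - 2 - int j))"
proof -
  have vV: "v \<in> V" using v hom_V by blast
  have \<Phi>0: "\<Phi> 0 n = 0" for n using clinear_on_0[OF \<Phi> V_sub] .
  have L: "(L1 ^^ j) v = of_nat (fact j) *\<^sub>C E j v" for j by (simp add: E_def)
  have term_eq: "((-1) powi h / of_nat (fact j)) *\<^sub>C \<Phi> ((L1 ^^ j) v) n = (-1) powi h *\<^sub>C \<Phi> (E j v) n"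
    for j n by (simp add: L clinear_on_scale[OF \<Phi>] E_V vV)
  have "Opp \<Phi> v m = fsum (\<lambda>j. ((-1) powi h / of_nat (fact j)) *\<^sub>C \<Phi> ((L1 ^^ j) v) (2 * h - m - 2 - int j))"
    unfolding opp_def
    by (subst fsum_single[of h]) (auto simp: comp_hom[OF v] L1_pow_0 \<Phi>0 intro: fsum_zero)
  also have "\<dots> = (\<Sum>j<J. (-1) powi h *\<^sub>C \<Phi> (E j v) (2 * h - m - 2 - int j))"
    unfolding term_eq by (rule fsum_eq_sum_lessThan) (simp add: J \<Phi>0)
  finally show ?thesis .
qed

text \<open>A homogeneous component of weight h stops at \<open>nat (h - lb + 1)\<close>. The
  resulting index sets depend on v alone and not on \<Phi>, so transforms of different families can
  be compared term by term.\<close>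

lemma opp_finite:
  assumes v: "v \<in> V" and \<Phi>: "\<And>n. clinear_on V (\<lambda>v. \<Phi> v n)"
  shows "Opp \<Phi> v m = (\<Sum>h | comp v h \<noteq> 0. \<Sum>j<nat (h - lb + 1).
    (-1) powi h *\<^sub>C \<Phi> (E j (comp v h)) (2 * h - m - 2 - int j))"
proof -
  have \<Phi>0: "\<Phi> 0 n = 0" for n using clinear_on_0[OF \<Phi> V_sub] .
  have term_eq: "((-1) powi h / of_nat (fact j)) *\<^sub>C \<Phi> ((L1 ^^ j) (comp v h)) n
      = (-1) powi h *\<^sub>C \<Phi> (E j (comp v h)) n" for h j n
  proof -
    have "(L1 ^^ j) (comp v h) = of_nat (fact j) *\<^sub>C E j (comp v h)" by (simp add: E_def)
    moreover have "comp v h \<in> V" using comp_in[OF v] hom_V by blast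
    ultimately show ?thesis by (simp add: clinear_on_scale[OF \<Phi>] E_V)
  qed
  have E0: "E j 0 = 0" for j using clinear_on_0[OF E_lin V_sub] .
  have inner: "fsum (\<lambda>j. (-1) powi h *\<^sub>C \<Phi> (E j (comp v h)) (2 * h - m - 2 - int j))
    = (\<Sum>j<nat (h - lb + 1). (-1) powi h *\<^sub>C \<Phi> (E j (comp v h)) (2 * h - m - 2 - int j))" for h
    by (rule fsum_eq_sum_lessThan) (simp add: E_zero[OF comp_in[OF v]] \<Phi>0)
  show ?thesis unfolding opp_def term_eq inner
    by (rule fsum_eq_sum) (auto simp: comp_finite[OF v] E0 \<Phi>0)
qed

lemma opp_lin:
  assumes \<Phi>: "\<And>n. clinear_on V (\<lambda>v. \<Phi> v n)"
  shows "clinear_on V (\<lambda>v. Opp \<Phi> v m)"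
proof -
  have \<Phi>0: "\<Phi> 0 n = 0" for n using clinear_on_0[OF \<Phi> V_sub] .
  have V2: "comp v h \<in> V" if "v \<in> V" for v h using comp_in[OF that] hom_V by blast
  show ?thesis unfolding opp_def
  proof (intro clinear_on_fsumI)
    fix h j
    let ?f = "\<lambda>x. ((-1) powi h / of_nat (fact j)) *\<^sub>C \<Phi> ((L1 ^^ j) (comp x h)) (2 * h - m - 2 - int j)"
    show "clinear_on V ?f"
      by (rule clinear_onI)
        (simp_all add: clinear_on_add[OF comp_lin] clinear_on_scale[OF comp_lin] V2
          clinear_on_add[OF L1_pow_lin] clinear_on_scale[OF L1_pow_lin] L1_pow_V
          clinear_on_add[OF \<Phi>] clinear_on_scale[OF \<Phi>] cscale_right_distrib mult.commute)
  next
    fix x h assume x: "x \<in> V"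
    show "finite {j. ((-1) powi h / of_nat (fact j)) *\<^sub>C \<Phi> ((L1 ^^ j) (comp x h)) (2 * h - m - 2 - int j) \<noteq> 0}"
    proof (rule finite_subset)
      show "{j. ((-1) powi h / of_nat (fact j)) *\<^sub>C \<Phi> ((L1 ^^ j) (comp x h)) (2 * h - m - 2 - int j) \<noteq> 0}
        \<subseteq> {..<nat (h - lb + 1)}"
        using L1_pow_zero[OF comp_in[OF x], of h] by (auto simp: \<Phi>0 simp flip: not_le)
    qed simp
  next
    fix x assume x: "x \<in> V"
    show "finite {h. fsum (\<lambda>j. ((-1) powi h / of_nat (fact j)) *\<^sub>C
      \<Phi> ((L1 ^^ j) (comp x h)) (2 * h - m - 2 - int j)) \<noteq> 0}"
      by (rule finite_subset[OF _ comp_finite[OF x]]) (auto simp: L1_pow_0 \<Phi>0 fsum_def)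
  qed (use V_sub in \<open>auto intro: csubspace_add csubspace_scale\<close>)
qed

text \<open>On weight h the inner transform sees \<open>E j x\<close> of weight h - j, so the two
  signs multiply to (-1)^j. The total coefficient of \<open>E s x\<close> is the alternating sum of
  binom(s, j) over j, which vanishes unless s = 0: the two exponentials cancel.\<close>

lemma opp_opp:
  assumes \<Phi>: "\<And>n. clinear_on V (\<lambda>v. \<Phi> v n)" and v: "v \<in> V"
  shows "Opp (Opp \<Phi>) v m = \<Phi> v m"
proof (rule lin_eq_hom[OF v opp_lin[OF opp_lin[OF \<Phi>]] \<Phi>])
  fix h x assume x: "x \<in> hom h"
  have xV: "x \<in> V" using x hom_V by blast
  have \<Phi>0: "\<Phi> 0 n = 0" for n using clinear_on_0[OF \<Phi> V_sub] .
  let ?J = "nat (h - lb + 1)"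
  have inner: "Opp \<Phi> (E j x) n
    = (\<Sum>i<?J. ((-1) powi h * (-1) ^ j) *\<^sub>C \<Phi> (E i (E j x)) (2 * (h - int j) - n - 2 - int i))" for j n
  proof -
    have "(-1) powi (h - int j) = ((-1) powi h * (-1) ^ j :: complex)"
      by (simp add: power_int_diff minus_one_power_iff)
    then show ?thesis
      by (subst opp_hom[OF E_hom[OF x] \<Phi>, of ?J]) (auto intro: E_zero[OF E_hom[OF x]])
  qed
  have EE: "E i (E j x) = 0" if "i \<ge> ?J \<or> j \<ge> ?J" for i j
    using that E_zero[OF E_hom[OF x], of j i] E_zero[OF x, of j] clinear_on_0[OF E_lin V_sub, of i] by auto
  have "Opp (Opp \<Phi>) x m = (\<Sum>j<?J. (-1) powi h *\<^sub>C Opp \<Phi> (E j x) (2 * h - m - 2 - int j))"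
    by (rule opp_hom[OF x opp_lin[OF \<Phi>] E_zero[OF x]])
  also have "\<dots> = (\<Sum>j<?J. \<Sum>i<?J. (-1) ^ j *\<^sub>C \<Phi> (E i (E j x)) (m - int (i + j)))"
    unfolding inner cv.scale_sum_right by (intro sum.cong refl) (simp add: diff_diff_eq add.commute)
  also have "\<dots> = (\<Sum>s<2 * ?J. \<Sum>j\<le>s. (-1) ^ j *\<^sub>C \<Phi> (E (s - j) (E j x)) (m - int ((s - j) + j)))"
    by (rule sum_pairs_by_total[of ?J ?J "\<lambda>j i. (-1) ^ j *\<^sub>C \<Phi> (E i (E j x)) (m - int (i + j))"])
      (auto simp: EE \<Phi>0)
  also have "\<dots> = (\<Sum>s<2 * ?J. if s = 0 then \<Phi> x m else 0)"
  proof (intro sum.cong refl)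
    fix s
    have "(\<Sum>j\<le>s. (-1) ^ j *\<^sub>C \<Phi> (E (s - j) (E j x)) (m - int ((s - j) + j)))
      = (\<Sum>j\<le>s. ((-1) ^ j * of_nat (s choose j)) *\<^sub>C \<Phi> (E s x) (m - int s))"
    proof (intro sum.cong refl)
      fix j assume "j \<in> {..s}"
      then have "(s - j) + j = s" "s choose (s - j) = s choose j" by (auto simp: binomial_symmetric[symmetric])
      then show "(-1) ^ j *\<^sub>C \<Phi> (E (s - j) (E j x)) (m - int ((s - j) + j))
        = ((-1) ^ j * of_nat (s choose j)) *\<^sub>C \<Phi> (E s x) (m - int s)"
        by (simp only: E_E[OF xV] clinear_on_scale[OF \<Phi> E_V[OF xV]] cv.scale_scale)
    qed
    also have "\<dots> = (\<Sum>j\<le>s. (-1) ^ j * of_nat (s choose j)) *\<^sub>C \<Phi> (E s x) (m - int s)"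
      by (simp add: cv.scale_sum_left)
    also have "\<dots> = (if s = 0 then \<Phi> x m else 0)"
      using choose_alternating_sum[of s, where ?'a = complex] by auto
    finally show "(\<Sum>j\<le>s. (-1) ^ j *\<^sub>C \<Phi> (E (s - j) (E j x)) (m - int ((s - j) + j)))
      = (if s = 0 then \<Phi> x m else 0)" .
  qed
  also have "\<dots> = \<Phi> x m"
  \<comment> \<open>An empty range of s means that the weight lies below \<open>lb\<close>; then x
    itself is 0.\<close>
  proof (cases "?J = 0")
    case True
    then have "x = 0" using hom_lb[OF _ x] by simp
    then show ?thesis using \<Phi>0 by (simp add: True)
  next
    case False
    then show ?thesis by (subst sum.delta) auto
  qed
  finally show "Opp (Opp \<Phi>) x m = \<Phi> x m" .
qed

end

context weak_mod
begin

abbreviation "YO \<equiv> Yo V Y \<omega> YW"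

lemma YO_lin_v: "w \<in> W \<Longrightarrow> clinear_on V (\<lambda>v. YO v m w)"
  unfolding Yo_eq_opp by (rule opp_lin) (rule YW_lin_v)

lemma YO_hom:
  assumes "v \<in> hom h" "\<And>j. j \<ge> J \<Longrightarrow> E j v = 0" "w \<in> W"
  shows "YO v m w = (\<Sum>j<J. (-1) powi h *\<^sub>C YW (E j v) (2 * h - m - 2 - int j) w)"
  unfolding Yo_eq_opp by (rule opp_hom) (use assms YW_lin_v in auto)

lemma YO_finite:
  assumes "v \<in> V" "w \<in> W"
  shows "YO v m w = (\<Sum>h | comp v h \<noteq> 0. \<Sum>j<nat (h - lb + 1).
    (-1) powi h *\<^sub>C YW (E j (comp v h)) (2 * h - m - 2 - int j) w)"
  unfolding Yo_eq_opp by (rule opp_finite) (use assms YW_lin_v in auto)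

lemma E_comp_V: "v \<in> V \<Longrightarrow> E j (comp v h) \<in> V"
  using comp_in hom_V E_V by blast

lemma YO_in: "v \<in> V \<Longrightarrow> w \<in> W \<Longrightarrow> YO v m w \<in> W"
  by (simp add: YO_finite csubspace_sum[OF W_sub] csubspace_scale[OF W_sub] YW_in E_comp_V)

lemma YO_lin: assumes "v \<in> V" shows "clinear_on W (YO v m)"
proof -
  have "clinear_on W (\<lambda>w. \<Sum>h | comp v h \<noteq> 0. \<Sum>j<nat (h - lb + 1).
    (-1) powi h *\<^sub>C YW (E j (comp v h)) (2 * h - m - 2 - int j) w)"
    by (intro clinear_on_sumI clinear_on_scaleI YW_lin E_comp_V assms)
  then show ?thesis using assms W_sub
    by (simp add: clinear_on_def YO_finite csubspace_add csubspace_scale)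
qed

end

section \<open>The opposite Jacobi identity\<close>

context weak_mod
begin

text \<open>The exponent is the weight of u_(l + i) v, which fixes the sign in its opposite modes.
  Negating an exponent does not change a power of -1.\<close>

lemma powi_weight_sign:
  "(-1) powi (h + h' - l - int i - 1)
    = (- ((-1) powi h * (-1) powi h') * (-1) powi l * (-1) ^ i :: complex)"
proof -
  have inv: "inverse ((-1) powi k) = ((-1) powi k :: complex)" for k
    by (rule inverse_unique) simp
  have add: "(-1) powi (a + b) = ((-1) powi a * (-1) powi b :: complex)" for a b
    by (simp add: power_int_add)
  have "(-1) powi (h + h' - l - int i - 1)
      = ((-1) powi (h + h' + - l + - int i + - 1) :: complex)"
    by simp
  also have "\<dots> = (-1) powi h * (-1) powi h' * (-1) powi l * (-1) powi (int i) * (-1) powi 1"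
    by (simp only: add power_int_minus inv)
  finally show ?thesis by simp
qed

text \<open>The factors are in the order that arises from composing transposes. In both products the
  mode applied first to w has index tending to minus infinity with i; under the transform this is an
  ordinary mode of large index, so these terms are eventually zero.\<close>

lemma opposite_borcherds_hom:
  assumes u: "u \<in> hom h" and v: "v \<in> hom h'" and w: "w \<in> W"
  shows "\<forall>\<^sub>F N in sequentially.
    (\<Sum>i<N. gbin m i *\<^sub>C YO (Y u (l + int i) v) (m + n - int i) w)
      = (\<Sum>i<N. ((-1) ^ i * gbin l i) *\<^sub>C
           (YO v (n + int i) (YO u (m + l - int i) w)
            - ((-1) powi l) *\<^sub>C YO u (m + int i) (YO v (n + l - int i) w)))"
proof -
  interpret self: weak_mod V Y vac \<omega> V Y by (rule self)
  have uV: "u \<in> V" and vV: "v \<in> V" using u v hom_V by auto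
  define J where "J = max (nat (h - lb + 1)) (nat (h' - lb + 1))"
  define J' where "J' = nat (h + h' - l - lb + 1)"
  \<comment> \<open>M and N' are chosen so that the opposite modes in the claim become modes of
    \<open>E a u\<close> and \<open>E c v\<close> with base indices M - a and N' - c. The index M -
    a is also the upper binomial index delivered by \<open>E_iterate\<close>.\<close>
  define M where "M = 2 * h - m - l - 2"
  define N' where "N' = 2 * h' - n - l - 2"
  define \<epsilon> :: complex where "\<epsilon> = (-1) powi h * (-1) powi h'"
  \<comment> \<open>The part of the sign of u_(l + i) v that does not depend on i; the remaining
    (-1)^i joins \<open>gbin m i\<close>.\<close>
  define \<kappa> :: complex where "\<kappa> = - \<epsilon> * (-1) powi l"
  have Ju: "E j u = 0" and Jv: "E j v = 0" if "j \<ge> J" for j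
    using that E_zero[OF u, of j] E_zero[OF v, of j] unfolding J_def by auto
  have uv_hom: "Y u (l + int i) v \<in> hom (h + h' - l - int i - 1)" for i
    using mode_hom[OF u v, of "l + int i"] by (simp add: algebra_simps)
  have J': "E j (Y u (l + int i) v) = 0" if "j \<ge> J'" for i j
    by (rule E_zero[OF uv_hom]) (use that in \<open>auto simp: J'_def\<close>)
  have EuV: "E j u \<in> V" and EvV: "E j v \<in> V" for j using E_V uV vV by auto
  let ?B = "\<lambda>a c N. \<Sum>i<N. ((-1) ^ i * gbin l i) *\<^sub>C
           (YW (E a u) (M - int a + l - int i) (YW (E c v) (N' - int c + int i) w)
            - ((-1) powi l) *\<^sub>C YW (E c v) (N' - int c + l - int i) (YW (E a u) (M - int a + int i) w))"
  let ?Z = "\<lambda>a b c. gbin (M - int a) b *\<^sub>C Y (E a u) (l + int b) (E c v)"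
  \<comment> \<open>Only finitely many pairs (a, c) occur, so one N serves all the ordinary Jacobi
    identities used.\<close>
  have B_ev: "\<forall>\<^sub>F N in sequentially. \<forall>(a, c)\<in>{..<J} \<times> {..<J}.
      ?B a c N = (\<Sum>b<N. gbin (M - int a) b *\<^sub>C YW (Y (E a u) (l + int b) (E c v)) (M - int a + (N' - int c) - int b) w)"
  proof (intro eventually_ball_finite ballI; clarsimp?)
    fix a c :: nat
    show "\<forall>\<^sub>F N in sequentially. ?B a c N = (\<Sum>b<N. gbin (M - int a) b *\<^sub>C YW (Y (E a u) (l + int b) (E c v)) (M - int a + (N' - int c) - int b) w)"
      using borch_ev[OF EuV EvV w, where m = "M - int a" and l = l and n = "N' - int c"]
      by (rule eventually_mono) (rule sym)
  qed
  have trunc_ev: "\<forall>\<^sub>F N in sequentially. \<forall>(a, c)\<in>{..<J} \<times> {..<J}. \<forall>b\<ge>N. Y (E a u) (l + int b) (E c v) = 0"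
  proof (intro eventually_ball_finite ballI; clarsimp?)
    fix a c :: nat
    show "\<forall>\<^sub>F N in sequentially. \<forall>b\<ge>N. Y (E a u) (l + int b) (E c v) = 0"
      using self.trunc_ev[OF EuV[of a] EvV[of c], where n = l] unfolding eventually_sequentially by (meson order_trans)
  qed
  have trunc_uv: "\<forall>\<^sub>F N in sequentially. \<forall>i\<ge>N. Y u (l + int i) v = 0"
    using self.trunc_ev[OF uV vV, where n = l] unfolding eventually_sequentially by (meson order_trans)
  show ?thesis using B_ev trunc_ev trunc_uv
  proof eventually_elim
    case (elim N)
    have E00: "E j 0 = 0" for j using clinear_on_0[OF E_lin V_sub] .
    have Z0: "?Z a b c = 0" if "a \<ge> J \<or> b \<ge> N \<or> c \<ge> J" for a b c
    proof (cases "a \<ge> J \<or> c \<ge> J")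
      case True
      then show ?thesis using Ju Jv self.YW_0_left self.YW_0_right EuV EvV by auto
    next
      case False
      then show ?thesis using elim(2) that by auto
    qed
    \<comment> \<open>Large enough for both regroupings, by pairs in a box N by J' and by triples in
      a box J by N by J.\<close>
    define S where "S = J + N + J + J'"
    have "(\<Sum>i<N. gbin m i *\<^sub>C YO (Y u (l + int i) v) (m + n - int i) w)
      = (\<Sum>i<N. \<Sum>j<J'. \<kappa> *\<^sub>C YW (((-1) ^ i * gbin m i) *\<^sub>C E j (Y u (l + int i) v)) (M + N' - int (i + j)) w)"
    proof (intro sum.cong refl)
      fix i
      have idx: "2 * (h + h' - l - int i - 1) - (m + n - int i) - 2 - int j = M + N' - int (i + j)" for j
        by (simp add: M_def N'_def)
      have sgn: "(-1) powi (h + h' - l - int i - 1) = \<kappa> * (-1) ^ i"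
        unfolding \<kappa>_def \<epsilon>_def by (rule powi_weight_sign)
      have "YO (Y u (l + int i) v) (m + n - int i) w
        = (\<Sum>j<J'. (\<kappa> * (-1) ^ i) *\<^sub>C YW (E j (Y u (l + int i) v)) (M + N' - int (i + j)) w)"
        unfolding idx[symmetric] sgn[symmetric] by (rule YO_hom[OF uv_hom J' w])
      then show "gbin m i *\<^sub>C YO (Y u (l + int i) v) (m + n - int i) w
        = (\<Sum>j<J'. \<kappa> *\<^sub>C YW (((-1) ^ i * gbin m i) *\<^sub>C E j (Y u (l + int i) v)) (M + N' - int (i + j)) w)"
        by (simp add: cv.scale_sum_right clinear_on_scale[OF YW_lin_v[OF w]] E_V self.YW_in uV vV ac_simps)
    qed
    also have "\<dots> = \<kappa> *\<^sub>C (\<Sum>i<N. \<Sum>j<J'. YW (((-1) ^ i * gbin m i) *\<^sub>C E j (Y u (l + int i) v)) (M + N' - int (i + j)) w)"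
      by (simp only: cv.scale_sum_right)
    also have "(\<Sum>i<N. \<Sum>j<J'. YW (((-1) ^ i * gbin m i) *\<^sub>C E j (Y u (l + int i) v)) (M + N' - int (i + j)) w)
      = (\<Sum>s<S. \<Sum>i\<le>s. YW (((-1) ^ i * gbin m i) *\<^sub>C E (s - i) (Y u (l + int i) v)) (M + N' - int (i + (s - i))) w)"
    proof (rule sum_pairs_by_total)
      fix i j assume "N \<le> i \<or> J' \<le> j"
      then have "E j (Y u (l + int i) v) = 0" using elim(3) J' E00 by auto
      then show "YW (((-1) ^ i * gbin m i) *\<^sub>C E j (Y u (l + int i) v)) (M + N' - int (i + j)) w = 0"
        by (simp add: YW_0_left w)
    qed (simp add: S_def)
    also have "\<dots> = (\<Sum>s<S. YW (\<Sum>i\<le>s. ((-1) ^ i * gbin m i) *\<^sub>C E (s - i) (Y u (l + int i) v)) (M + N' - int s) w)"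
    proof (intro sum.cong refl)
      fix s
      have "(\<Sum>i\<le>s. YW (((-1) ^ i * gbin m i) *\<^sub>C E (s - i) (Y u (l + int i) v)) (M + N' - int (i + (s - i))) w)
        = (\<Sum>i\<le>s. YW (((-1) ^ i * gbin m i) *\<^sub>C E (s - i) (Y u (l + int i) v)) (M + N' - int s) w)"
        by (intro sum.cong refl) simp
      also have "\<dots> = YW (\<Sum>i\<le>s. ((-1) ^ i * gbin m i) *\<^sub>C E (s - i) (Y u (l + int i) v)) (M + N' - int s) w"
        by (rule clinear_on_sum[OF YW_lin_v[OF w] V_sub, symmetric])
          (intro csubspace_scale V_sub E_V self.YW_in uV vV)
      finally show "(\<Sum>i\<le>s. YW (((-1) ^ i * gbin m i) *\<^sub>C E (s - i) (Y u (l + int i) v)) (M + N' - int (i + (s - i))) w)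
        = YW (\<Sum>i\<le>s. ((-1) ^ i * gbin m i) *\<^sub>C E (s - i) (Y u (l + int i) v)) (M + N' - int s) w" .
    qed
    also have "\<dots> = (\<Sum>s<S. YW (\<Sum>(a, b, c)\<in>triples s. ?Z a b c) (M + N' - int s) w)"
      unfolding E_iterate[OF u vV] M_def ..
    also have "\<dots> = (\<Sum>s<S. \<Sum>(a, b, c)\<in>triples s. YW (?Z a b c) (M + N' - int (a + b + c)) w)"
    proof (intro sum.cong refl)
      fix s
      have "YW (\<Sum>(a, b, c)\<in>triples s. ?Z a b c) (M + N' - int s) w
        = (\<Sum>x\<in>triples s. YW (case x of (a, b, c) \<Rightarrow> ?Z a b c) (M + N' - int s) w)"
        by (rule clinear_on_sum[OF YW_lin_v[OF w] V_sub])
          (auto intro!: csubspace_scale V_sub self.YW_in EuV EvV)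
      also have "\<dots> = (\<Sum>(a, b, c)\<in>triples s. YW (?Z a b c) (M + N' - int (a + b + c)) w)"
        by (intro sum.cong refl) (auto simp: triples_def)
      finally show "YW (\<Sum>(a, b, c)\<in>triples s. ?Z a b c) (M + N' - int s) w
        = (\<Sum>(a, b, c)\<in>triples s. YW (?Z a b c) (M + N' - int (a + b + c)) w)" .
    qed
    also have "\<dots> = (\<Sum>a<J. \<Sum>c<J. \<Sum>b<N. YW (?Z a b c) (M + N' - int (a + b + c)) w)"
    proof (rule sym, rule sum_triples_by_total[of J N J])
      fix a b c assume "J \<le> a \<or> N \<le> b \<or> J \<le> c"
      from Z0[OF this] show "YW (?Z a b c) (M + N' - int (a + b + c)) w = 0"
        by (simp only: YW_0_left w)
    qed (simp add: S_def)
    also have "\<dots> = (\<Sum>a<J. \<Sum>c<J. ?B a c N)"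
    proof (rule sum.cong[OF refl], rule sum.cong[OF refl])
      fix a c assume ac: "a \<in> {..<J}" "c \<in> {..<J}"
      have idx: "M - int a + (N' - int c) - int b = M + N' - int (a + b + c)" for b by simp
      have "?B a c N = (\<Sum>b<N. gbin (M - int a) b *\<^sub>C YW (Y (E a u) (l + int b) (E c v)) (M + N' - int (a + b + c)) w)"
        unfolding idx[symmetric] using bspec[OF elim(1), of "(a, c)"] ac
        by (simp only: case_prod_conv mem_Times_iff fst_conv snd_conv simp_thms)
      also have "\<dots> = (\<Sum>b<N. YW (?Z a b c) (M + N' - int (a + b + c)) w)"
        by (simp only: clinear_on_scale[OF YW_lin_v[OF w]] self.YW_in EuV EvV)
      finally show "(\<Sum>b<N. YW (?Z a b c) (M + N' - int (a + b + c)) w) = ?B a c N" ..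
    qed
    also have "\<kappa> *\<^sub>C \<dots> = (\<Sum>i<N. ((-1) ^ i * gbin l i) *\<^sub>C
           (\<Sum>a<J. \<Sum>c<J. \<epsilon> *\<^sub>C (YW (E c v) (N' - int c + l - int i) (YW (E a u) (M - int a + int i) w)
            - ((-1) powi l) *\<^sub>C YW (E a u) (M - int a + l - int i) (YW (E c v) (N' - int c + int i) w))))"
    proof -
      \<comment> \<open>The sign (-1)^l squares to 1, so multiplication by \<kappa> exchanges the
        two products. This is where the order of the operators is reversed.\<close>
      have flip: "\<kappa> *\<^sub>C (x - (-1) powi l *\<^sub>C y) = \<epsilon> *\<^sub>C (y - (-1) powi l *\<^sub>C x)" for x y :: 'w
        by (simp add: \<kappa>_def cv.scale_right_diff_distrib mult.assoc)
      have "\<kappa> *\<^sub>C (\<Sum>a<J. \<Sum>c<J. ?B a c N)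
        = (\<Sum>a<J. \<Sum>c<J. \<Sum>i<N. ((-1) ^ i * gbin l i) *\<^sub>C
           (\<epsilon> *\<^sub>C (YW (E c v) (N' - int c + l - int i) (YW (E a u) (M - int a + int i) w)
            - ((-1) powi l) *\<^sub>C YW (E a u) (M - int a + l - int i) (YW (E c v) (N' - int c + int i) w))))"
        by (simp only: cv.scale_sum_right cv.scale_left_commute[of \<kappa>] flip)
      also have "\<dots> = (\<Sum>a<J. \<Sum>i<N. \<Sum>c<J. ((-1) ^ i * gbin l i) *\<^sub>C
           (\<epsilon> *\<^sub>C (YW (E c v) (N' - int c + l - int i) (YW (E a u) (M - int a + int i) w)
            - ((-1) powi l) *\<^sub>C YW (E a u) (M - int a + l - int i) (YW (E c v) (N' - int c + int i) w))))"
        by (rule sum.cong[OF refl], rule sum.swap)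
      also have "\<dots> = (\<Sum>i<N. \<Sum>a<J. \<Sum>c<J. ((-1) ^ i * gbin l i) *\<^sub>C
           (\<epsilon> *\<^sub>C (YW (E c v) (N' - int c + l - int i) (YW (E a u) (M - int a + int i) w)
            - ((-1) powi l) *\<^sub>C YW (E a u) (M - int a + l - int i) (YW (E c v) (N' - int c + int i) w))))"
        by (rule sum.swap)
      finally show ?thesis by (simp only: cv.scale_sum_right)
    qed
    also have "\<dots> = (\<Sum>i<N. ((-1) ^ i * gbin l i) *\<^sub>C
           (YO v (n + int i) (YO u (m + l - int i) w)
            - ((-1) powi l) *\<^sub>C YO u (m + int i) (YO v (n + l - int i) w)))"
    proof (intro sum.cong refl arg_cong2[where f = cscale])
      fix i
      have vu: "YO v q (YO u p w) = (\<Sum>a<J. \<Sum>c<J. \<epsilon> *\<^sub>C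
          YW (E c v) (2 * h' - q - 2 - int c) (YW (E a u) (2 * h - p - 2 - int a) w))" for p q
      proof -
        have inner: "YO u p w = (\<Sum>a<J. (-1) powi h *\<^sub>C YW (E a u) (2 * h - p - 2 - int a) w)"
          by (rule YO_hom[OF u Ju w])
        have "YO v q (YO u p w) = (\<Sum>c<J. (-1) powi h' *\<^sub>C YW (E c v) (2 * h' - q - 2 - int c) (YO u p w))"
          by (rule YO_hom[OF v Jv YO_in[OF uV w]])
        also have "\<dots> = (\<Sum>c<J. \<Sum>a<J. \<epsilon> *\<^sub>C
          YW (E c v) (2 * h' - q - 2 - int c) (YW (E a u) (2 * h - p - 2 - int a) w))"
          unfolding inner
          by (simp add: clinear_on_sum[OF YW_lin[OF EvV] W_sub] csubspace_scale W_sub YW_in EuV w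
              clinear_on_scale[OF YW_lin[OF EvV]] cv.scale_sum_right \<epsilon>_def mult.commute)
        finally show ?thesis by (subst sum.swap)
      qed
      have uv: "YO u p (YO v q w) = (\<Sum>a<J. \<Sum>c<J. \<epsilon> *\<^sub>C
          YW (E a u) (2 * h - p - 2 - int a) (YW (E c v) (2 * h' - q - 2 - int c) w))" for p q
      proof -
        have inner: "YO v q w = (\<Sum>c<J. (-1) powi h' *\<^sub>C YW (E c v) (2 * h' - q - 2 - int c) w)"
          by (rule YO_hom[OF v Jv w])
        have "YO u p (YO v q w) = (\<Sum>a<J. (-1) powi h *\<^sub>C YW (E a u) (2 * h - p - 2 - int a) (YO v q w))"
          by (rule YO_hom[OF u Ju YO_in[OF vV w]])
        also have "\<dots> = (\<Sum>a<J. \<Sum>c<J. \<epsilon> *\<^sub>C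
          YW (E a u) (2 * h - p - 2 - int a) (YW (E c v) (2 * h' - q - 2 - int c) w))"
          unfolding inner
          by (simp add: clinear_on_sum[OF YW_lin[OF EuV] W_sub] csubspace_scale W_sub YW_in EvV w
              clinear_on_scale[OF YW_lin[OF EuV]] cv.scale_sum_right \<epsilon>_def)
        finally show ?thesis .
      qed
      have idx: "2 * h' - (n + int i) - 2 - int c = N' - int c + l - int i"
        "2 * h - (m + l - int i) - 2 - int a = M - int a + int i"
        "2 * h - (m + int i) - 2 - int a = M - int a + l - int i"
        "2 * h' - (n + l - int i) - 2 - int c = N' - int c + int i" for a c
        by (simp_all add: M_def N'_def)
      show "(\<Sum>a<J. \<Sum>c<J. \<epsilon> *\<^sub>C (YW (E c v) (N' - int c + l - int i) (YW (E a u) (M - int a + int i) w)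
            - ((-1) powi l) *\<^sub>C YW (E a u) (M - int a + l - int i) (YW (E c v) (N' - int c + int i) w)))
        = YO v (n + int i) (YO u (m + l - int i) w)
            - ((-1) powi l) *\<^sub>C YO u (m + int i) (YO v (n + l - int i) w)"
        unfolding vu uv idx
        by (simp only: cv.scale_right_diff_distrib sum_subtractf cv.scale_sum_right
            cv.scale_left_commute[of \<epsilon>])
    qed
    finally show ?case .
  qed
qed

text \<open>Both sides are bilinear in u and v, and eventual equality of partial sums survives
  addition because the two bounds can be taken jointly. Hence homogeneous components suffice, in v
  and then in u.\<close>

lemma opposite_borcherds:
  assumes u: "u \<in> V" and v: "v \<in> V" and w: "w \<in> W"
  shows "\<forall>\<^sub>F N in sequentially.
    (\<Sum>i<N. gbin m i *\<^sub>C YO (Y u (l + int i) v) (m + n - int i) w)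
      = (\<Sum>i<N. ((-1) ^ i * gbin l i) *\<^sub>C
           (YO v (n + int i) (YO u (m + l - int i) w)
            - ((-1) powi l) *\<^sub>C YO u (m + int i) (YO v (n + l - int i) w)))"
  (is "\<forall>\<^sub>F N in _. (\<Sum>i<N. ?L u v i) = (\<Sum>i<N. ?R u v i)")
proof -
  interpret self: weak_mod V Y vac \<omega> V Y by (rule self)
  have YO0: "YO 0 p x = 0" if "x \<in> W" for p x using clinear_on_0[OF YO_lin_v[OF that] V_sub] .
  have YO0': "YO x p 0 = 0" if "x \<in> V" for p x using clinear_on_0[OF YO_lin[OF that] W_sub] .
  have sum_add: "(\<Sum>i<N. F i) = (\<Sum>i<N. G i)"
    if "(\<Sum>i<N. F1 i) = (\<Sum>i<N. G1 i)" "(\<Sum>i<N. F2 i) = (\<Sum>i<N. G2 i)"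
      "\<And>i. F i = F1 i + F2 i" "\<And>i. G i = G1 i + G2 i" for F G F1 F2 G1 G2 :: "nat \<Rightarrow> 'w" and N
    using that by (simp add: sum.distrib)
  have bilinear: "c *\<^sub>C (a + b - d *\<^sub>C (p + q)) = c *\<^sub>C (a - d *\<^sub>C p) + c *\<^sub>C (b - d *\<^sub>C q)"
    for c d and a b p q :: 'w
    by (simp add: cv.scale_right_distrib cv.scale_right_diff_distrib)
  have hom_left: "\<forall>\<^sub>F N in sequentially. (\<Sum>i<N. ?L u v i) = (\<Sum>i<N. ?R u v i)" if u: "u \<in> hom h" for u h
    using v
  proof (induction rule: hom_induct)
    case zero
    have "u \<in> V" using u hom_V by blast
    then show ?case by (simp add: YO0 YO0' w YO_in self.YW_0_right)
  next
    case (add x y)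
    have uV: "u \<in> V" using u hom_V by blast
    have L: "?L u (x + y) i = ?L u x i + ?L u y i" for i
      using add(1,2) uV w
      by (simp add: clinear_on_add[OF self.YW_lin] clinear_on_add[OF YO_lin_v] self.YW_in
          cv.scale_right_distrib)
    have R: "?R u (x + y) i = ?R u x i + ?R u y i" for i
      using add(1,2) uV w
      by (simp only: clinear_on_add[OF YO_lin_v] clinear_on_add[OF YO_lin] YO_in bilinear)
    from add(3,4) show ?case
      by eventually_elim (rule sum_add[OF _ _ L R])
  next
    case (hom h' x)
    then show ?case using opposite_borcherds_hom u w by blast
  qed
  show ?thesis using u
  proof (induction rule: hom_induct)
    case zero
    then show ?case by (simp add: YO0 YO0' w YO_in self.YW_0_left v)
  next
    case (add x y)
    have L: "?L (x + y) v i = ?L x v i + ?L y v i" for i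
      using add(1,2) v w
      by (simp add: clinear_on_add[OF self.YW_lin_v] clinear_on_add[OF YO_lin_v] self.YW_in
          cv.scale_right_distrib)
    have R: "?R (x + y) v i = ?R x v i + ?R y v i" for i
      using add(1,2) v w
      by (simp only: clinear_on_add[OF YO_lin_v] clinear_on_add[OF YO_lin] YO_in bilinear)
    from add(3,4) show ?case
      by eventually_elim (rule sum_add[OF _ _ L R])
  next
    case (hom h x)
    then show ?case by (rule hom_left)
  qed
qed

end

section \<open>The contragredient module\<close>

context graded_space
begin

text \<open>The dual of \<open>Spow_inj\<close>. If \<alpha> kills the image of T - n on the
  p-space, then \<alpha>((T - p)x) = (n - p)\<alpha>(x) there, and local nilpotency of T - p forces
  \<alpha> = 0 on it. Induction on k replaces \<alpha> by its composition with T - n.\<close>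

lemma functional_vanishes:
  assumes "clinear_on W \<alpha>" "\<And>x. x \<in> G p \<Longrightarrow> \<alpha> ((S n ^^ k) x) = (0::complex)" "n \<noteq> p" "w \<in> G p"
  shows "\<alpha> w = 0"
  using assms(1,2,4)
proof (induction k arbitrary: \<alpha> w)
  case (Suc k)
  have lin: "clinear_on W (\<lambda>x. \<alpha> (S n x))"
    using Suc.prems(1) S_lin[of n] S_in[where n = n] unfolding clinear_on_def by simp
  have \<alpha>S: "\<alpha> (S n x) = 0" if "x \<in> G p" for x
    using Suc.IH[OF lin _ that] Suc.prems(2) by simp
  have \<alpha>Sp: "\<alpha> (S p x) = (n - p) * \<alpha> x" if "x \<in> G p" for x
    using \<alpha>S[OF that] G_W[OF that]
    by (simp add: clinear_on_diff[OF Suc.prems(1) sub] clinear_on_scale[OF Suc.prems(1)] T_in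
        csubspace_scale[OF sub] algebra_simps)
  have pow: "\<alpha> ((S p ^^ j) w) = (n - p) ^ j * \<alpha> w" for j
  proof (induction j)
    case (Suc j)
    then show ?case using \<alpha>Sp[OF Spow_G[OF \<open>w \<in> G p\<close>, where m = p and k = j]] by simp
  qed simp
  obtain j where "(S p ^^ j) w = 0" using Suc.prems(3) unfolding gen_eigensp_def by blast
  then show ?case using pow[of j] assms(3) clinear_on_0[OF Suc.prems(1) sub] by simp
qed simp

text \<open>A functional on the whole eigenspace needs one exponent valid for all vectors; the
  maximum over a finite spanning set provides it.\<close>

lemma G_nilpotent:
  assumes "fin_dim (G n)"
  obtains k where "\<And>w. w \<in> G n \<Longrightarrow> (S n ^^ k) w = 0"
proof -
  obtain B where B: "finite B" "B \<subseteq> G n" "G n \<subseteq> cspan B" using assms unfolding fin_dim_def by blast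
  have "\<exists>k. \<forall>b\<in>B. (S n ^^ k) b = 0" using B(1,2)
  proof (induction B)
    case (insert b B)
    then obtain k where k: "\<forall>b\<in>B. (S n ^^ k) b = 0" by blast
    obtain l where l: "(S n ^^ l) b = 0" using insert.prems unfolding gen_eigensp_def by blast
    have "(S n ^^ max k l) x = 0" if "x \<in> insert b B" for x
      using that k l Spow_zero_mono[where n = n and k = k and l = "max k l" and w = x]
        Spow_zero_mono[where n = n and k = l and l = "max k l" and w = b] by auto
    then show ?case by blast
  qed simp
  then obtain k where k: "\<And>b. b \<in> B \<Longrightarrow> (S n ^^ k) b = 0" by blast
  have "(S n ^^ k) w = 0" if "w \<in> G n" for w
  proof -
    obtain T' c where T': "finite T'" "T' \<subseteq> B" "w = (\<Sum>t\<in>T'. c t *\<^sub>C t)"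
      using \<open>w \<in> G n\<close> B(3) unfolding cspan_def by blast
    have W: "t \<in> W" if "t \<in> T'" for t using that T'(2) B(2) G_W by blast
    have "(S n ^^ k) w = (\<Sum>t\<in>T'. (S n ^^ k) (c t *\<^sub>C t))"
      unfolding T'(3) using W by (intro clinear_on_sum[OF Spow_lin sub] csubspace_scale[OF sub])
    also have "\<dots> = 0"
      using W k T'(2) by (intro sum.neutral) (auto simp: clinear_on_scale[OF Spow_lin])
    finally show ?thesis .
  qed
  then show thesis by (rule that)
qed

end

text \<open>The flag \<open>ordinary\<close> stays a parameter, so the ordinary and the generalized
  version of every result share one proof.\<close>

locale gen_mod = weak_mod V Y vac \<omega> W YW
  for V :: "'v::cvec set" and Y :: "'v \<Rightarrow> int \<Rightarrow> 'v \<Rightarrow> 'v" and vac \<omega> :: 'v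
    and W :: "'w::cvec set" and YW :: "'v \<Rightarrow> int \<Rightarrow> 'w \<Rightarrow> 'w" +
  fixes ordinary :: bool
  assumes gen: "gen_module ordinary V Y vac \<omega> W YW"
begin

lemma G_fin_dim: "fin_dim (gen_eigensp W (YW \<omega> 1) n)"
  using gen unfolding gen_module_def by (elim conjE) (erule spec)

lemma G_low: "\<exists>K::int. \<forall>k<K. gen_eigensp W (YW \<omega> 1) (n + of_int k) = {0}"
  using gen unfolding gen_module_def by (elim conjE) (erule spec)

lemma G_ordinary: "ordinary \<Longrightarrow> gen_eigensp W (YW \<omega> 1) n = eigensp W (YW \<omega> 1) n"
  using gen unfolding gen_module_def by (elim conjE) (drule (1) mp, erule spec)

sublocale graded_space W "YW \<omega> 1"
proof
  fix w assume "w \<in> W"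
  then show "\<exists>f. finite {n. f n \<noteq> 0} \<and> (\<forall>n. f n \<in> gen_eigensp W (YW \<omega> 1) n) \<and> w = fsum f"
    using gen unfolding gen_module_def by (elim conjE) (drule (1) bspec)
qed (use W_sub om_V YW_in YW_lin in auto)

abbreviation "W' \<equiv> contragredient W YW \<omega>"
abbreviation "Y' \<equiv> Yprime V Y \<omega> W YW"
abbreviation "G' \<equiv> gen_eigensp W' (Y' \<omega> 1)"
abbreviation "supp \<alpha> \<equiv> {n. \<exists>w\<in>G n. \<alpha> w \<noteq> (0::complex)}"

lemma dual_iff:
  "\<alpha> \<in> W' \<longleftrightarrow> clinear_on W \<alpha> \<and> (\<forall>w. w \<notin> W \<longrightarrow> \<alpha> w = 0) \<and> finite (supp \<alpha>)"
  by (simp add: contragredient_def)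

lemma dual_lin: "\<alpha> \<in> W' \<Longrightarrow> clinear_on W \<alpha>"
  and dual_outside: "\<alpha> \<in> W' \<Longrightarrow> w \<notin> W \<Longrightarrow> \<alpha> w = 0"
  and dual_supp: "\<alpha> \<in> W' \<Longrightarrow> finite (supp \<alpha>)"
  by (simp_all add: dual_iff)

lemma dual_sub: "csubspace W'"
  unfolding csubspace_def
proof (intro conjI ballI allI)
  show "0 \<in> W'" by (simp add: dual_iff clinear_on_def)
next
  fix \<alpha> \<beta> assume ab: "\<alpha> \<in> W'" "\<beta> \<in> W'"
  have "supp (\<alpha> + \<beta>) \<subseteq> supp \<alpha> \<union> supp \<beta>" by auto
  then have "finite (supp (\<alpha> + \<beta>))" using ab dual_supp by (meson finite_UnI finite_subset)
  moreover have "clinear_on W (\<alpha> + \<beta>)"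
    using dual_lin[OF ab(1)] dual_lin[OF ab(2)] unfolding clinear_on_def by (simp add: algebra_simps)
  ultimately show "\<alpha> + \<beta> \<in> W'"
    using dual_outside[OF ab(1)] dual_outside[OF ab(2)] unfolding dual_iff by simp
next
  fix c \<alpha> assume a: "\<alpha> \<in> W'"
  have "supp (c *\<^sub>C \<alpha>) \<subseteq> supp \<alpha>" by auto
  then have "finite (supp (c *\<^sub>C \<alpha>))" using a dual_supp by (meson finite_subset)
  moreover have "clinear_on W (c *\<^sub>C \<alpha>)"
    using dual_lin[OF a] unfolding clinear_on_def by (simp add: algebra_simps)
  ultimately show "c *\<^sub>C \<alpha> \<in> W'" using dual_outside[OF a] unfolding dual_iff by simp
qed

lemma lin_eq_G:
  assumes "clinear_on W f" "clinear_on W g" "\<And>p w. w \<in> G p \<Longrightarrow> f w = g w" "w \<in> W"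
  shows "f w = g w"
proof -
  have "f (\<pi> n w) = g (\<pi> n w)" for n using assms(3) \<pi>_in[OF assms(4)] .
  then show ?thesis using assms(1,2)[THEN lin_\<pi>, OF assms(4)] by simp
qed

lemma dual_eqI:
  assumes "\<alpha> \<in> W'" "\<beta> \<in> W'" "\<And>p w. w \<in> G p \<Longrightarrow> \<alpha> w = \<beta> w"
  shows "\<alpha> = \<beta>"
proof
  fix w show "\<alpha> w = \<beta> w"
  proof (cases "w \<in> W")
    case True
    show ?thesis by (rule lin_eq_G[OF assms(1,2)[THEN dual_lin] assms(3) True])
  qed (simp add: dual_outside assms)
qed

lemma Y'_apply: "Y' v m \<alpha> w = (if w \<in> W then \<alpha> (YO v m w) else 0)"
  by (simp add: Yprime_def)

lemma Y'_add: "\<lbrakk>\<alpha> \<in> W'; x \<in> V; y \<in> V\<rbrakk> \<Longrightarrow> Y' (x + y) m \<alpha> = Y' x m \<alpha> + Y' y m \<alpha>"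
  by (auto simp: fun_eq_iff Y'_apply clinear_on_add[OF YO_lin_v] clinear_on_add[OF dual_lin] YO_in)

lemma Y'_scale: "\<lbrakk>\<alpha> \<in> W'; x \<in> V\<rbrakk> \<Longrightarrow> Y' (c *\<^sub>C x) m \<alpha> = c *\<^sub>C Y' x m \<alpha>"
  by (auto simp: fun_eq_iff Y'_apply clinear_on_scale[OF YO_lin_v] clinear_on_scale[OF dual_lin] YO_in)

lemma Y'_0: "\<alpha> \<in> W' \<Longrightarrow> Y' 0 m \<alpha> = 0"
  using Y'_scale[of \<alpha> 0 0 m] V_sub by (simp add: csubspace_0)

lemma Y'_lin: "clinear_on W' (Y' v m)"
  unfolding clinear_on_def by (auto simp: fun_eq_iff Y'_apply)

lemma Y'_0_right: "Y' v m 0 = 0"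
  by (auto simp: fun_eq_iff Y'_apply)

text \<open>\<open>E j v\<close> loses weight j and its mode index also drops by j, so all terms of
  an opposite mode shift L(0)-weights equally, and oppositely to v_m.\<close>

lemma YO_weight:
  assumes v: "v \<in> hom h" and w: "w \<in> G p"
  shows "YO v m w \<in> G (p + of_int (m + 1 - h))"
proof -
  have "YW (E j v) (2 * h - m - 2 - int j) w \<in> G (p + of_int (m + 1 - h))" for j
    using mode_weight[OF E_hom[OF v] w, of j "2 * h - m - 2 - int j"] by (simp add: algebra_simps)
  then show ?thesis
    by (simp add: YO_hom[OF v E_zero[OF v] G_W[OF w]] csubspace_sum[OF G_sub] csubspace_scale[OF G_sub])
qed

lemma Y'_in:
  assumes "v \<in> V" "\<alpha> \<in> W'" shows "Y' v m \<alpha> \<in> W'"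
  using assms(1)
proof (induction rule: hom_induct)
  case zero
  show ?case unfolding Y'_0[OF assms(2)] by (rule csubspace_0[OF dual_sub])
next
  case (add x y)
  then show ?case unfolding Y'_add[OF assms(2) add(1,2)] by (intro csubspace_add[OF dual_sub])
next
  case (hom h v)
  then have v: "v \<in> V" using hom_V by blast
  have "supp (Y' v m \<alpha>) \<subseteq> (\<lambda>n. n - of_int (m + 1 - h)) ` supp \<alpha>"
  proof
    fix p assume "p \<in> supp (Y' v m \<alpha>)"
    then obtain w where w: "w \<in> G p" "\<alpha> (YO v m w) \<noteq> 0" by (auto simp: Y'_apply split: if_splits)
    then have "p + of_int (m + 1 - h) \<in> supp \<alpha>" using YO_weight[OF hom w(1)] by blast
    then show "p \<in> (\<lambda>n. n - of_int (m + 1 - h)) ` supp \<alpha>"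
      by (rule rev_image_eqI) (simp add: algebra_simps)
  qed
  then have "finite (supp (Y' v m \<alpha>))" using assms dual_supp by (meson finite_imageI finite_subset)
  moreover have "clinear_on W (Y' v m \<alpha>)"
    using W_sub by (intro clinear_onI) (simp_all add: Y'_apply csubspace_add csubspace_scale
        clinear_on_add[OF YO_lin[OF v]] clinear_on_scale[OF YO_lin[OF v]] YO_in v
        clinear_on_add[OF dual_lin[OF assms(2)]] clinear_on_scale[OF dual_lin[OF assms(2)]])
  ultimately show ?case unfolding dual_iff by (simp add: Y'_apply)
qed

text \<open>If the result is nonzero on weight p, then q = p + m + 1 - h lies in the finite support
  of \<alpha>. For large m the weight p = q + h - m - 1 is below the lower bound on weights
  congruent to q modulo the integers, uniformly over these finitely many q.\<close>

lemma Y'_trunc: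
  assumes "v \<in> V" "\<alpha> \<in> W'" shows "\<exists>N. \<forall>n\<ge>N. Y' v n \<alpha> = 0"
  using assms(1)
proof (induction rule: hom_induct)
  case zero
  then show ?case using Y'_0 assms by simp
next
  case (add x y)
  then obtain N M where "\<forall>n\<ge>N. Y' x n \<alpha> = 0" "\<forall>n\<ge>M. Y' y n \<alpha> = 0" by blast
  then have "\<forall>n\<ge>max N M. Y' (x + y) n \<alpha> = 0" using add Y'_add assms by simp
  then show ?case by blast
next
  case (hom h v)
  then have v: "v \<in> V" using hom_V by blast
  define K where "K q = (SOME K::int. \<forall>k<K. G (q + of_int k) = {0})" for q
  have K: "G (q + of_int k) = {0}" if "k < K q" for q k
    using someI_ex[OF G_low[of q]] that unfolding K_def by blast
  \<comment> \<open>The inserted 0 keeps the minimum defined when \<alpha> has empty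
    support.\<close>
  define B where "B = Min (insert 0 (K ` supp \<alpha>))"
  have B: "B \<le> K q" if "q \<in> supp \<alpha>" for q
    unfolding B_def using that dual_supp[OF assms(2)] by (intro Min_le) blast+
  have "Y' v m \<alpha> = 0" if "m \<ge> h - B" for m
  proof (rule dual_eqI[OF Y'_in[OF v assms(2)] csubspace_0[OF dual_sub]])
    fix p w assume w: "w \<in> G p"
    have "\<alpha> (YO v m w) = 0"
    proof (rule ccontr)
      let ?q = "p + of_int (m + 1 - h)"
      assume nz: "\<alpha> (YO v m w) \<noteq> 0"
      then have "?q \<in> supp \<alpha>" using YO_weight[OF hom w] by blast
      then have "G (?q + of_int (h - m - 1)) = {0}" using B[of ?q] that by (intro K) simp
      then have "w = 0" using w by simp
      then show False using nz clinear_on_0[OF YO_lin[OF v] W_sub] clinear_on_0[OF dual_lin[OF assms(2)] W_sub]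
        by simp
    qed
    then show "Y' v m \<alpha> w = 0 w" by (simp add: Y'_apply)
  qed
  then show ?case by blast
qed

lemma E_zero_of_L1: "L1 v = 0 \<Longrightarrow> j \<ge> 1 \<Longrightarrow> E j v = 0"
  by (cases j) (simp_all add: E_def funpow_Suc_right L1_pow_0 del: funpow.simps(2))

lemma YO_vac: "w \<in> W \<Longrightarrow> YO vac n w = (if n = -1 then w else 0)"
  using YO_hom[OF vac_hom E_zero_of_L1[OF L1_vac], where m = n and w = w] by (simp add: YW_vac)

text \<open>L(0) is its own transpose, since \<omega> has weight 2 and is killed by L(1); 2 * 2 - 1
  - 2 = 1 returns the same mode. The grading of W' is therefore dual to that of W.\<close>

lemma YO_\<omega>: "w \<in> W \<Longrightarrow> YO \<omega> 1 w = YW \<omega> 1 w"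
  using YO_hom[OF \<omega>_hom E_zero_of_L1[OF L1_\<omega>], where m = 1 and w = w] by simp

text \<open>Transposition reverses products: u_p applied after v_q on \<alpha> pairs with w as
  \<alpha> applied to the opposite v_q after the opposite u_p. As sums of functionals the two sides
  need a truncation bound \<open>N0\<close> independent of w, supplied by \<open>Y'_trunc\<close>;
  the opposite identity holds from some bound depending on w, and an N beyond both is used.\<close>

lemma Y'_borcherds: "borcherds V Y W' Y'"
  unfolding borcherds_def
proof (intro ballI allI)
  fix u v \<alpha> and l m n :: int
  assume u: "u \<in> V" and v: "v \<in> V" and \<alpha>: "\<alpha> \<in> W'"
  let ?A = "\<lambda>i::nat. gbin m i *\<^sub>C Y' (Y u (l + int i) v) (m + n - int i) \<alpha>"
  let ?B = "\<lambda>i::nat. ((-1) ^ i * gbin l i) *\<^sub>C (Y' u (m + l - int i) (Y' v (n + int i) \<alpha>)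
            - ((-1) powi l) *\<^sub>C Y' v (n + l - int i) (Y' u (m + int i) \<alpha>))"
  interpret self: weak_mod V Y vac \<omega> V Y by (rule self)
  obtain N1 where N1: "\<forall>i\<ge>N1. Y u (l + int i) v = 0" using self.trunc_ev[OF u v] by blast
  obtain N2 where N2: "\<forall>k\<ge>N2. Y' v k \<alpha> = 0" using Y'_trunc v \<alpha> by blast
  obtain N3 where N3: "\<forall>k\<ge>N3. Y' u k \<alpha> = 0" using Y'_trunc u \<alpha> by blast
  define N0 where "N0 = max N1 (max (nat (N2 - n)) (nat (N3 - m)))"
  have A: "?A i = 0" if "i \<ge> N0" for i using that N1 \<alpha> by (simp add: N0_def Y'_0)
  have B: "?B i = 0" if "i \<ge> N0" for i
  proof -
    have "n + int i \<ge> N2" "m + int i \<ge> N3" using that unfolding N0_def by linarith+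
    then show ?thesis using N2 N3 by (simp add: Y'_0_right)
  qed
  have fA: "fsum ?A w = (\<Sum>i<N. ?A i w)" if "N \<ge> N0" for N w
    using fsum_eq_sum_lessThan[of N ?A] A that by (simp add: sum_fun_apply)
  have fB: "fsum ?B w = (\<Sum>i<N. ?B i w)" if "N \<ge> N0" for N w
    using fsum_eq_sum_lessThan[of N ?B] B that by (simp add: sum_fun_apply)
  show "fsum ?A = fsum ?B"
  proof
    fix w
    show "fsum ?A w = fsum ?B w"
    proof (cases "w \<in> W")
      case True
      have "\<forall>\<^sub>F N in sequentially. N \<ge> N0" by (rule eventually_ge_at_top)
      with opposite_borcherds[OF u v True, of m l n] have "\<forall>\<^sub>F N in sequentially. fsum ?A w = fsum ?B w"
      proof eventually_elim
        case (elim N)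
        have "fsum ?A w = (\<Sum>i<N. ?A i w)"
          by (rule fA[OF elim(2)])
        also have "\<dots> = (\<Sum>i<N. \<alpha> (gbin m i *\<^sub>C YO (Y u (l + int i) v) (m + n - int i) w))"
          using True u v by (simp add: Y'_apply clinear_on_scale[OF dual_lin[OF \<alpha>]] YO_in self.YW_in)
        also have "\<dots> = \<alpha> (\<Sum>i<N. gbin m i *\<^sub>C YO (Y u (l + int i) v) (m + n - int i) w)"
          using True u v
          by (subst clinear_on_sum[OF dual_lin[OF \<alpha>] W_sub]) (auto intro!: csubspace_scale W_sub YO_in self.YW_in)
        also have "\<dots> = \<alpha> (\<Sum>i<N. ((-1) ^ i * gbin l i) *\<^sub>C
           (YO v (n + int i) (YO u (m + l - int i) w)
            - ((-1) powi l) *\<^sub>C YO u (m + int i) (YO v (n + l - int i) w)))"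
          by (simp only: elim(1))
        also have "\<dots> = (\<Sum>i<N. \<alpha> (((-1) ^ i * gbin l i) *\<^sub>C
           (YO v (n + int i) (YO u (m + l - int i) w)
            - ((-1) powi l) *\<^sub>C YO u (m + int i) (YO v (n + l - int i) w))))"
          using True u v
          by (intro clinear_on_sum[OF dual_lin[OF \<alpha>] W_sub] csubspace_scale csubspace_diff W_sub YO_in)
        also have "\<dots> = (\<Sum>i<N. ?B i w)"
          using True u v
          by (simp add: Y'_apply clinear_on_scale[OF dual_lin[OF \<alpha>]] clinear_on_diff[OF dual_lin[OF \<alpha>] W_sub]
              YO_in csubspace_diff[OF W_sub] csubspace_scale[OF W_sub])
        also have "\<dots> = fsum ?B w"
          by (rule fB[OF elim(2), symmetric])
        finally show ?case .
      qed
      then show ?thesis by simp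
    next
      case False
      then show ?thesis
        unfolding fA[OF order_refl] fB[OF order_refl] by (simp add: Y'_apply)
    qed
  qed
qed

lemma weak_dual: "weak_module V Y vac W' Y'"
  unfolding weak_module_def
proof (intro conjI ballI allI)
  fix \<alpha> n assume "\<alpha> \<in> W'"
  then show "Y' vac n \<alpha> = (if n = -1 then \<alpha> else 0)"
    using dual_outside[of \<alpha>] clinear_on_0[OF dual_lin W_sub, of \<alpha>]
    by (auto simp: fun_eq_iff Y'_apply YO_vac)
qed (use dual_sub Y'_in Y'_lin Y'_add Y'_scale Y'_trunc Y'_borcherds in \<open>auto simp: clinear_on_def\<close>)

lemma Y'_\<omega>: "Y' \<omega> 1 \<alpha> = (\<lambda>w. if w \<in> W then \<alpha> (YW \<omega> 1 w) else 0)"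
  by (auto simp: fun_eq_iff Y'_apply YO_\<omega>)

lemma S'_apply:
  assumes "\<alpha> \<in> W'" "w \<in> W"
  shows "(Y' \<omega> 1 \<alpha> - n *\<^sub>C \<alpha>) w = \<alpha> (S n w)"
  using assms(2)
  by (simp add: Y'_\<omega> clinear_on_diff[OF dual_lin[OF assms(1)] W_sub] T_in
      clinear_on_scale[OF dual_lin[OF assms(1)]] csubspace_scale[OF W_sub])

lemma S'_pow:
  assumes "\<alpha> \<in> W'"
  shows "((\<lambda>x. Y' \<omega> 1 x - n *\<^sub>C x) ^^ k) \<alpha> \<in> W' \<and>
    (\<forall>w\<in>W. ((\<lambda>x. Y' \<omega> 1 x - n *\<^sub>C x) ^^ k) \<alpha> w = \<alpha> ((S n ^^ k) w))"
proof (induction k)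
  case (Suc k)
  let ?\<beta> = "((\<lambda>x. Y' \<omega> 1 x - n *\<^sub>C x) ^^ k) \<alpha>"
  have \<beta>: "?\<beta> \<in> W'" "\<And>w. w \<in> W \<Longrightarrow> ?\<beta> w = \<alpha> ((S n ^^ k) w)" using Suc.IH by blast+
  have "(Y' \<omega> 1 ?\<beta> - n *\<^sub>C ?\<beta>) w = \<alpha> ((S n ^^ Suc k) w)" if w: "w \<in> W" for w
  proof -
    have "(Y' \<omega> 1 ?\<beta> - n *\<^sub>C ?\<beta>) w = ?\<beta> (S n w)"
      by (rule S'_apply[OF \<beta>(1) w])
    also have "\<dots> = \<alpha> ((S n ^^ Suc k) w)" unfolding \<beta>(2)[OF S_in[OF w]] by (simp only: funpow_Suc_right o_apply)
    finally show ?thesis .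
  qed
  moreover have "Y' \<omega> 1 ?\<beta> - n *\<^sub>C ?\<beta> \<in> W'"
    by (intro csubspace_diff csubspace_scale dual_sub Y'_in om_V \<beta>(1))
  ultimately show ?case unfolding funpow.simps o_apply by blast
qed (use assms in simp)

text \<open>Identifies the generalized L(0)-eigenspace of W' with the dual of W_[n]. One direction
  is \<open>functional_vanishes\<close>, the other the common nilpotency exponent on the
  finite-dimensional W_[n].\<close>

lemma G'_iff: "\<alpha> \<in> G' n \<longleftrightarrow> \<alpha> \<in> W' \<and> (\<forall>p w. p \<noteq> n \<longrightarrow> w \<in> G p \<longrightarrow> \<alpha> w = 0)"
proof
  assume "\<alpha> \<in> G' n"
  then obtain k where \<alpha>: "\<alpha> \<in> W'" and k: "((\<lambda>x. Y' \<omega> 1 x - n *\<^sub>C x) ^^ k) \<alpha> = 0"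
    unfolding gen_eigensp_def by blast
  have "\<alpha> ((S n ^^ k) w) = 0" if "w \<in> W" for w using S'_pow[OF \<alpha>, where n = n and k = k] that unfolding k by simp
  then show "\<alpha> \<in> W' \<and> (\<forall>p w. p \<noteq> n \<longrightarrow> w \<in> G p \<longrightarrow> \<alpha> w = 0)"
    using functional_vanishes[OF dual_lin[OF \<alpha>], where n = n and k = k] \<alpha> G_W by metis
next
  assume r: "\<alpha> \<in> W' \<and> (\<forall>p w. p \<noteq> n \<longrightarrow> w \<in> G p \<longrightarrow> \<alpha> w = 0)"
  then have \<alpha>: "\<alpha> \<in> W'" by blast
  obtain k where k: "\<And>w. w \<in> G n \<Longrightarrow> (S n ^^ k) w = 0" using G_nilpotent[OF G_fin_dim] by blast
  have "((\<lambda>x. Y' \<omega> 1 x - n *\<^sub>C x) ^^ k) \<alpha> = 0"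
  proof (rule dual_eqI[OF _ csubspace_0[OF dual_sub]])
    fix p w assume w: "w \<in> G p"
    have "((\<lambda>x. Y' \<omega> 1 x - n *\<^sub>C x) ^^ k) \<alpha> w = \<alpha> ((S n ^^ k) w)"
      using S'_pow[OF \<alpha>] G_W[OF w] by blast
    also have "\<dots> = 0"
    proof (cases "p = n")
      case True
      then show ?thesis using k w clinear_on_0[OF dual_lin[OF \<alpha>] W_sub] by simp
    next
      case False
      then show ?thesis using r Spow_G[OF w] by blast
    qed
    finally show "((\<lambda>x. Y' \<omega> 1 x - n *\<^sub>C x) ^^ k) \<alpha> w = 0 w"
      by (simp only: zero_fun_apply)
  qed (use S'_pow[OF \<alpha>] in blast)
  then show "\<alpha> \<in> G' n" using \<alpha> unfolding gen_eigensp_def by blast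
qed

text \<open>Extends a functional on one weight space by zero on the others; both coordinate
  functionals and evaluation maps arise in this way.\<close>

lemma comp_\<pi>_G':
  assumes "clinear_on (G n) f"
  shows "(\<lambda>w. if w \<in> W then f (\<pi> n w) else 0) \<in> G' n"
proof -
  let ?\<beta> = "\<lambda>w. if w \<in> W then f (\<pi> n w) else 0"
  have f0: "f 0 = 0" using clinear_on_0[OF assms G_sub] .
  have z: "?\<beta> w = 0" if "p \<noteq> n" "w \<in> G p" for p w using that f0 by (simp add: \<pi>_G[OF that(2)])
  then have "supp ?\<beta> \<subseteq> {n}" by blast
  then have "finite (supp ?\<beta>)" by (rule finite_subset) simp
  moreover have "clinear_on W ?\<beta>"
    by (rule clinear_onI) (simp_all add: W_sub csubspace_add csubspace_scale \<pi>_add \<pi>_scale \<pi>_in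
        clinear_on_add[OF assms] clinear_on_scale[OF assms])
  ultimately have "?\<beta> \<in> W'" unfolding dual_iff by simp
  then show ?thesis using z unfolding G'_iff by blast
qed

lemma dual_decomposition:
  assumes "\<alpha> \<in> W'"
  shows "\<exists>f. finite {n. f n \<noteq> 0} \<and> (\<forall>n. f n \<in> G' n) \<and> \<alpha> = fsum f"
proof -
  define f where "f n = (\<lambda>w. if w \<in> W then \<alpha> (\<pi> n w) else 0)" for n
  have G': "f n \<in> G' n" for n
    unfolding f_def using dual_lin[OF assms] G_W
    by (intro comp_\<pi>_G') (auto intro: clinear_on_subset)
  have "{n. f n \<noteq> 0} \<subseteq> supp \<alpha>"
    using \<pi>_in by (auto simp: f_def fun_eq_iff)
  then have fin: "finite {n. f n \<noteq> 0}" using dual_supp[OF assms] by (rule finite_subset)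
  have "fsum f w = \<alpha> w" for w
  proof (cases "w \<in> W")
    case True
    have "fsum (\<lambda>n. \<alpha> (\<pi> n w)) = (\<Sum>n | f n \<noteq> 0. \<alpha> (\<pi> n w))"
    proof (rule fsum_eq_sum[OF fin])
      fix n assume "n \<notin> {n. f n \<noteq> 0}"
      then have "f n w = 0" by simp
      then show "\<alpha> (\<pi> n w) = 0" using True by (simp add: f_def)
    qed
    then show ?thesis
      using lin_\<pi>[OF dual_lin[OF assms] True] True by (simp add: fsum_def sum_fun_apply f_def)
  next
    case False
    then show ?thesis by (simp add: fsum_def sum_fun_apply f_def dual_outside[OF assms])
  qed
  then show ?thesis using G' fin by (intro exI[of _ f]) (auto simp: fun_eq_iff)
qed

text \<open>A basis with its coordinate functionals, recorded through the expansion of vectors. The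
  functionals are taken as elements of W', so that they can be arguments of functionals on
  W'.\<close>

definition dual_bases :: "complex \<Rightarrow> 'w set \<Rightarrow> ('w \<Rightarrow> 'w \<Rightarrow> complex) \<Rightarrow> bool" where
  "dual_bases n B \<delta> \<longleftrightarrow> finite B \<and> B \<subseteq> G n \<and> (\<forall>b\<in>B. \<delta> b \<in> G' n)
    \<and> (\<forall>w\<in>G n. w = (\<Sum>b\<in>B. \<delta> b w *\<^sub>C b))"

lemma ex_dual_bases: "\<exists>B \<delta>. dual_bases n B \<delta>"
proof -
  obtain B where B: "finite B" "cv.independent B" "cv.span B = G n"
    using fin_dim_basis[OF G_sub G_fin_dim] by blast
  define \<delta> where "\<delta> b = (\<lambda>w. if w \<in> W then cv.representation B (\<pi> n w) b else 0)" for b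
  have BG: "B \<subseteq> G n" using B(3) cv.span_superset by blast
  moreover have "\<delta> b \<in> G' n" for b
    unfolding \<delta>_def using B(2,3)
    by (intro comp_\<pi>_G' clinear_onI) (simp_all add: cv.representation_add cv.representation_scale)
  moreover have "w = (\<Sum>b\<in>B. \<delta> b w *\<^sub>C b)" if "w \<in> G n" for w
    using cv.sum_representation_eq[OF B(2) _ B(1) order_refl, of w] that B(3) G_W[OF that]
    by (simp add: \<delta>_def \<pi>_G[OF that])
  ultimately have "dual_bases n B \<delta>" using B(1) unfolding dual_bases_def by blast
  then show ?thesis by blast
qed

lemma G'_expand:
  assumes "\<alpha> \<in> G' n" and bases: "dual_bases n B \<delta>"
  shows "\<alpha> = (\<Sum>b\<in>B. \<alpha> b *\<^sub>C \<delta> b)"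
proof (rule dual_eqI)
  have B: "B \<subseteq> G n" and \<delta>: "\<And>b. b \<in> B \<Longrightarrow> \<delta> b \<in> G' n"
    and expand: "\<And>w. w \<in> G n \<Longrightarrow> w = (\<Sum>b\<in>B. \<delta> b w *\<^sub>C b)"
    using bases unfolding dual_bases_def by blast+
  have \<alpha>: "\<alpha> \<in> W'" and \<alpha>0: "\<And>p w. p \<noteq> n \<Longrightarrow> w \<in> G p \<Longrightarrow> \<alpha> w = 0" using assms(1) G'_iff by auto
  then show "\<alpha> \<in> W'" by simp
  show "(\<Sum>b\<in>B. \<alpha> b *\<^sub>C \<delta> b) \<in> W'"
    using \<delta> G'_iff by (intro csubspace_sum csubspace_scale dual_sub) auto
  fix p w assume w: "w \<in> G p"
  show "\<alpha> w = (\<Sum>b\<in>B. \<alpha> b *\<^sub>C \<delta> b) w"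
  proof (cases "p = n")
    case True
    have "\<alpha> w = \<alpha> (\<Sum>b\<in>B. \<delta> b w *\<^sub>C b)" using expand w True by simp
    also have "\<dots> = (\<Sum>b\<in>B. \<alpha> (\<delta> b w *\<^sub>C b))"
      using B G_W by (intro clinear_on_sum[OF dual_lin[OF \<alpha>] W_sub] csubspace_scale W_sub) auto
    also have "\<dots> = (\<Sum>b\<in>B. \<delta> b w * \<alpha> b)"
      using B G_W by (intro sum.cong refl) (auto simp: clinear_on_scale[OF dual_lin[OF \<alpha>]])
    finally show ?thesis by (simp add: sum_fun_apply mult.commute)
  next
    case False
    then show ?thesis using \<alpha>0[OF False w] \<delta> w
      by (simp add: sum_fun_apply G'_iff)
  qed
qed

theorem contragredient_module: "gen_module ordinary V Y vac \<omega> W' Y'"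
  unfolding gen_module_def
proof (intro conjI ballI allI impI)
  show "weak_module V Y vac W' Y'" by (rule weak_dual)
next
  fix n
  obtain B \<delta> where bases: "dual_bases n B \<delta>" using ex_dual_bases by blast
  then have B: "finite B" "\<And>b. b \<in> B \<Longrightarrow> \<delta> b \<in> G' n" unfolding dual_bases_def by blast+
  have "\<alpha> \<in> cspan (\<delta> ` B)" if "\<alpha> \<in> G' n" for \<alpha>
  proof -
    have "(\<Sum>b\<in>B. \<alpha> b *\<^sub>C \<delta> b) \<in> cv.span (\<delta> ` B)"
      by (intro cv.span_sum cv.span_scale cv.span_base) auto
    then show ?thesis using G'_expand[OF that bases] by (simp add: cspan_eq)
  qed
  then show "fin_dim (G' n)"
    unfolding fin_dim_def using B by (intro exI[of _ "\<delta> ` B"]) auto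
next
  fix n
  obtain K :: int where K: "\<forall>k<K. G (n + of_int k) = {0}" using G_low by blast
  have "G' (n + of_int k) = {0}" if "k < K" for k
  proof -
    have "\<alpha> = 0" if "\<alpha> \<in> G' (n + of_int k)" for \<alpha>
    proof (rule dual_eqI)
      show "\<alpha> \<in> W'" "0 \<in> W'" using that G'_iff dual_sub by (auto simp: csubspace_0)
      fix p w assume w: "w \<in> G p"
      show "\<alpha> w = 0 w"
      proof (cases "p = n + of_int k")
        case True
        then have "w = 0" using K \<open>k < K\<close> w by blast
        then show ?thesis using that G'_iff clinear_on_0[OF dual_lin W_sub] by simp
      next
        case False
        then show ?thesis using that w G'_iff by auto
      qed
    qed
    moreover have "0 \<in> G' (n + of_int k)" using dual_sub by (simp add: G'_iff csubspace_0)
    ultimately show ?thesis by blast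
  qed
  then show "\<exists>K::int. \<forall>k<K. G' (n + of_int k) = {0}" by blast
next
  fix n assume ordinary
  show "G' n = eigensp W' (Y' \<omega> 1) n"
  proof
    show "eigensp W' (Y' \<omega> 1) n \<subseteq> G' n"
      by (auto simp: eigensp_def gen_eigensp_def intro: exI[of _ 1])
    show "G' n \<subseteq> eigensp W' (Y' \<omega> 1) n"
    proof
      fix \<alpha> assume \<alpha>: "\<alpha> \<in> G' n"
      then have \<alpha>W: "\<alpha> \<in> W'" using G'_iff by blast
      have "Y' \<omega> 1 \<alpha> = n *\<^sub>C \<alpha>"
      proof (rule dual_eqI[OF Y'_in[OF om_V \<alpha>W] csubspace_scale[OF dual_sub \<alpha>W]])
        fix p w assume w: "w \<in> G p"
        show "Y' \<omega> 1 \<alpha> w = (n *\<^sub>C \<alpha>) w"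
        proof (cases "p = n")
          case True
          then have "YW \<omega> 1 w = n *\<^sub>C w" using w G_ordinary[OF \<open>ordinary\<close>] by (auto simp: eigensp_def)
          then show ?thesis using G_W[OF w] by (simp add: Y'_\<omega> clinear_on_scale[OF dual_lin[OF \<alpha>W]])
        next
          case False
          then show ?thesis using \<alpha> w T_G[OF w] G'_iff by (auto simp: Y'_\<omega>)
        qed
      qed
      then show "\<alpha> \<in> eigensp W' (Y' \<omega> 1) n" using \<alpha>W by (simp add: eigensp_def)
    qed
  qed
qed (rule dual_decomposition)

end

section \<open>Homomorphic images and the completion\<close>

lemma finite_support_nat: "\<exists>N. \<forall>i\<ge>N. g i = 0 \<Longrightarrow> finite {i::nat. g i \<noteq> 0}"
proof -
  assume "\<exists>N. \<forall>i\<ge>N. g i = 0"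
  then obtain N where "\<forall>i\<ge>N. g i = 0" by blast
  then have "{i. g i \<noteq> 0} \<subseteq> {..<N}" by (auto simp flip: not_le)
  then show ?thesis by (rule finite_subset) simp
qed

context weak_mod
begin

text \<open>\<open>YU\<close> is an arbitrary family of maps that f intertwines with
  \<open>YW\<close>. Each axiom is transported by writing elements as f w; for the Jacobi identity
  the supports are shown finite in W, which lets f pass through both sums.\<close>

lemma hom_image_weak_module:
  assumes lin: "clinear_on W f"
    and f_hom: "\<And>v n w. v \<in> V \<Longrightarrow> w \<in> W \<Longrightarrow> f (YW v n w) = YU v n (f w)"
  shows "weak_module V Y vac (f ` W) YU"
proof -
  interpret self: weak_mod V Y vac \<omega> V Y by (rule self)
  have f0: "f 0 = 0" using clinear_on_0[OF lin W_sub] .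
  have add: "f x + f y = f (x + y)" if "x \<in> W" "y \<in> W" for x y
    using clinear_on_add[OF lin that] by simp
  have scale: "c *\<^sub>C f x = f (c *\<^sub>C x)" if "x \<in> W" for c x
    using clinear_on_scale[OF lin that] by simp
  have diff: "f x - f y = f (x - y)" if "x \<in> W" "y \<in> W" for x y
    using clinear_on_diff[OF lin W_sub that] by simp
  show ?thesis unfolding weak_module_def
  proof (intro conjI ballI allI)
    show "csubspace (f ` W)"
      unfolding csubspace_def using W_sub f0 add scale
      by (force simp: csubspace_0 csubspace_add csubspace_scale intro: rev_image_eqI)
  next
    fix v n u assume "v \<in> V" "u \<in> f ` W"
    then show "YU v n u \<in> f ` W" using YW_in by (auto simp flip: f_hom)
  next
    fix v n assume v: "v \<in> V"
    show "clinear_on (f ` W) (YU v n)"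
      by (rule clinear_onI)
        (auto simp: add scale W_sub csubspace_add csubspace_scale YW_in v
          clinear_on_add[OF YW_lin[OF v]] clinear_on_scale[OF YW_lin[OF v]] simp flip: f_hom)
  next
    fix u n assume "u \<in> f ` W"
    then show "clinear_on V (\<lambda>v. YU v n u)"
      using V_sub by (intro clinear_onI)
        (auto simp: add scale csubspace_add csubspace_scale YW_in
          clinear_on_add[OF YW_lin_v] clinear_on_scale[OF YW_lin_v] simp flip: f_hom)
  next
    fix v u assume v: "v \<in> V" and "u \<in> f ` W"
    then obtain w where w: "w \<in> W" "u = f w" by blast
    obtain N where "\<forall>n\<ge>N. YW v n w = 0" using YW_trunc[OF v w(1)] by blast
    then have "\<forall>n\<ge>N. YU v n u = 0" using f0 v w by (simp flip: f_hom)
    then show "\<exists>N. \<forall>n\<ge>N. YU v n u = 0" ..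
  next
    fix u n assume "u \<in> f ` W"
    then show "YU vac n u = (if n = -1 then u else 0)"
      using vac_V f0 by (auto simp: YW_vac simp flip: f_hom)
  next
    show "borcherds V Y (f ` W) YU" unfolding borcherds_def
    proof (intro ballI allI)
      fix u v x and l m n :: int
      assume u: "u \<in> V" and v: "v \<in> V" and "x \<in> f ` W"
      then obtain w where w: "w \<in> W" and x: "x = f w" by blast
      let ?A = "\<lambda>i::nat. gbin m i *\<^sub>C YW (Y u (l + int i) v) (m + n - int i) w"
      let ?B = "\<lambda>i::nat. ((-1) ^ i * gbin l i) *\<^sub>C
           (YW u (m + l - int i) (YW v (n + int i) w)
            - ((-1) powi l) *\<^sub>C YW v (n + l - int i) (YW u (m + int i) w))"
      obtain N1 where N1: "\<forall>i\<ge>N1. Y u (l + int i) v = 0" using self.trunc_ev[OF u v] by blast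
      obtain N2 where N2: "\<forall>i\<ge>N2. YW v (n + int i) w = 0" using trunc_ev[OF v w] by blast
      obtain N3 where N3: "\<forall>i\<ge>N3. YW u (m + int i) w = 0" using trunc_ev[OF u w] by blast
      have A_in: "?A i \<in> W" and B_in: "?B i \<in> W" for i
        using u v w self.YW_in by (auto intro!: csubspace_scale csubspace_diff W_sub YW_in)
      have "\<forall>i\<ge>N1. ?A i = 0" using N1 by (simp add: YW_0_left w)
      then have A: "finite {i. ?A i \<noteq> 0}" by (intro finite_support_nat) blast
      have "\<forall>i\<ge>max N2 N3. ?B i = 0" using N2 N3 u v by (simp add: YW_0_right)
      then have B: "finite {i. ?B i \<noteq> 0}" by (intro finite_support_nat) blast
      have "fsum (\<lambda>i::nat. gbin m i *\<^sub>C YU (Y u (l + int i) v) (m + n - int i) x)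
        = fsum (\<lambda>i. f (?A i))"
        unfolding x using u v w self.YW_in YW_in by (simp add: clinear_on_scale[OF lin] f_hom)
      also have "\<dots> = f (fsum ?A)" using clinear_on_fsum[OF lin W_sub A_in A] by simp
      also have "\<dots> = f (fsum ?B)" using borch[OF u v w] by simp
      also have "\<dots> = fsum (\<lambda>i. f (?B i))" by (rule clinear_on_fsum[OF lin W_sub B_in B])
      also have "\<dots> = fsum (\<lambda>i::nat. ((-1) ^ i * gbin l i) *\<^sub>C
           (YU u (m + l - int i) (YU v (n + int i) x)
            - ((-1) powi l) *\<^sub>C YU v (n + l - int i) (YU u (m + int i) x)))"
        unfolding x using u v w W_sub
        by (simp add: clinear_on_scale[OF lin] clinear_on_diff[OF lin W_sub] csubspace_diff
            csubspace_scale YW_in f_hom)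
      finally show "fsum (\<lambda>i::nat. gbin m i *\<^sub>C YU (Y u (l + int i) v) (m + n - int i) x)
        = fsum (\<lambda>i::nat. ((-1) ^ i * gbin l i) *\<^sub>C
           (YU u (m + l - int i) (YU v (n + int i) x)
            - ((-1) powi l) *\<^sub>C YU v (n + l - int i) (YU u (m + int i) x)))" .
    qed
  qed
qed

end

context gen_mod
begin

text \<open>The weight spaces of the image are the images of the weight spaces, whence finite
  dimension, lower bounds and semisimplicity.\<close>

lemma hom_image_gen_module:
  assumes lin: "clinear_on W f"
    and f_hom: "\<And>v n w. v \<in> V \<Longrightarrow> w \<in> W \<Longrightarrow> f (YW v n w) = YU v n (f w)"
  shows "gen_module ordinary V Y vac \<omega> (f ` W) YU"
proof -
  have weak_U: "weak_module V Y vac (f ` W) YU" by (rule hom_image_weak_module[OF assms])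
  interpret U: weak_mod V Y vac \<omega> "f ` W" YU by unfold_locales (rule weak_U)
  have f0: "f 0 = 0" using clinear_on_0[OF lin W_sub] .
  have step: "YU \<omega> 1 (f w) - n *\<^sub>C f w = f (S n w)" if "w \<in> W" for n w
    using that om_V by (simp add: clinear_on_diff[OF lin W_sub] clinear_on_scale[OF lin]
        csubspace_scale[OF W_sub] YW_in f_hom)
  have pow: "((\<lambda>x. YU \<omega> 1 x - n *\<^sub>C x) ^^ k) (f w) = f ((S n ^^ k) w)" if "w \<in> W" for n k w
  proof (induction k)
    case (Suc k)
    then show ?case using step[OF Spow_in[OF that]] by simp
  qed simp
  have f_G: "f w \<in> gen_eigensp (f ` W) (YU \<omega> 1) n" if w: "w \<in> G n" for w n
  proof -
    obtain k where "(S n ^^ k) w = 0" using w unfolding gen_eigensp_def by blast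
    then have "((\<lambda>x. YU \<omega> 1 x - n *\<^sub>C x) ^^ k) (f w) = 0" using pow[OF G_W[OF w]] f0 by simp
    then show ?thesis using G_W[OF w] unfolding gen_eigensp_def by blast
  qed
  have f_dec: "finite {n. f (\<pi> n w) \<noteq> 0}" "f w = fsum (\<lambda>n. f (\<pi> n w))" if "w \<in> W" for w
  proof -
    show "finite {n. f (\<pi> n w) \<noteq> 0}"
      by (rule finite_subset[OF _ \<pi>_finite[OF that]]) (auto simp: f0)
    show "f w = fsum (\<lambda>n. f (\<pi> n w))" by (rule lin_\<pi>[OF lin that])
  qed
  interpret UG: graded_space "f ` W" "YU \<omega> 1"
  proof
    fix u assume "u \<in> f ` W"
    then obtain w where w: "w \<in> W" "u = f w" by blast
    show "\<exists>g. finite {n. g n \<noteq> 0} \<and> (\<forall>n. g n \<in> gen_eigensp (f ` W) (YU \<omega> 1) n) \<and> u = fsum g"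
      using f_dec[OF w(1)] f_G[OF \<pi>_in[OF w(1)]] unfolding w(2)
      by (intro exI[of _ "\<lambda>n. f (\<pi> n w)"]) simp
  qed (use U.W_sub om_V U.YW_in U.YW_lin in auto)
  have G_eq: "gen_eigensp (f ` W) (YU \<omega> 1) n = f ` G n" for n
  proof
    show "gen_eigensp (f ` W) (YU \<omega> 1) n \<subseteq> f ` G n"
    proof
      fix u assume u: "u \<in> gen_eigensp (f ` W) (YU \<omega> 1) n"
      then obtain w where w: "w \<in> W" "u = f w" unfolding gen_eigensp_def by blast
      \<comment> \<open>The images of the components of w form an admissible family for u; by
        uniqueness, a generalized eigenvector u equals the image of a single component.\<close>
      have "decomp (f ` W) (YU \<omega> 1) u = (\<lambda>n. f (\<pi> n w))"
        using f_dec[OF w(1)] f_G[OF \<pi>_in[OF w(1)]] unfolding w(2) by (intro UG.decomp_eqI)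
      then have "u = f (\<pi> n w)" using UG.\<pi>_G[OF u, of n] by simp
      then show "u \<in> f ` G n" using \<pi>_in[OF w(1)] by blast
    qed
  qed (use f_G in blast)
  show ?thesis unfolding gen_module_def
  proof (intro conjI ballI allI impI)
    show "fin_dim (gen_eigensp (f ` W) (YU \<omega> 1) n)" for n
      unfolding G_eq using G_W
      by (intro fin_dim_image G_fin_dim G_sub clinear_on_subset[OF lin]) auto
    show "\<exists>K::int. \<forall>k<K. gen_eigensp (f ` W) (YU \<omega> 1) (n + of_int k) = {0}" for n
    proof -
      obtain K :: int where "\<forall>k<K. G (n + of_int k) = {0}" using G_low by blast
      then have "\<forall>k<K. gen_eigensp (f ` W) (YU \<omega> 1) (n + of_int k) = {0}"
        unfolding G_eq using f0 by simp
      then show ?thesis ..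
    qed
    show "gen_eigensp (f ` W) (YU \<omega> 1) n = eigensp (f ` W) (YU \<omega> 1) n" if ordinary for n
    proof
      show "eigensp (f ` W) (YU \<omega> 1) n \<subseteq> gen_eigensp (f ` W) (YU \<omega> 1) n"
        by (auto simp: eigensp_def gen_eigensp_def intro: exI[of _ 1])
      show "gen_eigensp (f ` W) (YU \<omega> 1) n \<subseteq> eigensp (f ` W) (YU \<omega> 1) n"
        unfolding G_eq G_ordinary[OF that]
        by (auto simp: eigensp_def clinear_on_scale[OF lin] om_V simp flip: f_hom)
    qed
  qed (use weak_U UG.ex_dec in auto)
qed

section \<open>The completion and its pairing with the contragredient\<close>

abbreviation "Wbar \<equiv> completion W (YW \<omega> 1)"

lemma completion_sub: "csubspace Wbar"
  using G_sub unfolding completion_def csubspace_def by auto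

lemma completion_in: "f \<in> Wbar \<Longrightarrow> f n \<in> G n"
  by (simp add: completion_def)

lemma pairing_supp: "f \<in> Wbar \<Longrightarrow> {n. \<alpha> (f n) \<noteq> 0} \<subseteq> supp \<alpha>"
  using completion_in by blast

lemma pairing_eq_sum:
  assumes "\<alpha> \<in> W'" "f \<in> Wbar" "finite A" "supp \<alpha> \<subseteq> A"
  shows "pairing \<alpha> f = (\<Sum>n\<in>A. \<alpha> (f n))"
  unfolding pairing_def using pairing_supp[OF assms(2), of \<alpha>] assms(3,4)
  by (intro fsum_eq_sum) auto

lemma pairing_lin: assumes "\<alpha> \<in> W'" shows "clinear_on Wbar (pairing \<alpha>)"
  using completion_sub G_W[OF completion_in]
  by (intro clinear_onI) (simp_all add: pairing_eq_sum[OF assms _ dual_supp[OF assms] order_refl]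
      csubspace_add csubspace_scale clinear_on_add[OF dual_lin[OF assms]]
      clinear_on_scale[OF dual_lin[OF assms]] sum.distrib sum_distrib_left)

lemma pairing_lin_left: assumes "f \<in> Wbar" shows "clinear_on W' (\<lambda>\<alpha>. pairing \<alpha> f)"
proof (rule clinear_onI)
  fix \<alpha> \<beta> assume ab: "\<alpha> \<in> W'" "\<beta> \<in> W'"
  let ?A = "supp \<alpha> \<union> supp \<beta>"
  have A: "finite ?A" using ab dual_supp by blast
  have "supp (\<alpha> + \<beta>) \<subseteq> ?A" by auto
  then have "pairing (\<alpha> + \<beta>) f = (\<Sum>n\<in>?A. (\<alpha> + \<beta>) (f n))"
    by (rule pairing_eq_sum[OF csubspace_add[OF dual_sub ab] assms A])
  moreover have "pairing \<alpha> f = (\<Sum>n\<in>?A. \<alpha> (f n))" "pairing \<beta> f = (\<Sum>n\<in>?A. \<beta> (f n))"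
    using ab by (auto intro!: pairing_eq_sum[OF _ assms A])
  ultimately show "pairing (\<alpha> + \<beta>) f = pairing \<alpha> f + pairing \<beta> f" by (simp add: sum.distrib)
next
  fix c \<alpha> assume a: "\<alpha> \<in> W'"
  have "supp (c *\<^sub>C \<alpha>) \<subseteq> supp \<alpha>" by auto
  then have "pairing (c *\<^sub>C \<alpha>) f = (\<Sum>n\<in>supp \<alpha>. (c *\<^sub>C \<alpha>) (f n))"
    by (rule pairing_eq_sum[OF csubspace_scale[OF dual_sub a] assms dual_supp[OF a]])
  then show "pairing (c *\<^sub>C \<alpha>) f = c *\<^sub>C pairing \<alpha> f"
    by (simp add: pairing_eq_sum[OF a assms dual_supp[OF a] order_refl] sum_distrib_left)
qed

text \<open>A homogeneous mode shifts weights by a fixed amount, so only one component of f can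
  reach weight k; general v is a finite sum of homogeneous vectors.\<close>

lemma Ybar_finite:
  assumes "v \<in> V" "f \<in> Wbar" shows "finite {p. \<pi> k (YW v m (f p)) \<noteq> 0}"
  using assms(1)
proof (induction rule: hom_induct)
  case zero
  have "\<pi> k (YW 0 m (f p)) = 0" for p
    using YW_0_left[OF G_W[OF completion_in[OF assms(2)]]] clinear_on_0[OF \<pi>_lin W_sub] by simp
  then show ?case by simp
next
  case (add x y)
  have "\<pi> k (YW (x + y) m (f p)) = \<pi> k (YW x m (f p)) + \<pi> k (YW y m (f p))" for p
    using G_W[OF completion_in[OF assms(2)]] add(1,2)
    by (simp add: clinear_on_add[OF YW_lin_v] \<pi>_add YW_in)
  then have "{p. \<pi> k (YW (x + y) m (f p)) \<noteq> 0}
    \<subseteq> {p. \<pi> k (YW x m (f p)) \<noteq> 0} \<union> {p. \<pi> k (YW y m (f p)) \<noteq> 0}" by auto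
  then show ?case using add(3,4) by (meson finite_UnI finite_subset)
next
  case (hom h v)
  have "{p. \<pi> k (YW v m (f p)) \<noteq> 0} \<subseteq> {k - of_int (h - m - 1)}"
    using \<pi>_G[OF mode_weight[OF hom completion_in[OF assms(2)]], where m = k] by (auto split: if_splits)
  then show ?case by (rule finite_subset) simp
qed

lemma dual_eq_sum_supp:
  assumes "\<alpha> \<in> W'" "w \<in> W" shows "\<alpha> w = (\<Sum>k\<in>supp \<alpha>. \<alpha> (\<pi> k w))"
proof -
  have "fsum (\<lambda>k. \<alpha> (\<pi> k w)) = (\<Sum>k\<in>supp \<alpha>. \<alpha> (\<pi> k w))"
    using \<pi>_in[OF assms(2)] by (intro fsum_eq_sum dual_supp assms) auto
  then show ?thesis using lin_\<pi>[OF dual_lin[OF assms(1)] assms(2)] by simp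
qed

text \<open>\<alpha> sees finitely many weights k, and each receives contributions from finitely
  many p. Over the union \<open>?Q\<close> of these p the double sum is finite and its order can be
  exchanged.\<close>

lemma pairing_modes_finite:
  assumes "v \<in> V" "\<alpha> \<in> W'" "f \<in> Wbar"
  shows "finite {p. \<alpha> (YW v m (f p)) \<noteq> 0}"
    and "pairing \<alpha> (Ybar W YW \<omega> v m f) = fsum (\<lambda>p. \<alpha> (YW v m (f p)))"
proof -
  have W: "YW v m (f p) \<in> W" for p using assms G_W[OF completion_in] YW_in by blast
  let ?Q = "\<Union>k\<in>supp \<alpha>. {p. \<pi> k (YW v m (f p)) \<noteq> 0}"
  have Q: "finite ?Q" using dual_supp[OF assms(2)] Ybar_finite[OF assms(1,3)] by blast
  have \<alpha>0: "\<alpha> 0 = 0" using clinear_on_0[OF dual_lin[OF assms(2)] W_sub] .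
  have out: "\<alpha> (YW v m (f p)) = 0" if "p \<notin> ?Q" for p
    unfolding dual_eq_sum_supp[OF assms(2) W] using that by (intro sum.neutral) (auto simp: \<alpha>0)
  then have "{p. \<alpha> (YW v m (f p)) \<noteq> 0} \<subseteq> ?Q" by blast
  then show "finite {p. \<alpha> (YW v m (f p)) \<noteq> 0}" using Q by (rule finite_subset)
  have Yb: "Ybar W YW \<omega> v m f k = (\<Sum>p\<in>?Q. \<pi> k (YW v m (f p)))" if "k \<in> supp \<alpha>" for k
    unfolding Ybar_def using that by (intro fsum_eq_sum Q) auto
  have YbG: "Ybar W YW \<omega> v m f k \<in> G k" for k
    unfolding Ybar_def by (intro csubspace_fsum G_sub \<pi>_in W)
  then have "Ybar W YW \<omega> v m f \<in> Wbar" by (simp add: completion_def)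
  then have "pairing \<alpha> (Ybar W YW \<omega> v m f) = (\<Sum>k\<in>supp \<alpha>. \<alpha> (Ybar W YW \<omega> v m f k))"
    by (rule pairing_eq_sum[OF assms(2) _ dual_supp[OF assms(2)] order_refl])
  also have "\<dots> = (\<Sum>k\<in>supp \<alpha>. \<Sum>p\<in>?Q. \<alpha> (\<pi> k (YW v m (f p))))"
    by (intro sum.cong refl, subst Yb)
      (auto intro!: clinear_on_sum[OF dual_lin[OF assms(2)] W_sub] \<pi>_W W)
  also have "\<dots> = (\<Sum>p\<in>?Q. \<alpha> (YW v m (f p)))"
    by (subst sum.swap) (simp only: dual_eq_sum_supp[OF assms(2) W])
  also have "\<dots> = fsum (\<lambda>p. \<alpha> (YW v m (f p)))" by (rule fsum_eq_sum[symmetric]) (use Q out in auto)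
  finally show "pairing \<alpha> (Ybar W YW \<omega> v m f) = fsum (\<lambda>p. \<alpha> (YW v m (f p)))" .
qed

lemma pairing_Ybar_lin:
  assumes "\<alpha> \<in> W'" "f \<in> Wbar"
  shows "clinear_on V (\<lambda>v. pairing \<alpha> (Ybar W YW \<omega> v m f))"
proof -
  have W: "f p \<in> W" for p using assms G_W[OF completion_in] by blast
  have "clinear_on V (\<lambda>v. fsum (\<lambda>p. \<alpha> (YW v m (f p))))"
  proof (rule clinear_on_fsumI)
    show "clinear_on V (\<lambda>v. \<alpha> (YW v m (f p)))" for p
      by (rule clinear_onI) (simp_all add: clinear_on_add[OF YW_lin_v] clinear_on_scale[OF YW_lin_v] W
          YW_in clinear_on_add[OF dual_lin[OF assms(1)]] clinear_on_scale[OF dual_lin[OF assms(1)]])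
  qed (use V_sub pairing_modes_finite(1) assms in \<open>auto intro: csubspace_add csubspace_scale\<close>)
  then show ?thesis using V_sub assms
    by (simp add: clinear_on_def pairing_modes_finite(2) csubspace_add csubspace_scale)
qed

text \<open>Extends the definition of the contragredient action from vectors of W to elements of the
  completion. The additional sum over components of f has to be interchanged with the sums over h
  and j of the transform.\<close>

lemma opp_pairing_Ybar:
  assumes "v \<in> V" "\<alpha> \<in> W'" "f \<in> Wbar"
  shows "Opp (\<lambda>v m. pairing \<alpha> (Ybar W YW \<omega> v m f)) v m = pairing (Y' v m \<alpha>) f"
proof -
  have W: "f p \<in> W" for p using assms G_W[OF completion_in] by blast
  let ?H = "{h. comp v h \<noteq> 0}"
  let ?g = "\<lambda>h j p. \<alpha> (YW (E j (comp v h)) (2 * h - m - 2 - int j) (f p))"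
  \<comment> \<open>One finite set of weights that works for all pairs (h, j) at once.\<close>
  let ?Q = "\<Union>h\<in>?H. \<Union>j<nat (h - lb + 1). {p. ?g h j p \<noteq> 0}"
  have EV: "E j (comp v h) \<in> V" for j h using E_comp_V[OF assms(1)] .
  have Q: "finite ?Q"
    using comp_finite[OF assms(1)] pairing_modes_finite(1)[OF EV assms(2,3)] by blast
  have \<alpha>YO: "\<alpha> (YO v m (f p)) = (\<Sum>h\<in>?H. \<Sum>j<nat (h - lb + 1). (-1) powi h * ?g h j p)" for p
    by (simp add: YO_finite[OF assms(1) W] clinear_on_sum[OF dual_lin[OF assms(2)] W_sub]
        csubspace_sum[OF W_sub] csubspace_scale[OF W_sub] YW_in EV W
        clinear_on_scale[OF dual_lin[OF assms(2)]])
  have "Opp (\<lambda>v m. pairing \<alpha> (Ybar W YW \<omega> v m f)) v m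
    = (\<Sum>h\<in>?H. \<Sum>j<nat (h - lb + 1). (-1) powi h * fsum (?g h j))"
    using opp_finite[OF assms(1) pairing_Ybar_lin[OF assms(2,3)]]
    by (simp add: pairing_modes_finite(2)[OF EV assms(2,3)])
  also have "\<dots> = (\<Sum>h\<in>?H. \<Sum>j<nat (h - lb + 1). \<Sum>p\<in>?Q. (-1) powi h * ?g h j p)"
  proof (intro sum.cong refl)
    fix h j assume "h \<in> ?H" "j \<in> {..<nat (h - lb + 1)}"
    then have "fsum (?g h j) = (\<Sum>p\<in>?Q. ?g h j p)" by (intro fsum_eq_sum[OF Q]) blast
    then show "(-1) powi h * fsum (?g h j) = (\<Sum>p\<in>?Q. (-1) powi h * ?g h j p)"
      by (simp only: sum_distrib_left)
  qed
  also have "\<dots> = (\<Sum>h\<in>?H. \<Sum>p\<in>?Q. \<Sum>j<nat (h - lb + 1). (-1) powi h * ?g h j p)"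
    by (rule sum.cong[OF refl], rule sum.swap)
  also have "\<dots> = (\<Sum>p\<in>?Q. \<Sum>h\<in>?H. \<Sum>j<nat (h - lb + 1). (-1) powi h * ?g h j p)"
    by (rule sum.swap)
  also have "\<dots> = (\<Sum>p\<in>?Q. \<alpha> (YO v m (f p)))" by (simp only: \<alpha>YO)
  also have "\<dots> = fsum (\<lambda>p. \<alpha> (YO v m (f p)))"
    by (rule fsum_eq_sum[symmetric, OF Q]) (unfold \<alpha>YO, intro sum.neutral ballI, auto)
  also have "\<dots> = pairing (Y' v m \<alpha>) f" by (simp add: pairing_def Y'_apply W)
  finally show ?thesis .
qed

end

section \<open>Quasi-intertwining maps\<close>

locale tensor_pair = voa V Y vac \<omega> + M1: weak_mod V Y vac \<omega> W1 Y1 + M2: weak_mod V Y vac \<omega> W2 Y2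
  for V :: "'v::cvec set" and Y :: "'v \<Rightarrow> int \<Rightarrow> 'v \<Rightarrow> 'v" and vac \<omega> :: 'v
    and W1 :: "'w1::cvec set" and Y1 :: "'v \<Rightarrow> int \<Rightarrow> 'w1 \<Rightarrow> 'w1"
    and W2 :: "'w2::cvec set" and Y2 :: "'v \<Rightarrow> int \<Rightarrow> 'w2 \<Rightarrow> 'w2" +
  fixes z :: complex
begin

abbreviation "\<tau> \<equiv> tauP V Y \<omega> W1 Y1 W2 Y2 z"
abbreviation "bilin \<equiv> bilin_forms W1 W2"

text \<open>The coefficient of x_0^k x_1^(-m-1) in z^(-1) delta((x_1 - x_0)/z); the residue pairs it
  with v_k on the first factor.\<close>

definition res_coeff :: "int \<Rightarrow> nat \<Rightarrow> complex" where
  "res_coeff m k = (-1) ^ k * gbin (int k - m - 1) k * z powi (m - int k)"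

definition res_part :: "('w1 \<Rightarrow> 'w2 \<Rightarrow> complex) \<Rightarrow> 'w1 \<Rightarrow> 'w2 \<Rightarrow> 'v \<Rightarrow> int \<Rightarrow> complex" where
  "res_part lam a b v m = fsum (\<lambda>k. res_coeff m k * lam (Y1 v (int k) a) b)"

text \<open>The right-hand side \<open>\<lambda>(w\<^sub>1 \<otimes> Y\<^sub>2(v,x)w\<^sub>2) + Res \<lambda>(Y\<^sub>1(v,x\<^sub>0)w\<^sub>1 \<otimes> w\<^sub>2)\<close> of the quasi-intertwining
  relation; \<open>\<tau>\<close> is its image under \<open>opp\<close>.\<close>
definition modes :: "('w1 \<Rightarrow> 'w2 \<Rightarrow> complex) \<Rightarrow> 'w1 \<Rightarrow> 'w2 \<Rightarrow> 'v \<Rightarrow> int \<Rightarrow> complex" where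
  "modes lam a b v m = res_part lam a b v m + lam a (Y2 v m b)"

lemma bilin_left: "lam \<in> bilin \<Longrightarrow> b \<in> W2 \<Longrightarrow> clinear_on W1 (\<lambda>a. lam a b)"
  and bilin_right: "lam \<in> bilin \<Longrightarrow> a \<in> W1 \<Longrightarrow> clinear_on W2 (lam a)"
  and bilin_outside: "lam \<in> bilin \<Longrightarrow> a \<notin> W1 \<or> b \<notin> W2 \<Longrightarrow> lam a b = 0"
  by (auto simp: bilin_forms_def)

lemma res_part_finite:
  assumes "lam \<in> bilin" "a \<in> W1" "b \<in> W2" "v \<in> V"
  shows "finite {k. res_coeff m k * lam (Y1 v (int k) a) b \<noteq> 0}"
proof -
  have "\<exists>N. \<forall>i\<ge>N. Y1 v (0 + int i) a = 0" by (rule M1.trunc_ev) fact+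
  then obtain N where "\<forall>i\<ge>N. Y1 v (int i) a = 0" by auto
  then have "\<forall>k\<ge>N. res_coeff m k * lam (Y1 v (int k) a) b = 0"
    using clinear_on_0[OF bilin_left[OF assms(1,3)] M1.W_sub] by simp
  then show ?thesis by (intro finite_support_nat) blast
qed

lemma res_part_lin:
  assumes "lam \<in> bilin" "a \<in> W1" "b \<in> W2"
  shows "clinear_on V (\<lambda>v. res_part lam a b v m)"
  unfolding res_part_def
proof (rule clinear_on_fsumI)
  show "clinear_on V (\<lambda>v. res_coeff m k * lam (Y1 v (int k) a) b)" for k
    using assms
    by (intro clinear_onI) (simp_all add: clinear_on_add[OF M1.YW_lin_v] clinear_on_scale[OF M1.YW_lin_v]
        M1.YW_in clinear_on_add[OF bilin_left] clinear_on_scale[OF bilin_left] algebra_simps)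
qed (use V_sub assms res_part_finite in \<open>auto intro: csubspace_add csubspace_scale\<close>)

lemma right_part_lin:
  assumes "lam \<in> bilin" "a \<in> W1" "b \<in> W2"
  shows "clinear_on V (\<lambda>v. lam a (Y2 v m b))"
  using assms
  by (intro clinear_onI) (simp_all add: clinear_on_add[OF M2.YW_lin_v] clinear_on_scale[OF M2.YW_lin_v]
      M2.YW_in clinear_on_add[OF bilin_right] clinear_on_scale[OF bilin_right])

lemma modes_lin:
  assumes "lam \<in> bilin" "a \<in> W1" "b \<in> W2"
  shows "clinear_on V (\<lambda>v. modes lam a b v m)"
  using res_part_lin[OF assms, of m] right_part_lin[OF assms, of m]
  unfolding modes_def clinear_on_def by (simp add: algebra_simps)

text \<open>Substituting x_1^(-1) for x_1 in the delta function means evaluating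
  \<open>res_coeff\<close> at the mode that \<open>opp\<close> prescribes. The left and right parts
  of \<open>tauP\<close> are thus transforms of the two summands of \<open>modes\<close>.\<close>

lemma tau_eq_opp:
  assumes "lam \<in> bilin" "a \<in> W1" "b \<in> W2" "v \<in> V"
  shows "\<tau> v m lam a b = Opp (modes lam a b) v m"
proof -
  have inner: "fsum (\<lambda>k::nat. ((-1) powi (h + int k) / of_nat (fact j)
          * z powi (- (int k + int j - 2 * h + m + 2))
          * gbin (int k + int j - 2 * h + m + 1) k) * lam (Y1 x (int k) a) b)
      = ((-1) powi h / of_nat (fact j)) *\<^sub>C res_part lam a b x (2 * h - m - 2 - int j)" for h j x
  proof -
    have "(-1) powi (h + int k) / of_nat (fact j)
          * z powi (- (int k + int j - 2 * h + m + 2))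
          * gbin (int k + int j - 2 * h + m + 1) k
      = ((-1) powi h / of_nat (fact j)) * res_coeff (2 * h - m - 2 - int j) k" for k
    proof -
      \<comment> \<open>With m replaced by 2h - m - 2 - j, the exponent of z and the upper binomial
        index of \<open>res_coeff\<close> become those in \<open>tauP\<close>.\<close>
      have idx: "- (int k + int j - 2 * h + m + 2) = 2 * h - m - 2 - int j - int k"
        "int k + int j - 2 * h + m + 1 = int k - (2 * h - m - 2 - int j) - 1" by simp_all
      show ?thesis unfolding res_coeff_def idx by (simp add: power_int_add)
    qed
    then show ?thesis unfolding res_part_def fsum_scale[symmetric] by (simp add: mult.assoc)
  qed
  have "\<tau> v m lam a b = Opp (res_part lam a b) v m + lam a (Yo V Y \<omega> Y2 v m b)"
    unfolding tauP_def opp_def inner using assms by simp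
  also have "lam a (Yo V Y \<omega> Y2 v m b) = Opp (\<lambda>v m. lam a (Y2 v m b)) v m"
    unfolding opp_finite[OF assms(4) right_part_lin[OF assms(1-3)]] M2.YO_finite[OF assms(4,3)]
    using bilin_right[OF assms(1,2)] assms
    by (simp add: clinear_on_sum[OF _ M2.W_sub] csubspace_sum[OF M2.W_sub] csubspace_scale[OF M2.W_sub]
        M2.YW_in M2.E_comp_V clinear_on_scale)
  also have "Opp (res_part lam a b) v m + \<dots> = Opp (modes lam a b) v m"
    unfolding opp_finite[OF assms(4) right_part_lin[OF assms(1-3)]]
      opp_finite[OF assms(4) res_part_lin[OF assms(1-3)]] opp_finite[OF assms(4) modes_lin[OF assms(1-3)]]
    by (simp add: modes_def algebra_simps flip: sum.distrib)
  finally show ?thesis .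
qed

lemma tau_outside: "a \<notin> W1 \<or> b \<notin> W2 \<Longrightarrow> \<tau> v m lam a b = 0"
  by (auto simp: tauP_def)

lemma opp_cong:
  assumes "v \<in> V" "\<And>n. clinear_on V (\<lambda>v. \<Phi> v n)" "\<And>n. clinear_on V (\<lambda>v. \<Psi> v n)"
    "\<And>v n. v \<in> V \<Longrightarrow> \<Phi> v n = \<Psi> v n"
  shows "Opp \<Phi> v m = Opp \<Psi> v m"
  unfolding opp_finite[OF assms(1,2)] opp_finite[OF assms(1,3)]
  using assms(4) M1.E_comp_V[OF assms(1)] by simp

end

locale quasi_map = tensor_pair V Y vac \<omega> W1 Y1 W2 Y2 z + M3: gen_mod V Y vac \<omega> W3 Y3 ordinary
  for V :: "'v::cvec set" and Y :: "'v \<Rightarrow> int \<Rightarrow> 'v \<Rightarrow> 'v" and vac \<omega> :: 'v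
    and W1 :: "'w1::cvec set" and Y1 :: "'v \<Rightarrow> int \<Rightarrow> 'w1 \<Rightarrow> 'w1"
    and W2 :: "'w2::cvec set" and Y2 :: "'v \<Rightarrow> int \<Rightarrow> 'w2 \<Rightarrow> 'w2"
    and z :: complex
    and W3 :: "'w3::cvec set" and Y3 :: "'v \<Rightarrow> int \<Rightarrow> 'w3 \<Rightarrow> 'w3" and ordinary :: bool +
  fixes F :: "'w1 \<Rightarrow> 'w2 \<Rightarrow> complex \<Rightarrow> 'w3"
  assumes quasi: "quasi_intertwining V \<omega> W1 Y1 W2 Y2 W3 Y3 z F"
begin

abbreviation "W3' \<equiv> contragredient W3 Y3 \<omega>"
abbreviation "Y3' \<equiv> Yprime V Y \<omega> W3 Y3"
abbreviation "FV \<equiv> Fvee W1 W2 F"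

lemma F_in: "a \<in> W1 \<Longrightarrow> b \<in> W2 \<Longrightarrow> F a b \<in> M3.Wbar"
  and F_left: "b \<in> W2 \<Longrightarrow> clinear_on W1 (\<lambda>a. F a b)"
  and F_right: "a \<in> W1 \<Longrightarrow> clinear_on W2 (F a)"
  and F_rel: "\<lbrakk>v \<in> V; a \<in> W1; b \<in> W2\<rbrakk> \<Longrightarrow> Ybar W3 Y3 \<omega> v m (F a b) - F a (Y2 v m b)
         = fsum (\<lambda>k::nat. res_coeff m k *\<^sub>C F (Y1 v (int k) a) b)"
  using quasi unfolding quasi_intertwining_def res_coeff_def by blast+

lemma FV_apply: "a \<in> W1 \<Longrightarrow> b \<in> W2 \<Longrightarrow> FV \<alpha> a b = pairing \<alpha> (F a b)"
  by (simp add: Fvee_def)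

lemma FV_bilin: assumes "\<alpha> \<in> W3'" shows "FV \<alpha> \<in> bilin"
proof -
  note lin = M3.pairing_lin[OF assms]
  have "clinear_on W1 (\<lambda>a. FV \<alpha> a b)" if b: "b \<in> W2" for b
    using b F_left[OF b] M1.W_sub
    by (intro clinear_onI) (simp_all add: FV_apply csubspace_add csubspace_scale clinear_on_add[OF lin]
        clinear_on_scale[OF lin] F_in clinear_on_add[OF F_left[OF b]] clinear_on_scale[OF F_left[OF b]])
  moreover have "clinear_on W2 (FV \<alpha> a)" if a: "a \<in> W1" for a
    using a F_right[OF a] M2.W_sub
    by (intro clinear_onI) (simp_all add: FV_apply csubspace_add csubspace_scale clinear_on_add[OF lin]
        clinear_on_scale[OF lin] F_in clinear_on_add[OF F_right[OF a]] clinear_on_scale[OF F_right[OF a]])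
  ultimately show ?thesis by (auto simp: bilin_forms_def Fvee_def)
qed

text \<open>The quasi-intertwining relation paired with \<alpha>. Only finitely many v_k with k
  nonnegative act nontrivially on a, which allows the pairing to pass through the residue
  sum.\<close>

lemma pairing_Ybar_eq_modes:
  assumes "\<alpha> \<in> W3'" "a \<in> W1" "b \<in> W2" "v \<in> V"
  shows "pairing \<alpha> (Ybar W3 Y3 \<omega> v m (F a b)) = modes (FV \<alpha>) a b v m"
proof -
  note lin = M3.pairing_lin[OF assms(1)]
  let ?g = "\<lambda>k. res_coeff m k *\<^sub>C F (Y1 v (int k) a) b"
  have Fk: "F (Y1 v (int k) a) b \<in> M3.Wbar" for k using F_in M1.YW_in assms by blast
  have g_in: "?g k \<in> M3.Wbar" for k by (intro csubspace_scale M3.completion_sub Fk)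
  have "\<exists>N. \<forall>i\<ge>N. Y1 v (0 + int i) a = 0" by (rule M1.trunc_ev) fact+
  then obtain N where "\<forall>i\<ge>N. Y1 v (int i) a = 0" by auto
  then have "\<forall>k\<ge>N. ?g k = 0" using clinear_on_0[OF F_left[OF assms(3)] M1.W_sub] by simp
  then have g_fin: "finite {k. ?g k \<noteq> 0}" by (intro finite_support_nat) blast
  have "Ybar W3 Y3 \<omega> v m (F a b) = fsum ?g + F a (Y2 v m b)"
    using F_rel[OF assms(4,2,3), of m] by (simp add: algebra_simps)
  then have "pairing \<alpha> (Ybar W3 Y3 \<omega> v m (F a b)) = pairing \<alpha> (fsum ?g) + pairing \<alpha> (F a (Y2 v m b))"
    using assms by (simp only: clinear_on_add[OF lin] csubspace_fsum[OF M3.completion_sub g_in] F_in M2.YW_in)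
  also have "pairing \<alpha> (fsum ?g) = fsum (\<lambda>k. pairing \<alpha> (?g k))"
    by (rule clinear_on_fsum[OF lin M3.completion_sub g_in g_fin])
  also have "\<dots> = res_part (FV \<alpha>) a b v m"
    unfolding res_part_def using assms
    by (simp add: clinear_on_scale[OF lin Fk] FV_apply M1.YW_in)
  finally show ?thesis using assms by (simp add: modes_def FV_apply M2.YW_in)
qed

text \<open>Both sides are transforms of one family of modes: \<open>tauP\<close> of its expression
  through W_1 and W_2, the contragredient action of its expression through W_3.\<close>

lemma tau_FV:
  assumes "\<alpha> \<in> W3'" "v \<in> V" shows "\<tau> v m (FV \<alpha>) = FV (Y3' v m \<alpha>)"
proof (intro ext)
  fix a b
  show "\<tau> v m (FV \<alpha>) a b = FV (Y3' v m \<alpha>) a b"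
  proof (cases "a \<in> W1 \<and> b \<in> W2")
    case True
    then have ab: "a \<in> W1" "b \<in> W2" by auto
    have "\<tau> v m (FV \<alpha>) a b = Opp (modes (FV \<alpha>) a b) v m"
      by (rule tau_eq_opp[OF FV_bilin[OF assms(1)] ab assms(2)])
    also have "\<dots> = Opp (\<lambda>v m. pairing \<alpha> (Ybar W3 Y3 \<omega> v m (F a b))) v m"
      using ab assms
      by (intro opp_cong modes_lin FV_bilin M3.pairing_Ybar_lin F_in) (simp_all add: pairing_Ybar_eq_modes)
    also have "\<dots> = pairing (Y3' v m \<alpha>) (F a b)"
      by (rule M3.opp_pairing_Ybar[OF assms(2,1) F_in[OF ab]])
    finally show ?thesis using ab by (simp add: FV_apply)
  next
    case False
    then show ?thesis by (auto simp: tau_outside Fvee_def)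
  qed
qed

lemma FV_lin: "clinear_on W3' FV"
proof (rule clinear_onI)
  fix \<alpha> \<beta> assume "\<alpha> \<in> W3'" "\<beta> \<in> W3'"
  then show "FV (\<alpha> + \<beta>) = FV \<alpha> + FV \<beta>"
    by (auto simp: fun_eq_iff Fvee_def clinear_on_add[OF M3.pairing_lin_left[OF F_in]])
next
  fix c \<alpha> assume "\<alpha> \<in> W3'"
  then show "FV (c *\<^sub>C \<alpha>) = c *\<^sub>C FV \<alpha>"
    by (auto simp: fun_eq_iff Fvee_def clinear_on_scale[OF M3.pairing_lin_left[OF F_in]])
qed

lemma FV_gen_module: "gen_module ordinary V Y vac \<omega> (FV ` W3') \<tau>"
proof -
  interpret dual: gen_mod V Y vac \<omega> W3' Y3' ordinary
    by unfold_locales (use M3.weak_dual M3.contragredient_module in auto)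
  show ?thesis by (rule dual.hom_image_gen_module[OF FV_lin]) (simp add: tau_FV)
qed

lemma FV_weak: "weak_module V Y vac (FV ` W3') \<tau>"
  using FV_gen_module unfolding gen_module_def by (elim conjE)

lemma FV_tau_module: "tau_module ordinary V Y vac \<omega> W1 Y1 W2 Y2 z (FV ` W3')"
  using FV_gen_module FV_weak FV_bilin unfolding tau_module_def weak_module_def by blast

lemma FV_module_hom: "module_hom V W3' Y3' (FV ` W3') \<tau> FV"
  unfolding module_hom_def using FV_lin tau_FV by simp

text \<open>Read off at one element from the module axioms of the image; the same holds for the
  Jacobi identity below.\<close>

lemma FV_lower_truncation: "\<alpha> \<in> W3' \<Longrightarrow> lower_truncation V Y \<omega> W1 Y1 W2 Y2 z (FV \<alpha>)"
  using FV_weak unfolding weak_module_def lower_truncation_def by blast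

lemma FV_jacobi: assumes "\<alpha> \<in> W3'" shows "tau_jacobi V Y \<omega> W1 Y1 W2 Y2 z (FV \<alpha>)"
proof -
  have "borcherds V Y (FV ` W3') \<tau>" using FV_weak unfolding weak_module_def by (elim conjE)
  then show ?thesis using assms unfolding borcherds_def tau_jacobi_def Let_def by blast
qed

end

section \<open>From tau-modules to quasi-intertwining maps\<close>

locale tau_mod = tensor_pair V Y vac \<omega> W1 Y1 W2 Y2 z
  for V :: "'v::cvec set" and Y :: "'v \<Rightarrow> int \<Rightarrow> 'v \<Rightarrow> 'v" and vac \<omega> :: 'v
    and W1 :: "'w1::cvec set" and Y1 :: "'v \<Rightarrow> int \<Rightarrow> 'w1 \<Rightarrow> 'w1"
    and W2 :: "'w2::cvec set" and Y2 :: "'v \<Rightarrow> int \<Rightarrow> 'w2 \<Rightarrow> 'w2"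
    and z :: complex +
  fixes M :: "('w1 \<Rightarrow> 'w2 \<Rightarrow> complex) set" and ordinary :: bool
  assumes tau_mod: "tau_module ordinary V Y vac \<omega> W1 Y1 W2 Y2 z M"
begin

lemma M_bilin: "lam \<in> M \<Longrightarrow> lam \<in> bilin"
  using tau_mod unfolding tau_module_def by blast

lemma M_gen: "gen_module ordinary V Y vac \<omega> M \<tau>"
  using tau_mod unfolding tau_module_def by (elim conjE)

sublocale Mod: gen_mod V Y vac \<omega> M \<tau> ordinary
  by unfold_locales (use M_gen in \<open>auto simp: gen_module_def\<close>)

abbreviation "M' \<equiv> contragredient M \<tau> \<omega>"
abbreviation "\<tau>' \<equiv> Yprime V Y \<omega> M \<tau>"

sublocale Dual: gen_mod V Y vac \<omega> M' \<tau>' ordinary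
  by unfold_locales (use Mod.weak_dual Mod.contragredient_module in auto)

text \<open>Evaluation at the tensor of a and b, seen as an element of the product of the duals of
  the weight spaces M_[n]. It is 0 off M because elements of a contragredient are.\<close>

definition evF :: "'w1 \<Rightarrow> 'w2 \<Rightarrow> complex \<Rightarrow> ('w1 \<Rightarrow> 'w2 \<Rightarrow> complex) \<Rightarrow> complex" where
  "evF a b n = (\<lambda>lam. if lam \<in> M then Mod.\<pi> n lam a b else 0)"

lemma eval_lin: "clinear_on X (\<lambda>lam :: 'w1 \<Rightarrow> 'w2 \<Rightarrow> complex. lam a b)"
  by (simp add: clinear_on_def)

lemma evF_G': "evF a b n \<in> Mod.G' n"
  unfolding evF_def by (rule Mod.comp_\<pi>_G'[OF eval_lin])

lemma evF_completion: "evF a b \<in> Dual.Wbar"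
  using evF_G' by (simp add: completion_def)

lemma evF_left: assumes "b \<in> W2" shows "clinear_on W1 (\<lambda>a. evF a b)"
proof -
  have "Mod.\<pi> n lam \<in> bilin" if "lam \<in> M" for n lam using M_bilin Mod.\<pi>_W[OF that] .
  then show ?thesis
    by (intro clinear_onI) (auto simp: fun_eq_iff evF_def clinear_on_add[OF bilin_left] assms
        clinear_on_scale[OF bilin_left])
qed

lemma evF_right: assumes "a \<in> W1" shows "clinear_on W2 (evF a)"
proof -
  have "Mod.\<pi> n lam \<in> bilin" if "lam \<in> M" for n lam using M_bilin Mod.\<pi>_W[OF that] .
  then show ?thesis
    by (intro clinear_onI) (auto simp: fun_eq_iff evF_def clinear_on_add[OF bilin_right] assms
        clinear_on_scale[OF bilin_right])
qed

text \<open>Evaluated at (a, b), \<open>tauP\<close> is the transform of \<open>modes\<close>;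
  transforming once more returns \<open>modes\<close>.\<close>

lemma Yo_tau_apply:
  assumes "lam \<in> M" "a \<in> W1" "b \<in> W2" "v \<in> V"
  shows "Mod.YO v m lam a b = modes lam a b v m"
proof -
  have lin: "clinear_on V (\<lambda>v. \<tau> v n lam a b)" for n
    using Mod.YW_lin_v[OF assms(1), of n] by (simp add: clinear_on_def)
  have "Mod.YO v m lam a b = Opp (\<lambda>v n. \<tau> v n lam a b) v m"
    unfolding Mod.YO_finite[OF assms(4,1)] opp_finite[OF assms(4) lin] by (simp add: sum_fun_apply)
  also have "\<dots> = Opp (Opp (modes lam a b)) v m"
    by (intro opp_cong opp_lin modes_lin lin tau_eq_opp M_bilin assms)
  also have "\<dots> = modes lam a b v m"
    by (intro opp_opp modes_lin M_bilin assms)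
  finally show ?thesis .
qed

lemma \<pi>'_apply: assumes "\<beta> \<in> M'" "lam \<in> Mod.G k" shows "Dual.\<pi> k \<beta> lam = \<beta> lam"
proof -
  have "\<beta> lam = fsum (\<lambda>q. Dual.\<pi> q \<beta> lam)"
    by (rule Dual.lin_\<pi>[of "\<lambda>\<beta>. \<beta> lam", OF _ assms(1)]) (simp add: clinear_on_def)
  also have "\<dots> = Dual.\<pi> k \<beta> lam"
  proof (rule fsum_single)
    fix q assume "q \<noteq> k"
    then show "Dual.\<pi> q \<beta> lam = 0"
      using Dual.\<pi>_in[OF assms(1), of q, unfolded Mod.G'_iff, THEN conjunct2, rule_format, of k lam]
        assms(2) by simp
  qed
  finally show ?thesis ..
qed

lemma G'_apply: assumes "\<beta> \<in> Mod.G' n" "lam \<in> M" shows "\<beta> lam = \<beta> (Mod.\<pi> n lam)"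
proof -
  have \<beta>: "\<beta> \<in> M'" using assms(1) Mod.G'_iff by blast
  have "\<beta> lam = fsum (\<lambda>q. \<beta> (Mod.\<pi> q lam))"
    by (rule Mod.lin_\<pi>[OF Mod.dual_lin[OF \<beta>] assms(2)])
  also have "\<dots> = \<beta> (Mod.\<pi> n lam)"
    using Mod.\<pi>_in[OF assms(2)] assms(1) by (intro fsum_single) (auto simp: Mod.G'_iff)
  finally show ?thesis .
qed

text \<open>Tested on lam of weight k, the contribution of the p-th component of \<open>evF\<close>
  is the p-component of the opposite mode of lam, evaluated at (a, b). Summed over p these give the
  full opposite mode, hence \<open>modes\<close>.\<close>

lemma Ybar_evF:
  assumes "v \<in> V" "a \<in> W1" "b \<in> W2" "lam \<in> Mod.G k"
  shows "Ybar M' \<tau>' \<omega> v m (evF a b) k lam = modes lam a b v m"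
proof -
  have lam: "lam \<in> M" using Mod.G_W assms(4) .
  have evF: "evF a b p \<in> M'" for p using evF_G' Mod.G'_iff by blast
  let ?Q = "{p. Dual.\<pi> k (\<tau>' v m (evF a b p)) \<noteq> 0}"
  have Q: "finite ?Q" by (rule Dual.Ybar_finite[OF assms(1) evF_completion])
  have eq: "Dual.\<pi> k (\<tau>' v m (evF a b p)) lam = Mod.\<pi> p (Mod.YO v m lam) a b" for p
  proof -
    have "Dual.\<pi> k (\<tau>' v m (evF a b p)) lam = \<tau>' v m (evF a b p) lam"
      by (rule \<pi>'_apply[OF Mod.Y'_in[OF assms(1) evF] assms(4)])
    then show ?thesis using lam Mod.YO_in[OF assms(1) lam] by (simp add: Mod.Y'_apply evF_def)
  qed
  have "Ybar M' \<tau>' \<omega> v m (evF a b) k lam = (\<Sum>p\<in>?Q. Mod.\<pi> p (Mod.YO v m lam) a b)"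
    unfolding Ybar_def fsum_def by (simp only: sum_fun_apply eq)
  also have "\<dots> = fsum (\<lambda>p. Mod.\<pi> p (Mod.YO v m lam) a b)"
  proof (rule fsum_eq_sum[OF Q, symmetric])
    fix p assume "p \<notin> ?Q"
    then show "Mod.\<pi> p (Mod.YO v m lam) a b = 0" unfolding eq[symmetric] by simp
  qed
  also have "\<dots> = Mod.YO v m lam a b"
    by (rule Mod.lin_\<pi>[OF eval_lin Mod.YO_in[OF assms(1) lam], symmetric])
  finally show ?thesis using Yo_tau_apply[OF lam assms(2,3,1)] by simp
qed

lemma quasi_evF: "quasi_intertwining V \<omega> W1 Y1 W2 Y2 M' \<tau>' z evF"
  unfolding quasi_intertwining_def
proof (intro conjI ballI allI)
  fix v a b and m :: int assume v: "v \<in> V" and a: "a \<in> W1" and b: "b \<in> W2"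
  let ?g = "\<lambda>k::nat. ((-1) ^ k * gbin (int k - m - 1) k * z powi (m - int k)) *\<^sub>C evF (Y1 v (int k) a) b"
  have "\<exists>N. \<forall>i\<ge>N. Y1 v (0 + int i) a = 0" by (rule M1.trunc_ev[OF v a])
  then obtain N where "\<forall>i\<ge>N. Y1 v (int i) a = 0" by auto
  then have "\<forall>i\<ge>N. ?g i = 0" using clinear_on_0[OF evF_left[OF b] M1.W_sub] by simp
  then have fsum_g: "fsum ?g = (\<Sum>i<N. ?g i)" by (intro fsum_eq_sum_lessThan) blast
  have Yb: "Ybar M' \<tau>' \<omega> v m (evF a b) k \<in> Mod.G' k" for k
    unfolding Ybar_def using Mod.Y'_in[OF v] evF_G' Mod.G'_iff
    by (intro csubspace_fsum Dual.G_sub Dual.\<pi>_in) blast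
  have rhs: "(fsum ?g + evF a (Y2 v m b)) k \<in> Mod.G' k" for k
    unfolding fsum_g using evF_G'
    by (simp add: sum_fun_apply) (intro csubspace_add csubspace_sum csubspace_scale Dual.G_sub)
  \<comment> \<open>Both sides lie in the k-th weight space of M' and so vanish on all other weights
    of M; only lam of weight k needs computation.\<close>
  have "Ybar M' \<tau>' \<omega> v m (evF a b) k = (fsum ?g + evF a (Y2 v m b)) k" for k
  proof (rule Mod.dual_eqI)
    show "Ybar M' \<tau>' \<omega> v m (evF a b) k \<in> M'" "(fsum ?g + evF a (Y2 v m b)) k \<in> M'"
      using Yb rhs Mod.G'_iff by blast+
    fix p lam assume lam: "lam \<in> Mod.G p"
    show "Ybar M' \<tau>' \<omega> v m (evF a b) k lam = (fsum ?g + evF a (Y2 v m b)) k lam"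
    proof (cases "p = k")
      case True
      then have lamk: "lam \<in> Mod.G k" and lamM: "lam \<in> M" using lam Mod.G_W by auto
      have ev: "evF a' b' k lam = lam a' b'" for a' b'
        using lamM by (simp add: evF_def Mod.\<pi>_G[OF lamk])
      have "fsum ?g k lam = (\<Sum>i<N. res_coeff m i * lam (Y1 v (int i) a) b)"
        unfolding fsum_g by (simp add: sum_fun_apply ev res_coeff_def)
      also have "\<dots> = res_part lam a b v m"
        unfolding res_part_def
        using \<open>\<forall>i\<ge>N. Y1 v (int i) a = 0\<close> clinear_on_0[OF bilin_left[OF M_bilin[OF lamM] b] M1.W_sub]
        by (intro fsum_eq_sum_lessThan[symmetric]) simp
      finally show ?thesis by (simp add: Ybar_evF[OF v a b lamk] modes_def ev)
    next
      case False
      then show ?thesis using Yb[of k] rhs[of k] lam Mod.G'_iff by auto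
    qed
  qed
  then have "Ybar M' \<tau>' \<omega> v m (evF a b) = fsum ?g + evF a (Y2 v m b)" by (rule ext)
  then show "Ybar M' \<tau>' \<omega> v m (evF a b) - evF a (Y2 v m b) = fsum ?g" by simp
qed (use evF_completion evF_left evF_right in auto)

text \<open>The identification of M'' with M. One inclusion sends lam to evaluation at lam; the
  other reconstructs lam from a functional on M' by dual bases of the finitely many weight spaces in
  its support.\<close>

lemma Fvee_evF_surj: "M = Fvee W1 W2 evF ` contragredient M' \<tau>' \<omega>"
proof
  show "M \<subseteq> Fvee W1 W2 evF ` contragredient M' \<tau>' \<omega>"
  proof
    fix lam assume lam: "lam \<in> M"
    define \<alpha> where "\<alpha> = (\<lambda>\<beta>. if \<beta> \<in> M' then \<beta> lam else 0 :: complex)"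
    have evF: "evF a b p \<in> M'" for a b p using evF_G' Mod.G'_iff by blast
    \<comment> \<open>A functional of weight n sees only the n-component of lam, so evaluation at
      lam lives on the finitely many weights of lam.\<close>
    have "Dual.supp \<alpha> \<subseteq> {n. Mod.\<pi> n lam \<noteq> 0}"
    proof
      fix n assume "n \<in> Dual.supp \<alpha>"
      then obtain \<beta> where \<beta>: "\<beta> \<in> Mod.G' n" "\<alpha> \<beta> \<noteq> 0" by blast
      then have "\<beta> \<in> M'" using Mod.G'_iff by blast
      then have "\<beta> (Mod.\<pi> n lam) \<noteq> 0" using \<beta> G'_apply[OF \<beta>(1) lam] by (simp add: \<alpha>_def)
      then show "n \<in> {n. Mod.\<pi> n lam \<noteq> 0}"
        using clinear_on_0[OF Mod.dual_lin[OF \<open>\<beta> \<in> M'\<close>] Mod.W_sub] by auto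
    qed
    then have "finite (Dual.supp \<alpha>)" using Mod.\<pi>_finite[OF lam] by (rule finite_subset)
    moreover have "clinear_on M' \<alpha>"
      by (rule clinear_onI) (simp_all add: \<alpha>_def csubspace_add[OF Mod.dual_sub] csubspace_scale[OF Mod.dual_sub])
    ultimately have "\<alpha> \<in> contragredient M' \<tau>' \<omega>" unfolding Dual.dual_iff by (simp add: \<alpha>_def)
    moreover have "lam = Fvee W1 W2 evF \<alpha>"
    proof (intro ext)
      fix a b
      show "lam a b = Fvee W1 W2 evF \<alpha> a b"
      proof (cases "a \<in> W1 \<and> b \<in> W2")
        case True
        have "lam a b = fsum (\<lambda>n. Mod.\<pi> n lam a b)" by (rule Mod.lin_\<pi>[OF eval_lin lam])
        then show ?thesis using True evF by (simp add: Fvee_def pairing_def \<alpha>_def) (simp add: evF_def lam)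
      next
        case False
        then show ?thesis using bilin_outside[OF M_bilin[OF lam]] by (auto simp: Fvee_def)
      qed
    qed
    ultimately show "lam \<in> Fvee W1 W2 evF ` contragredient M' \<tau>' \<omega>" by blast
  qed
next
  show "Fvee W1 W2 evF ` contragredient M' \<tau>' \<omega> \<subseteq> M"
  proof
    fix mu assume "mu \<in> Fvee W1 W2 evF ` contragredient M' \<tau>' \<omega>"
    then obtain \<alpha> where \<alpha>: "\<alpha> \<in> contragredient M' \<tau>' \<omega>" and mu: "mu = Fvee W1 W2 evF \<alpha>" by blast
    have "\<forall>n. \<exists>p. Mod.dual_bases n (fst p) (snd p)" using Mod.ex_dual_bases by simp
    from choice[OF this] obtain p where p: "\<And>n. Mod.dual_bases n (fst (p n)) (snd (p n))" by blast
    define B where "B n = fst (p n)" for n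
    define \<delta> where "\<delta> n = snd (p n)" for n
    have bases: "Mod.dual_bases n (B n) (\<delta> n)" for n using p by (simp add: B_def \<delta>_def)
    have BG: "c \<in> Mod.G n" and \<delta>: "\<delta> n c \<in> Mod.G' n" if "c \<in> B n" for n c
      using bases[of n] that unfolding Mod.dual_bases_def by blast+
    have \<delta>M: "\<delta> n c \<in> M'" if "c \<in> B n" for n c using \<delta>[OF that] Mod.G'_iff by blast
    \<comment> \<open>The preimage of \<alpha> under M -> M'': its coordinate at the basis vector c
      is \<alpha> of the coordinate functional of c.\<close>
    define lam where "lam = (\<Sum>n\<in>Dual.supp \<alpha>. \<Sum>c\<in>B n. \<alpha> (\<delta> n c) *\<^sub>C c)"
    have lam: "lam \<in> M" unfolding lam_def
      by (intro csubspace_sum csubspace_scale Mod.W_sub Mod.G_W[OF BG])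
    have "mu = lam"
    proof (intro ext)
      fix a b
      show "mu a b = lam a b"
      proof (cases "a \<in> W1 \<and> b \<in> W2")
        case True
        have term_eq: "\<alpha> (evF a b n) = (\<Sum>c\<in>B n. \<alpha> (\<delta> n c) * c a b)" for n
        proof -
          have "evF a b n = (\<Sum>c\<in>B n. evF a b n c *\<^sub>C \<delta> n c)"
            by (rule Mod.G'_expand[OF evF_G' bases])
          then have "\<alpha> (evF a b n) = \<alpha> (\<Sum>c\<in>B n. evF a b n c *\<^sub>C \<delta> n c)" by simp
          also have "\<dots> = (\<Sum>c\<in>B n. \<alpha> (evF a b n c *\<^sub>C \<delta> n c))"
            by (intro clinear_on_sum[OF Dual.dual_lin[OF \<alpha>] Mod.dual_sub] csubspace_scale Mod.dual_sub \<delta>M)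
          also have "\<dots> = (\<Sum>c\<in>B n. \<alpha> (\<delta> n c) * c a b)"
          proof (intro sum.cong refl)
            fix c assume c: "c \<in> B n"
            have "evF a b n c = c a b"
              using Mod.G_W[OF BG[OF c]] by (simp add: evF_def Mod.\<pi>_G[OF BG[OF c]])
            then show "\<alpha> (evF a b n c *\<^sub>C \<delta> n c) = \<alpha> (\<delta> n c) * c a b"
              by (simp add: clinear_on_scale[OF Dual.dual_lin[OF \<alpha>] \<delta>M[OF c]])
          qed
          finally show ?thesis .
        qed
        have "mu a b = pairing \<alpha> (evF a b)" using True by (simp add: mu Fvee_def)
        also have "\<dots> = (\<Sum>n\<in>Dual.supp \<alpha>. \<alpha> (evF a b n))"
          by (rule Dual.pairing_eq_sum[OF \<alpha> evF_completion Dual.dual_supp[OF \<alpha>] order_refl])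
        also have "\<dots> = lam a b" unfolding term_eq lam_def by (simp add: sum_fun_apply)
        finally show ?thesis .
      next
        case False
        then show ?thesis using bilin_outside[OF M_bilin[OF lam]] by (auto simp: mu Fvee_def)
      qed
    qed
    then show "mu \<in> M" using lam by simp
  qed
qed

end

theorem mainTheorem2:
  fixes V :: "'v::cvec set" and Y :: "'v \<Rightarrow> int \<Rightarrow> 'v \<Rightarrow> 'v" and vac \<omega> :: 'v
    and W1 :: "'w1::cvec set" and Y1 :: "'v \<Rightarrow> int \<Rightarrow> 'w1 \<Rightarrow> 'w1"
    and W2 :: "'w2::cvec set" and Y2 :: "'v \<Rightarrow> int \<Rightarrow> 'w2 \<Rightarrow> 'w2"
    and z :: complex and ordinary :: bool
  assumes VOA: "is_VOA V Y vac \<omega>"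
    and z: "z \<noteq> 0"
    and W1: "gen_module False V Y vac \<omega> W1 Y1"
    and W2: "gen_module False V Y vac \<omega> W2 Y2"
  shows
    "(\<forall>(W3 :: 'w3::cvec set) Y3 F.
        gen_module ordinary V Y vac \<omega> W3 Y3
        \<and> quasi_intertwining V \<omega> W1 Y1 W2 Y2 W3 Y3 z F \<longrightarrow>
        (\<forall>\<alpha>\<in>contragredient W3 Y3 \<omega>.
            lower_truncation V Y \<omega> W1 Y1 W2 Y2 z (Fvee W1 W2 F \<alpha>)
          \<and> tau_jacobi V Y \<omega> W1 Y1 W2 Y2 z (Fvee W1 W2 F \<alpha>))
        \<and> tau_module ordinary V Y vac \<omega> W1 Y1 W2 Y2 z (Fvee W1 W2 F ` contragredient W3 Y3 \<omega>)
        \<and> module_hom V (contragredient W3 Y3 \<omega>) (Yprime V Y \<omega> W3 Y3)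
            (Fvee W1 W2 F ` contragredient W3 Y3 \<omega>) (tauP V Y \<omega> W1 Y1 W2 Y2 z)
            (Fvee W1 W2 F))
     \<and> (\<forall>M. tau_module ordinary V Y vac \<omega> W1 Y1 W2 Y2 z M \<longrightarrow>
          (\<exists>(W3 :: (('w1 \<Rightarrow> 'w2 \<Rightarrow> complex) \<Rightarrow> complex) set) Y3 F.
              gen_module ordinary V Y vac \<omega> W3 Y3
            \<and> quasi_intertwining V \<omega> W1 Y1 W2 Y2 W3 Y3 z F
            \<and> M = Fvee W1 W2 F ` contragredient W3 Y3 \<omega>))"
proof -
  have weak: "weak_module V Y vac W1 Y1" "weak_module V Y vac W2 Y2"
    using W1 W2 by (simp_all add: gen_module_def)
  interpret tensor_pair V Y vac \<omega> W1 Y1 W2 Y2 z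
    by unfold_locales (use VOA weak in auto)
  show ?thesis
  proof (intro conjI allI impI; (elim conjE)?)
    fix W3 :: "'w3 set" and Y3 F
    assume W3: "gen_module ordinary V Y vac \<omega> W3 Y3"
      and F: "quasi_intertwining V \<omega> W1 Y1 W2 Y2 W3 Y3 z F"
    interpret quasi_map V Y vac \<omega> W1 Y1 W2 Y2 z W3 Y3 ordinary F
      by unfold_locales (use W3 F in \<open>auto simp: gen_module_def\<close>)
    show "\<forall>\<alpha>\<in>contragredient W3 Y3 \<omega>.
            lower_truncation V Y \<omega> W1 Y1 W2 Y2 z (Fvee W1 W2 F \<alpha>)
          \<and> tau_jacobi V Y \<omega> W1 Y1 W2 Y2 z (Fvee W1 W2 F \<alpha>)"
      using FV_lower_truncation FV_jacobi by blast
    show "tau_module ordinary V Y vac \<omega> W1 Y1 W2 Y2 z (Fvee W1 W2 F ` contragredient W3 Y3 \<omega>)"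
      by (rule FV_tau_module)
    show "module_hom V (contragredient W3 Y3 \<omega>) (Yprime V Y \<omega> W3 Y3)
            (Fvee W1 W2 F ` contragredient W3 Y3 \<omega>) (tauP V Y \<omega> W1 Y1 W2 Y2 z) (Fvee W1 W2 F)"
      by (rule FV_module_hom)
  next
    fix M assume M: "tau_module ordinary V Y vac \<omega> W1 Y1 W2 Y2 z M"
    interpret tau_mod V Y vac \<omega> W1 Y1 W2 Y2 z M ordinary
      by unfold_locales (rule M)
    show "\<exists>(W3 :: (('w1 \<Rightarrow> 'w2 \<Rightarrow> complex) \<Rightarrow> complex) set) Y3 F.
              gen_module ordinary V Y vac \<omega> W3 Y3
            \<and> quasi_intertwining V \<omega> W1 Y1 W2 Y2 W3 Y3 z F
            \<and> M = Fvee W1 W2 F ` contragredient W3 Y3 \<omega>"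
      using Mod.contragredient_module quasi_evF Fvee_evF_surj by blast
  qed
qed

end
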